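(* Fix six distinct odd primes $11\le M_1<\cdots<M_6$ and an integer $L>\sum_{i=1}^6M_i$. Let $k\equiv1\pmod4$ be a sufficiently large prime, let $\delta=10^3(\log k)^{1/5}k^{-1/5}$, and let $H=\mathrm{Cay}(\mathbb Z_k,S)$ be the Cayley graph constructed in the context. If $X\subseteq\mathbb Z_k$ satisfies $|X|\ge(1-\delta)k$ and $f:H[X]\to H$ is an induced embedding, then there are $\sigma\in\{\pm1\}$ and $b\in\mathbb Z_k$ such that $$f(x)=\sigma x+b\qquad\text{for every }x\in X.$$ Thus $f$ is the restriction to $X$ of a translation or reflection of $\mathbb Z_k$.
   Context: All logarithms are natural. For $S\subseteq\mathbb Z_k$ with $S=-S$, $0\notin S$, $\mathrm{Cay}(\mathbb Z_k,S)$ is the graph on $\mathbb Z_k$ with distinct $x,y$ adjacent iff $y-x\in S$. An induced embedding $f:H[X]\to H$ is an injective map $X\to V(H)$ such that, for all distinct $x,y\in X$, $xy\in E(H)$ iff $f(x)f(y)\in E(H)$. Construction of $H$. The greedy Sidon sequence $(a_j)_{j\ge1}$: $a_1=1$ and, for $j\ge2$, $a_j$ is the smallest integer larger than $a_{j-1}$ such that $\{a_1,\dots,a_j\}$ is Sidon (a set $A$ of integers is Sidon if $a+b=c+d$ with $a,b,c,d\in A$ implies $\{a,b\}=\{c,d\}$). With $M_1,\dots,M_6,L$ fixed (independent of $k$), put $g_j=La_j$ for $1\le j\le L$, $G_0=\{g_1,\dots,g_L\}$, $m_0=0$, $m_i=\sum_{h=1}^iM_h$, and $G_i=\{g_{m_{i-1}+1},\dots,g_{m_i}\}$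 for $1\le i\le 6$. For a sufficiently large prime $k\equiv1\pmod4$, let $T_i=\lfloor k^{i/7}\rfloor$ for $1\le i\le6$, and regard all these integers as elements of $\mathbb Z_k$. Let $B_0=(G_0+\{0,1\})\cup(-G_0-\{0,1\})$, $B_i=G_i+\{0,1\}$ for $1\le i\le6$, and $A_0=B_0\cup\bigcup_{i=1}^6\big((T_i+B_i)\cup(-T_i-B_i)\big)$, where $A\pm B=\{a\pm b:a\in A,b\in B\}$. Let $\chi$ be the Legendre symbol modulo $k$ (with $\chi(0)=0$) and, for a finite set $A\subseteq\mathbb Z_k$, $Q(A)=\{x\in\mathbb Z_k:\chi(x+a)=1\text{ for every }a\in A\}$. Let $D^+=\bigcup_{i=1}^6\{\pm(T_i+1)\}$, $D^-=\bigcup_{i=1}^6\{\pm(T_i-1)\}$, and $S=\big((Q(A_0)\setminus\{0\})\cup D^+\big)\setminus D^-$. Then $H=\mathrm{Cay}(\mathbb Z_k,S)$. *)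

theory Defs
  imports Complex_Main "HOL-Number_Theory.Number_Theory"
begin

section \<open>Cayley graphs on cyclic groups and induced embeddings\<close>

text \<open>The group of integers modulo \<open>k\<close> is represented by the canonical residues
  \<open>0, \<dots>, k - 1\<close>, with all arithmetic reduced modulo \<open>k\<close>.\<close>

definition Zmod :: "nat \<Rightarrow> int set" where
  "Zmod k = {0..<int k}"

definition residues_of :: "nat \<Rightarrow> int set \<Rightarrow> int set" where
  "residues_of k A = (\<lambda>a. a mod int k) ` A"

text \<open>\<open>S\<close> consists of canonical residues. Symmetry of \<open>S\<close> is not part of the definition; for the
  connection set used here it is proved in \<open>cayley_adj_conn_set_sym\<close> below. Membership of 0
  in \<open>S\<close> is irrelevant since only distinct vertices are adjacent.\<close>

definition cayley_adj :: "nat \<Rightarrow> int set \<Rightarrow> int \<Rightarrow> int \<Rightarrow> bool" where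
  "cayley_adj k S x y \<longleftrightarrow> x \<in> Zmod k \<and> y \<in> Zmod k \<and> x \<noteq> y \<and> (y - x) mod int k \<in> S"

definition induced_embedding ::
    "'a set \<Rightarrow> ('a \<Rightarrow> 'a \<Rightarrow> bool) \<Rightarrow> 'a set \<Rightarrow> ('a \<Rightarrow> 'a) \<Rightarrow> bool" where
  "induced_embedding V adj X f \<longleftrightarrow>
     X \<subseteq> V \<and> f ` X \<subseteq> V \<and> inj_on f X \<and>
     (\<forall>x\<in>X. \<forall>y\<in>X. x \<noteq> y \<longrightarrow> (adj x y \<longleftrightarrow> adj (f x) (f y)))"

section \<open>The greedy Sidon sequence\<close>

definition Sidon :: "'a::ab_semigroup_add set \<Rightarrow> bool" where
  "Sidon A \<longleftrightarrow> (\<forall>a\<in>A. \<forall>b\<in>A. \<forall>c\<in>A. \<forall>d\<in>A. a + b = c + d \<longrightarrow> {a, b} = {c, d})"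

text \<open>The sequence is indexed from 1; the value at 0 is a dummy.\<close>

fun greedy_sidon :: "nat \<Rightarrow> nat" where
  "greedy_sidon j =
     (if j \<le> 1 then 1
      else (LEAST n. greedy_sidon (j - 1) < n \<and> Sidon (insert n (greedy_sidon ` {1..j - 1}))))"

declare greedy_sidon.simps [simp del]

section \<open>The construction\<close>

text \<open>Throughout, \<open>M i\<close> is used for \<open>1 \<le> i \<le> 6\<close> only. The sets \<open>G_set\<close>, \<open>B_set\<close>, \<open>B0_set\<close> are
  sets of integers; reduction modulo \<open>k\<close> takes place in \<open>A0_set\<close>, \<open>D_plus\<close> and \<open>D_minus\<close>.\<close>

definition g_val :: "nat \<Rightarrow> nat \<Rightarrow> int" where
  "g_val L j = int L * int (greedy_sidon j)"

definition m_sum :: "(nat \<Rightarrow> nat) \<Rightarrow> nat \<Rightarrow> nat" where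
  "m_sum M i = (\<Sum>h = 1..i. M h)"

definition G0_set :: "nat \<Rightarrow> int set" where
  "G0_set L = g_val L ` {1..L}"

definition G_set :: "(nat \<Rightarrow> nat) \<Rightarrow> nat \<Rightarrow> nat \<Rightarrow> int set" where
  "G_set M L i = g_val L ` {m_sum M (i - 1) + 1..m_sum M i}"

definition B0_set :: "nat \<Rightarrow> int set" where
  "B0_set L = {g + e | g e. g \<in> G0_set L \<and> e \<in> {0, 1}} \<union>
              {- g - e | g e. g \<in> G0_set L \<and> e \<in> {0, 1}}"

definition B_set :: "(nat \<Rightarrow> nat) \<Rightarrow> nat \<Rightarrow> nat \<Rightarrow> int set" where
  "B_set M L i = {g + e | g e. g \<in> G_set M L i \<and> e \<in> {0, 1}}"

definition T_val :: "nat \<Rightarrow> nat \<Rightarrow> int" where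
  "T_val k i = \<lfloor>real k powr (real i / 7)\<rfloor>"

definition A0_set :: "(nat \<Rightarrow> nat) \<Rightarrow> nat \<Rightarrow> nat \<Rightarrow> int set" where
  "A0_set M L k = residues_of k
     (B0_set L \<union>
      (\<Union>i\<in>{1..6}. {T_val k i + b | b. b \<in> B_set M L i} \<union> {- T_val k i - b | b. b \<in> B_set M L i}))"

definition Q_set :: "nat \<Rightarrow> int set \<Rightarrow> int set" where
  "Q_set k A = {x \<in> Zmod k. \<forall>a\<in>A. Legendre (x + a) (int k) = 1}"

definition D_plus :: "nat \<Rightarrow> int set" where
  "D_plus k = residues_of k (\<Union>i\<in>{1..6}. {T_val k i + 1, - (T_val k i + 1)})"

definition D_minus :: "nat \<Rightarrow> int set" where
  "D_minus k = residues_of k (\<Union>i\<in>{1..6}. {T_val k i - 1, - (T_val k i - 1)})"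

definition conn_set :: "(nat \<Rightarrow> nat) \<Rightarrow> nat \<Rightarrow> nat \<Rightarrow> int set" where
  "conn_set M L k = ((Q_set k (A0_set M L k) - {0}) \<union> D_plus k) - D_minus k"

abbreviation H_adj :: "(nat \<Rightarrow> nat) \<Rightarrow> nat \<Rightarrow> nat \<Rightarrow> int \<Rightarrow> int \<Rightarrow> bool" where
  "H_adj M L k \<equiv> cayley_adj k (conn_set M L k)"

definition delta :: "nat \<Rightarrow> real" where
  "delta k = 10 ^ 3 * ln (real k) powr (1 / 5) * real k powr (- (1 / 5))"

section \<open>Symmetry of the connection set\<close>

lemma leg_minus: assumes "prime k" "[k = 1] (mod 4)" "k > 2"
  shows "Legendre (-x) (int k) = 1 \<longleftrightarrow> Legendre x (int k) = 1"
proof -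
  have "even ((k-1) div 2)" using assms(2,3) unfolding cong_def by presburger
  have "[Legendre (-1) (int k) = (-1)^((k-1) div 2)] (mod int k)"
    using euler_criterion[of k "-1"] assms by (simp)
  then have c: "[Legendre (-1) (int k) = 1] (mod int k)" using \<open>even _\<close> by simp
  have "\<not> [-1 = 1] (mod int k)" using assms(3) by (auto simp: cong_iff_dvd_diff dest: zdvd_imp_le)
  moreover have "\<not> [0 = 1] (mod int k)" using assms(3) by (auto simp: cong_iff_dvd_diff dest: zdvd_imp_le)
  ultimately have "Legendre (-1) (int k) = 1" using c unfolding Legendre_def by (auto split: if_splits)
  then obtain y where y: "[y^2 = -1] (mod int k)" unfolding Legendre_def QuadRes_def by (auto split: if_splits)
  have q: "QuadRes (int k) (-x)" if h: "QuadRes (int k) x" for x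
  proof -
    obtain z where "[z^2 = x] (mod int k)" using h unfolding QuadRes_def by auto
    from cong_mult[OF y this] have "[(y*z)^2 = -x] (mod int k)" by (simp add: power_mult_distrib)
    then show ?thesis unfolding QuadRes_def by blast
  qed
  have "QuadRes (int k) (-x) \<longleftrightarrow> QuadRes (int k) x" using q[of x] q[of "-x"] by auto
  moreover have "[-x = 0] (mod int k) \<longleftrightarrow> [x = 0] (mod int k)" by (simp add: cong_0_iff)
  ultimately show ?thesis unfolding Legendre_def by auto
qed

lemma Legendre_cong: "[a = b] (mod p) \<Longrightarrow> Legendre a p = Legendre b p"
  unfolding Legendre_def QuadRes_def cong_def by simp

lemma res_sym: assumes "\<And>a. a \<in> A \<Longrightarrow> - a \<in> A" "x \<in> residues_of k A"
  shows "(- x) mod int k \<in> residues_of k A"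
  using assms unfolding residues_of_def by (auto simp: mod_minus_eq)

lemma A0_sym: "x \<in> A0_set M L k \<Longrightarrow> (- x) mod int k \<in> A0_set M L k"
  unfolding A0_set_def
proof (rule res_sym, goal_cases)
  case (1 a)
  then consider (p) g e where "g \<in> G0_set L" "e \<in> {0,1}" "a = g + e"
    | (m) g e where "g \<in> G0_set L" "e \<in> {0,1}" "a = - g - e"
    | (tp) i b where "i \<in> {1..6}" "b \<in> B_set M L i" "a = T_val k i + b"
    | (tm) i b where "i \<in> {1..6}" "b \<in> B_set M L i" "a = - T_val k i - b"
    unfolding B0_set_def by blast
  then show ?case
  proof cases
    case p then have "- a = - g - e" by simp
    then show ?thesis unfolding B0_set_def using p by blast
  next
    case m then have "- a = g + e" by simp
    then show ?thesis unfolding B0_set_def using m by blast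
  next
    case tp then have "- a = - T_val k i - b" by simp
    then show ?thesis using tp by blast
  next
    case tm then have "- a = T_val k i + b" by simp
    then show ?thesis using tm by blast
  qed
qed

lemma D_sym: "x \<in> D_plus k \<Longrightarrow> (- x) mod int k \<in> D_plus k"
   "x \<in> D_minus k \<Longrightarrow> (- x) mod int k \<in> D_minus k"
  unfolding D_plus_def D_minus_def by (rule res_sym; force)+

lemma neg_neg: "x \<in> Zmod k \<Longrightarrow> (- ((- x) mod int k)) mod int k = x"
  unfolding Zmod_def by (simp add: mod_minus_eq)

lemma conn_sym:
  assumes "prime k" "[k = 1] (mod 4)" "x \<in> conn_set M L k"
  shows "(- x) mod int k \<in> conn_set M L k"
proof -
  have k2: "k > 2" using prime_ge_2_nat[OF assms(1)] assms(2) by (cases "k = 2") (auto simp: cong_def)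
  have xZ: "x \<in> Zmod k" using assms(3) k2
    unfolding conn_set_def Q_set_def D_plus_def residues_of_def Zmod_def by auto
  have Q: "(- x) mod int k \<in> Q_set k (A0_set M L k) - {0}" if xQ: "x \<in> Q_set k (A0_set M L k) - {0}"
  proof -
    have "Legendre ((- x) mod int k + a) (int k) = 1" if "a \<in> A0_set M L k" for a
    proof -
      have "Legendre (x + (- a) mod int k) (int k) = 1"
        using A0_sym[OF that] xQ unfolding Q_set_def by auto
      also have "Legendre (x + (- a) mod int k) (int k) = Legendre (x - a) (int k)"
        by (rule Legendre_cong) (simp add: cong_def mod_simps)
      finally have "Legendre (- (x - a)) (int k) = 1" using leg_minus[OF assms(1,2) k2] by blast
      also have "Legendre (- (x - a)) (int k) = Legendre ((- x) mod int k + a) (int k)"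
        by (rule Legendre_cong) (simp add: cong_def mod_simps)
      finally show ?thesis .
    qed
    moreover have "(- x) mod int k \<noteq> 0" using neg_neg[OF xZ] xQ by auto
    ultimately show ?thesis using k2 unfolding Q_set_def Zmod_def by auto
  qed
  have "(- x) mod int k \<notin> D_minus k"
    using D_sym(2)[of "(- x) mod int k" k] neg_neg[OF xZ] assms(3) unfolding conn_set_def by auto
  then show ?thesis using Q D_sym(1)[of x k] assms(3) unfolding conn_set_def by (elim DiffE UnE) (simp_all only: Diff_iff Un_iff, simp_all)
qed

lemma cayley_adj_conn_set_sym:
  assumes "prime k" "[k = 1] (mod 4)" "H_adj M L k x y"
  shows "H_adj M L k y x"
  using assms(3) conn_sym[OF assms(1,2), of "(y - x) mod int k" M L]
  unfolding cayley_adj_def by (auto simp: mod_minus_eq)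

end

theory Submission
  imports Defs "HOL-Computational_Algebra.Computational_Algebra" "HOL-Real_Asymp.Real_Asymp"
begin

text \<open>Up to an error \<open>o(k)\<close>, two vertices \<open>u\<close>, \<open>v\<close> of \<open>H\<close> have
  \<open>k 2\<^sup>r 4\<^sup>-\<^sup>s\<close> common neighbours, where \<open>s\<close> is the size of \<open>A\<^sub>0\<close> and \<open>r\<close> is the number of
  representations of \<open>u - v\<close> as a difference of two elements of \<open>A\<^sub>0\<close>. This needs only an \<open>o(k)\<close> bound
  for Legendre symbol sums of products of boundedly many distinct linear factors, which a
  weak form of Stepanov's method provides. As codegrees survive an
  induced embedding up to the number of missing vertices, so does \<open>r\<close>. By the Sidon property and the lacunarity of the
  \<open>T\<^sub>i\<close>, the values \<open>r(1)\<close> and \<open>r(T\<^sub>i)\<close> are attained only at \<open>\<plusminus>1\<close> and \<open>\<plusminus>T\<^sub>i\<close>, hence \<open>f\<close> maps steps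
  \<open>1\<close> and \<open>T\<^sub>i\<close> to plus or minus themselves. Since \<open>T\<^sub>i + 1 \<in> S\<close> and \<open>T\<^sub>i - 1 \<notin> S\<close>, neighbouring steps
  have the same sign. Every residue is a sum of \<open>O(k\<^sup>1\<^sup>/\<^sup>7)\<close> such steps, and the missing vertices
  spoil only \<open>o(k)\<close> of the resulting paths from a suitable base point because \<open>1/7 < 1/5\<close>. Thus \<open>f\<close> is affine outside
  \<open>o(k)\<close> points, and a vertex is determined by its neighbourhood up to \<open>o(k)\<close> errors.\<close>

section \<open>Polynomials modulo a prime\<close>

text \<open>The parameters are chosen to separate the values of r. Let m be the sum of the
  \<open>M i\<close>. As L > m, the index blocks behind G_1, ..., G_6 lie inside that of G_0, and
  they are pairwise disjoint. A Sidon element therefore cancels in a difference of two elements of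
  \<open>A0\<close> only within one block or between block i and block 0. This gives r(0) = 4(L +
  m), r(1) = 2(L + m), r(T_i) = 4 M_i and r(T_i + 1) = r(T_i - 1) = 2 M_i; residues not of this form
  up to sign have r \<le> 32. The bound 11 lifts 4 M_i above 32, oddness excludes 4 M_i = 2 M_j,
  distinctness tells the T_i apart, and L > m keeps 4 M_i below 2(L + m). None of these numbers
  depends on k, so codegrees belonging to different values of r differ by a fixed proportion of k.
  Hence the order of vanishing in Stepanov's method can stay bounded as k grows, which keeps the
  auxiliary polynomial elementary.\<close>

lemma pderiv_const_dvd: "[:c:] dvd (P :: int poly) \<Longrightarrow> [:c:] dvd pderiv P"
  by (auto simp: const_poly_dvd_iff coeff_pderiv)

lemma higher_pderiv_const_dvd: "[:c:] dvd (P :: int poly) \<Longrightarrow> [:c:] dvd (pderiv ^^ i) P"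
  by (induction i) (auto intro: pderiv_const_dvd)

lemma const_dvd_poly: "[:c:] dvd (P :: int poly) \<Longrightarrow> c dvd poly P x"
  by (auto elim!: dvdE)

text \<open>Leibniz's rule: only two terms survive, because the second derivative of a linear factor
  vanishes. At \<open>i = 0\<close> the truncated \<open>i - 1\<close> is harmless, since its
  coefficient is 0.\<close>

lemma higher_pderiv_linear_mult:
  fixes Q :: "int poly"
  shows "(pderiv ^^ i) ([:- x, 1:] * Q)
    = [:- x, 1:] * (pderiv ^^ i) Q + of_nat i * (pderiv ^^ (i - 1)) Q"
proof (induction i)
  case (Suc i)
  have "(pderiv ^^ Suc i) ([:- x, 1:] * Q)
    = pderiv ([:- x, 1:] * (pderiv ^^ i) Q + of_nat i * (pderiv ^^ (i - 1)) Q)"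
    using Suc by simp
  also have "\<dots> = [:- x, 1:] * (pderiv ^^ Suc i) Q + (pderiv ^^ i) Q
      + of_nat i * pderiv ((pderiv ^^ (i - 1)) Q)"
    by (simp only: pderiv_add pderiv_mult pderiv_of_nat)
       (simp add: pderiv_pCons algebra_simps)
  also have "of_nat i * pderiv ((pderiv ^^ (i - 1)) Q) = of_nat i * (pderiv ^^ i) Q"
    by (cases i) auto
  finally show ?case by (simp add: algebra_simps)
qed simp

lemma higher_pderiv_diff: "(pderiv ^^ i) (P - Q :: int poly) = (pderiv ^^ i) P - (pderiv ^^ i) Q"
  by (induction i) (auto simp: pderiv_diff)

text \<open>Polynomials over the field with k elements are represented by integer polynomials, and
  \<open>[:int k:] dvd P\<close> says that P is zero over that field. Primality of the constant is
  the absence of zero divisors.\<close>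

lemma prime_int_poly: "prime k \<Longrightarrow> prime_elem [:int k:]"
  by (simp add: prime_elem_const_poly_iff)

lemma const_dvd_mult_iff:
  "prime k \<Longrightarrow> [:int k:] dvd P * Q \<longleftrightarrow> [:int k:] dvd P \<or> [:int k:] dvd Q"
  by (rule prime_elem_dvd_mult_iff[OF prime_int_poly])

lemma not_dvd_small: "\<lbrakk>x \<in> {0..<int k}; y \<in> {0..<int k}; x \<noteq> y\<rbrakk> \<Longrightarrow> \<not> int k dvd y - x"
  by (metis atLeastLessThan_iff mod_eq_dvd_iff mod_pos_pos_trivial)

lemma not_const_dvd_linear: "prime k \<Longrightarrow> \<not> [:int k:] dvd [:a, 1:]"
proof
  assume k: "prime k" and "[:int k:] dvd [:a, 1:]"
  then have "int k dvd coeff [:a, 1:] 1" unfolding const_poly_dvd_iff by blast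
  then show False using prime_gt_1_nat[OF k] by simp
qed

lemma linear_factor_mod:
  assumes "int k dvd poly P x"
  shows "[:int k:] dvd P - [:- x, 1:] * synthetic_div P x"
proof -
  have "P - [:- x, 1:] * synthetic_div P x = [:poly P x:]"
    using synthetic_div_correct'[of x P] by (simp add: algebra_simps)
  then show ?thesis using assms by simp
qed

text \<open>Induction on the total multiplicity, splitting off one factor X - x modulo k. At x
  itself the derivatives of P are those of the quotient, shifted by one and multiplied by
  \<open>Suc i\<close>, which is invertible because multiplicities are at most k. At any other point
  y the unit y - x lets the vanishing orders pass to the quotient unchanged.\<close>

lemma sum_multiplicities_le_degree:
  fixes P :: "int poly" and \<mu> :: "int \<Rightarrow> nat"
  assumes k: "prime k" and S: "finite S" "S \<subseteq> {0..<int k}"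
  shows "\<lbrakk>\<not> [:int k:] dvd P; \<forall>x\<in>S. \<mu> x \<le> k;
    \<forall>x\<in>S. \<forall>i<\<mu> x. int k dvd poly ((pderiv ^^ i) P) x\<rbrakk> \<Longrightarrow> sum \<mu> S \<le> degree P"
proof (induction "sum \<mu> S" arbitrary: \<mu> P)
  case (Suc n)
  then obtain x where x: "x \<in> S" "\<mu> x > 0"
    by (metis Suc_neq_Zero gr0I sum.neutral)
  note hP = Suc.prems(3)
  define Q where "Q = synthetic_div P x"
  have P0: "int k dvd poly P x" using Suc.prems(3) x by fastforce
  have PQ: "[:int k:] dvd P - [:- x, 1:] * Q" unfolding Q_def by (rule linear_factor_mod[OF P0])
  have deg0: "degree P \<noteq> 0"
  proof
    assume "degree P = 0"
    then obtain c where "P = [:c:]" by (auto elim: degree_eq_zeroE)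
    then show False using P0 Suc.prems(1) by simp
  qed
  have Qn: "\<not> [:int k:] dvd Q"
  proof
    assume "[:int k:] dvd Q"
    then have "[:int k:] dvd [:- x, 1:] * Q" by (rule dvd_mult)
    with PQ have "[:int k:] dvd P" by (simp only: dvd_diff_left_iff)
    then show False using Suc.prems(1) by contradiction
  qed
  have eq: "int k dvd poly ((pderiv ^^ i) P) y -
      ((y - x) * poly ((pderiv ^^ i) Q) y + int i * poly ((pderiv ^^ (i - 1)) Q) y)" for i y
  proof -
    have "[:int k:] dvd (pderiv ^^ i) P - ([:- x, 1:] * (pderiv ^^ i) Q + of_nat i * (pderiv ^^ (i - 1)) Q)"
      using higher_pderiv_const_dvd[OF PQ, of i] by (simp only: higher_pderiv_diff higher_pderiv_linear_mult)
    from const_dvd_poly[OF this, of y] show ?thesis by (simp add: algebra_simps)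
  qed
  have pk: "prime (int k)" using k by simp
  define \<mu>' where "\<mu>' = \<mu>(x := \<mu> x - 1)"
  have "sum \<mu> S = \<mu> x + sum \<mu> (S - {x})" using S x by (simp add: sum.remove)
  moreover have "sum \<mu>' S = \<mu> x - 1 + sum \<mu>' (S - {x})" using S x by (simp add: sum.remove \<mu>'_def)
  moreover have "sum \<mu>' (S - {x}) = sum \<mu> (S - {x})" by (rule sum.cong) (auto simp: \<mu>'_def)
  ultimately have sum': "n = sum \<mu>' S" using Suc.hyps(2) x by simp
  have "sum \<mu>' S \<le> degree Q"
  proof (rule Suc.hyps(1)[OF sum' Qn])
    show "\<forall>y\<in>S. \<mu>' y \<le> k" using Suc.prems(2) unfolding \<mu>'_def by auto
    show "\<forall>y\<in>S. \<forall>i<\<mu>' y. int k dvd poly ((pderiv ^^ i) Q) y"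
    proof (intro ballI allI impI)
      fix y i assume y: "y \<in> S" and i: "i < \<mu>' y"
      show "int k dvd poly ((pderiv ^^ i) Q) y"
      proof (cases "y = x")
        case True
        then have i': "Suc i < \<mu> x" using i unfolding \<mu>'_def by auto
        then have "int k dvd poly ((pderiv ^^ Suc i) P) x" using Suc.prems(3) x by blast
        with eq[of "Suc i" x] have "int k dvd int (Suc i) * poly ((pderiv ^^ i) Q) x"
          by (simp del: funpow.simps add: dvd_diff_commute dvd_diff_right_iff)
        moreover have "\<not> int k dvd int (Suc i)"
          using i' Suc.prems(2) x by (metis int_dvd_int_iff dvd_imp_le le_trans linorder_not_le zero_less_Suc)
        ultimately show ?thesis using pk True by (simp add: prime_dvd_mult_iff del: of_nat_Suc)
      next
        case False
        then have nd: "\<not> int k dvd y - x" using not_dvd_small[of x k y] x y S by blast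
        from False have iy: "i < \<mu> y" using i unfolding \<mu>'_def by auto
        then show ?thesis
        proof (induction i)
          case 0
          then have "int k dvd poly ((pderiv ^^ 0) P) y" using Suc.prems(3) y by blast
          with eq[of 0 y] have "int k dvd (y - x) * poly Q y"
            by (simp add: dvd_diff_right_iff)
          then show ?case using nd pk by (simp add: prime_dvd_mult_iff del: funpow.simps)
        next
          case (Suc i)
          then have "int k dvd poly ((pderiv ^^ Suc i) P) y" using hP y by blast
          with eq[of "Suc i" y] have "int k dvd (y - x) * poly ((pderiv ^^ Suc i) Q) y + int (Suc i) * poly ((pderiv ^^ i) Q) y"
            by (simp del: funpow.simps add: dvd_diff_right_iff)
          moreover have "int k dvd int (Suc i) * poly ((pderiv ^^ i) Q) y" using Suc by simp
          ultimately have "int k dvd (y - x) * poly ((pderiv ^^ Suc i) Q) y"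
            using dvd_add_left_iff by blast
          then show ?case using nd pk by (simp add: prime_dvd_mult_iff del: funpow.simps)
        qed
      qed
    qed
  qed
  then show ?case using sum' Suc.hyps(2) degree_synthetic_div[of P x] deg0 unfolding Q_def by simp
qed simp

section \<open>Derivatives of the auxiliary polynomial\<close>

text \<open>The cofactor left when \<open>f ^ (c - i)\<close> is split off from the i-th derivative
  of \<open>f ^ c * u\<close>. It is additive in u, and its degree grows by at most the degree of f
  per step whatever c is; thus the large exponent q never enters the number of linear
  conditions.\<close>

primrec deriv_factor :: "int poly \<Rightarrow> nat \<Rightarrow> nat \<Rightarrow> int poly \<Rightarrow> int poly" where
  "deriv_factor f c 0 u = u"
| "deriv_factor f c (Suc i) u =
     smult (int (c - i)) (pderiv f) * deriv_factor f c i u + f * pderiv (deriv_factor f c i u)"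

lemma deriv_factor_diff:
  "deriv_factor f c i (u - v) = deriv_factor f c i u - deriv_factor f c i v"
proof (induction i)
  case (Suc i)
  show ?case
    by (simp add: Suc pderiv_diff right_diff_distrib)
qed simp

lemma degree_deriv_factor: "degree (deriv_factor f c i u) \<le> degree u + i * degree f"
proof (induction i)
  case (Suc i)
  let ?v = "deriv_factor f c i u"
  have "degree (smult (int (c - i)) (pderiv f) * ?v) \<le> degree f + degree ?v"
    by (rule order_trans[OF degree_mult_le]) (simp add: degree_pderiv degree_smult_le)
  moreover have "degree (f * pderiv ?v) \<le> degree f + degree ?v"
    by (rule order_trans[OF degree_mult_le]) (simp add: degree_pderiv)
  ultimately have "degree (deriv_factor f c (Suc i) u) \<le> degree f + degree ?v"
    by (simp add: degree_add_le)
  then show ?case using Suc by simp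
qed simp

text \<open>The factor \<open>X ^ (k * j)\<close> behaves like a constant because its derivative vanishes modulo \<open>k\<close>.\<close>

lemma higher_pderiv_deriv_factor:
  assumes "i \<le> c"
  shows "[:int k:] dvd (pderiv ^^ i) (f ^ c * u * monom 1 (k * j))
    - f ^ (c - i) * deriv_factor f c i u * monom 1 (k * j)"
  using assms
proof (induction i)
  case (Suc i)
  let ?v = "deriv_factor f c i u" and ?X = "monom 1 (k * j) :: int poly"
  obtain d where d: "c - i = Suc d" using Suc.prems by (metis Suc_diff_Suc Suc_le_lessD)
  have cd: "c - Suc i = d" using d by simp
  have "[:int k:] dvd (pderiv ^^ i) (f ^ c * u * ?X) - f ^ (c - i) * ?v * ?X"
    using Suc by simp
  from pderiv_const_dvd[OF this]
  have A: "[:int k:] dvd pderiv ((pderiv ^^ i) (f ^ c * u * ?X)) - pderiv (f ^ (c - i) * ?v * ?X)"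
    by (simp only: pderiv_diff)
  have X: "[:int k:] dvd pderiv ?X"
    by (simp add: pderiv_monom const_poly_dvd_iff coeff_monom)
  have "pderiv (f ^ (c - i) * ?v * ?X) - f ^ d * deriv_factor f c (Suc i) u * ?X
      = f ^ (c - i) * ?v * pderiv ?X"
    unfolding d
    by (simp only: pderiv_mult pderiv_power_Suc deriv_factor.simps d)
       (simp add: algebra_simps)
  with X have "[:int k:] dvd pderiv (f ^ (c - i) * ?v * ?X) - f ^ d * deriv_factor f c (Suc i) u * ?X"
    by simp
  from dvd_add[OF A this] show ?case unfolding cd by simp
qed simp

text \<open>Counting replaces linear algebra: there are k ^ N residue vectors but only k ^ N'
  outcomes of the conditions, so two vectors agree on all conditions and their difference is a
  nontrivial solution. This asks of \<phi> only compatibility with differences.\<close>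

lemma pigeonhole_kernel_mod:
  fixes \<phi> :: "(nat \<Rightarrow> int) \<Rightarrow> nat \<Rightarrow> int"
  assumes k: "k > 1"
    and add: "\<And>t t' i. \<phi> (\<lambda>x. t x - t' x) i = \<phi> t i - \<phi> t' i"
    and N: "N' < N"
  shows "\<exists>t. (\<exists>i<N. \<not> int k dvd t i) \<and> (\<forall>i<N'. int k dvd \<phi> t i)"
proof -
  let ?A = "PiE {..<N} (\<lambda>_. {0..<int k})" and ?B = "PiE {..<N'} (\<lambda>_. {0..<int k})"
  define \<psi> where "\<psi> t = (\<lambda>i\<in>{..<N'}. \<phi> t i mod int k)" for t
  have "card ?A = k ^ N" "card ?B = k ^ N'" by (simp_all add: card_PiE)
  then have "card ?B < card ?A" using k N by (simp add: power_strict_increasing)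
  moreover have "\<psi> ` ?A \<subseteq> ?B" unfolding \<psi>_def using k by (intro image_subsetI) simp
  moreover have "finite ?B" by (simp add: finite_PiE)
  ultimately have "card (\<psi> ` ?A) < card ?A" by (meson card_mono le_less_trans)
  then have "\<not> inj_on \<psi> ?A" by (rule pigeonhole)
  then obtain t t' where t: "t \<in> ?A" "t' \<in> ?A" "\<psi> t = \<psi> t'" "t \<noteq> t'" unfolding inj_on_def by blast
  from t(4) obtain i where i: "t i \<noteq> t' i" by (meson ext)
  then have iN: "i < N" using t(1,2) by (metis PiE_arb lessThan_iff)
  then have "\<not> int k dvd t i - t' i"
    using not_dvd_small[of "t' i" k "t i"] i PiE_mem[OF t(1)] PiE_mem[OF t(2)] by simp
  moreover have "int k dvd \<phi> (\<lambda>x. t x - t' x) j" if "j < N'" for j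
  proof -
    have "\<psi> t j = \<psi> t' j" using t(3) by simp
    then have "\<phi> t j mod int k = \<phi> t' j mod int k" using that unfolding \<psi>_def by simp
    then show ?thesis unfolding add by (simp add: mod_eq_dvd_iff)
  qed
  ultimately show ?thesis using iN by (intro exI[of _ "\<lambda>x. t x - t' x"]) auto
qed

text \<open>By descent on the degree: the root \<open>- a\<close> has odd multiplicity in the first term of the
  difference and even multiplicity in the second.\<close>

lemma square_times_simple_root_mod:
  fixes r s h :: "int poly"
  assumes k: "prime k" and h: "\<not> int k dvd poly h (- a)" and c: "\<not> int k dvd c"
  shows "[:int k:] dvd r\<^sup>2 * ([:a, 1:] * h) - smult c (s\<^sup>2) \<Longrightarrow> [:int k:] dvd r \<and> [:int k:] dvd s"
proof (induction "degree s" arbitrary: r s rule: less_induct)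
  case less
  define X where X: "X = [:a, 1:]"
  have pk: "prime (int k)" using k by simp
  have prem: "[:int k:] dvd r\<^sup>2 * (X * h) - smult c (s\<^sup>2)" using less.prems unfolding X .
  have hn: "\<not> [:int k:] dvd X * h"
    unfolding X const_dvd_mult_iff[OF k] using not_const_dvd_linear[OF k] h const_dvd_poly[of "int k" h] by metis
  have fin: "[:int k:] dvd r" if "[:int k:] dvd s"
  proof -
    have "[:int k:] dvd smult c (s\<^sup>2)" using that by (simp add: power2_eq_square dvd_smult)
    then have "[:int k:] dvd r\<^sup>2 * (X * h)" using prem dvd_diff_left_iff by blast
    then show ?thesis using hn const_dvd_mult_iff[OF k] by (metis power2_eq_square)
  qed
  have "int k dvd c * (poly s (- a))\<^sup>2"
    using const_dvd_poly[OF less.prems, of "- a"] by simp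
  then have s0: "int k dvd poly s (- a)"
    using c pk by (simp add: prime_dvd_mult_iff prime_dvd_power_iff)
  define s1 where "s1 = synthetic_div s (- a)"
  have s1: "[:int k:] dvd s - X * s1" using linear_factor_mod[OF s0] unfolding s1_def X by simp
  have sd: "[:int k:] dvd s" if "[:int k:] dvd s1"
  proof -
    have "[:int k:] dvd X * s1" using that by (rule dvd_mult)
    with s1 show ?thesis by (simp only: dvd_diff_left_iff)
  qed
  show ?case
  proof (cases "degree s = 0")
    case True
    then have "s1 = 0" unfolding s1_def by (simp add: synthetic_div_eq_0_iff)
    then show ?thesis using sd fin by simp
  next
    case False
    then have deg: "degree s1 < degree s" unfolding s1_def by (simp add: degree_synthetic_div)
    \<comment> \<open>This is zero modulo k, and adding it trades \<open>s\<^sup>2\<close> for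
      \<open>X\<^sup>2 * s1\<^sup>2\<close>, after which one factor X cancels. The same manoeuvre
      for r then restores the original shape with \<open>r1\<close> and \<open>s1\<close>.\<close>
    have "[:int k:] dvd smult c ((s - X * s1) * (s + X * s1))"
      using s1 by (intro dvd_smult dvd_mult2)
    from dvd_add[OF prem this]
    have "[:int k:] dvd X * (r\<^sup>2 * h - smult c (X * s1\<^sup>2))"
      by (simp add: algebra_simps power2_eq_square smult_diff_right smult_add_right)
    then have A: "[:int k:] dvd r\<^sup>2 * h - smult c (X * s1\<^sup>2)"
      using const_dvd_mult_iff[OF k] not_const_dvd_linear[OF k] unfolding X by blast
    then have "int k dvd (poly r (- a))\<^sup>2 * poly h (- a)"
      using const_dvd_poly[OF A, of "- a"] by (simp add: X)
    then have r0: "int k dvd poly r (- a)"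
      using h pk by (simp add: prime_dvd_mult_iff prime_dvd_power_iff)
    define r1 where "r1 = synthetic_div r (- a)"
    have r1: "[:int k:] dvd r - X * r1" using linear_factor_mod[OF r0] unfolding r1_def X by simp
    have "[:int k:] dvd ((r - X * r1) * (r + X * r1)) * h"
      using r1 by (intro dvd_mult2)
    from dvd_diff[OF A this]
    have "[:int k:] dvd X * (r1\<^sup>2 * (X * h) - smult c (s1\<^sup>2))"
      by (simp add: algebra_simps power2_eq_square)
    then have "[:int k:] dvd r1\<^sup>2 * (X * h) - smult c (s1\<^sup>2)"
      using const_dvd_mult_iff[OF k] not_const_dvd_linear[OF k] unfolding X by blast
    from less.hyps[OF deg this[unfolded X]] show ?thesis using sd fin by blast
  qed
qed

section \<open>Nonvanishing of the auxiliary polynomial\<close>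

text \<open>Frobenius: writing f = a + X h, all middle binomial coefficients vanish modulo k, so
  that f ^ k is the constant a ^ k up to a multiple of X ^ k.\<close>

lemma power_prime_mod_monom:
  fixes f :: "int poly"
  assumes k: "prime k"
  shows "\<exists>W. [:int k:] dvd f ^ k - [:(coeff f 0) ^ k:] - monom 1 k * W"
proof -
  obtain a h where f: "f = pCons a h" by (cases f)
  have fe: "f = [:a:] + monom 1 1 * h" unfolding f by (simp add: monom_altdef)
  have "f ^ k = (\<Sum>i\<le>k. of_nat (k choose i) * [:a:] ^ i * (monom 1 1 * h) ^ (k - i))"
    unfolding fe by (rule binomial_ring)
  also have "{..k} = insert 0 (insert k {0<..<k})" using prime_gt_0_nat[OF k] by auto
  also have "(\<Sum>i\<in>\<dots>. of_nat (k choose i) * [:a:] ^ i * (monom 1 1 * h) ^ (k - i))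
     = monom 1 k * h ^ k + ([:a ^ k:] + (\<Sum>i\<in>{0<..<k}. of_nat (k choose i) * [:a:] ^ i * (monom 1 1 * h) ^ (k - i)))"
    using prime_gt_0_nat[OF k] by (simp add: monom_power power_mult_distrib poly_const_pow)
  finally have e: "f ^ k - [:a ^ k:] - monom 1 k * h ^ k
     = (\<Sum>i\<in>{0<..<k}. of_nat (k choose i) * [:a:] ^ i * (monom 1 1 * h) ^ (k - i))" by simp
  have "[:int k:] dvd (\<Sum>i\<in>{0<..<k}. of_nat (k choose i) * [:a:] ^ i * (monom 1 1 * h) ^ (k - i))"
  proof (rule dvd_sum)
    fix i assume "i \<in> {0<..<k}"
    then have "k dvd k choose i" using k by (intro dvd_choose_prime) auto
    then have "[:int k:] dvd [:int (k choose i):]" by simp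
    then have "[:int k:] dvd of_nat (k choose i)" by (simp add: of_nat_poly)
    then show "[:int k:] dvd of_nat (k choose i) * [:a:] ^ i * (monom 1 1 * h) ^ (k - i)"
      by (intro dvd_mult2)
  qed
  then show ?thesis unfolding e[symmetric] by (intro exI[of _ "h ^ k"]) (simp add: f)
qed

text \<open>Multiply the given relation by (r - f ^ q s) f. As 2q + 1 = k, the power of f becomes f
  ^ k, a constant modulo X ^ k. The remaining polynomial r^2 f - c s^2 has degree at most 2(D - 1) +
  deg f < k, so being divisible by X ^ k it vanishes. The simple root -a of f then forces r and s to
  vanish.\<close>

lemma stepanov_nonvanishing_base:
  fixes r s h f Z :: "int poly"
  assumes k: "prime k" "k = 2 * q + 1" and f: "f = [:a, 1:] * h"
    and h: "\<not> int k dvd poly h (- a)" and c: "\<not> int k dvd coeff f 0"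
    and deg: "degree r < D" "degree s < D" "2 * D + degree f \<le> k + 1"
    and Z: "[:int k:] dvd r + f ^ q * s + monom 1 k * Z"
  shows "[:int k:] dvd r \<and> [:int k:] dvd s"
proof -
  obtain W where W: "[:int k:] dvd f ^ k - [:(coeff f 0) ^ k:] - monom 1 k * W"
    using power_prime_mod_monom[OF k(1)] by blast
  let ?c = "coeff f 0 ^ k"
  define P where "P = r\<^sup>2 * f - smult ?c (s\<^sup>2)"
  define V where "V = W * s\<^sup>2 - Z * (r - f ^ q * s) * f"
  have "f ^ k = f * (f ^ q)\<^sup>2" unfolding k(2) by (simp add: power2_eq_square power_mult mult_2 power_add)
  then have "P - monom 1 k * V = (r + f ^ q * s + monom 1 k * Z) * ((r - f ^ q * s) * f)
      + (f ^ k - [:?c:] - monom 1 k * W) * s\<^sup>2"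
    unfolding P_def V_def by (simp add: algebra_simps power2_eq_square)
  then have dv: "[:int k:] dvd P - monom 1 k * V"
    using dvd_add[OF dvd_mult2[OF Z] dvd_mult2[OF W]] by simp
  have dP: "degree P < k"
  proof -
    have "degree (r\<^sup>2 * f) < k"
    proof -
      have "degree (r\<^sup>2 * f) \<le> degree r * 2 + degree f"
        by (rule order_trans[OF degree_mult_le]) (simp add: degree_power_le)
      then show ?thesis using deg by linarith
    qed
    moreover have "degree (smult ?c (s\<^sup>2)) < k"
    proof -
      have "degree (smult ?c (s\<^sup>2)) \<le> degree s * 2"
        by (rule order_trans[OF degree_smult_le degree_power_le])
      then show ?thesis using deg by linarith
    qed
    ultimately show ?thesis unfolding P_def by (rule degree_diff_less)
  qed
  have "int k dvd coeff P i" for i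
  proof (cases "i < k")
    case True
    have "int k dvd coeff (P - monom 1 k * V) i" using dv unfolding const_poly_dvd_iff by blast
    then show ?thesis using True by (simp add: coeff_monom_mult)
  next
    case False
    then show ?thesis using dP by (simp add: coeff_eq_0)
  qed
  then have "[:int k:] dvd r\<^sup>2 * ([:a, 1:] * h) - smult ?c (s\<^sup>2)"
    unfolding P_def f by (simp add: const_poly_dvd_iff)
  moreover have "\<not> int k dvd ?c" using c k(1) by (metis prime_dvd_power prime_nat_int_transfer)
  ultimately show ?thesis using square_times_simple_root_mod[OF k(1) h] by blast
qed

text \<open>All terms with positive j are multiples of X ^ k, so the base case removes the term j =
  0; dividing by X ^ k leaves a sum of the same kind with one term fewer.\<close>

lemma stepanov_nonvanishing:
  fixes r s :: "nat \<Rightarrow> int poly" and h f :: "int poly"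
  assumes k: "prime k" "k = 2 * q + 1" and f: "f = [:a, 1:] * h"
    and h: "\<not> int k dvd poly h (- a)" and c: "\<not> int k dvd coeff f 0"
    and D: "2 * D + degree f \<le> k + 1"
  shows "\<lbrakk>\<And>j. degree (r j) < D; \<And>j. degree (s j) < D;
    [:int k:] dvd (\<Sum>j<J. (r j + f ^ q * s j) * monom 1 (k * j))\<rbrakk>
    \<Longrightarrow> \<forall>j<J. [:int k:] dvd r j \<and> [:int k:] dvd s j"
proof (induction J arbitrary: r s)
  case (Suc J)
  define Z where "Z = (\<Sum>j<J. (r (Suc j) + f ^ q * s (Suc j)) * monom 1 (k * j))"
  have "(\<Sum>j<Suc J. (r j + f ^ q * s j) * monom 1 (k * j)) = r 0 + f ^ q * s 0 + monom 1 k * Z"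
  proof -
    have m: "monom 1 (k * Suc j) = monom 1 k * (monom 1 (k * j) :: int poly)" for j
      by (simp add: mult_monom)
    show ?thesis unfolding Z_def sum.lessThan_Suc_shift sum_distrib_left m
      by (simp add: mult_ac)
  qed
  with Suc.prems(3) have dv: "[:int k:] dvd r 0 + f ^ q * s 0 + monom 1 k * Z" by simp
  have 0: "[:int k:] dvd r 0 \<and> [:int k:] dvd s 0"
    by (rule stepanov_nonvanishing_base[OF k f h c Suc.prems(1,2) D dv])
  then have "[:int k:] dvd r 0 + f ^ q * s 0" by simp
  then have "[:int k:] dvd monom 1 k * Z" using dv dvd_add_right_iff by blast
  moreover have "\<not> [:int k:] dvd monom 1 k"
  proof
    assume "[:int k:] dvd monom 1 k"
    then have "int k dvd coeff (monom 1 k) k" unfolding const_poly_dvd_iff by blast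
    then show False using prime_gt_1_nat[OF k(1)] by simp
  qed
  ultimately have "[:int k:] dvd Z" using const_dvd_mult_iff[OF k(1)] by blast
  then have "\<forall>j<J. [:int k:] dvd r (Suc j) \<and> [:int k:] dvd s (Suc j)"
    unfolding Z_def by (intro Suc.IH Suc.prems(1,2))
  with 0 show ?case by (auto simp: less_Suc_eq_0_disj)
qed simp

section \<open>A bound for Legendre symbol sums\<close>

lemma fermat_int:
  assumes "prime k"
  shows "[x ^ k = x] (mod int k)"
proof (cases "int k dvd x")
  case True
  then show ?thesis using prime_gt_0_nat[OF assms]
    by (simp add: cong_0_iff Cong.cong_def dvd_eq_mod_eq_0 zero_power power_mod[symmetric, of x])
next
  case False
  define y where "y = nat (x mod int k)"
  have y: "int y = x mod int k" unfolding y_def using prime_gt_0_nat[OF assms] by simp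
  have "\<not> k dvd y"
    using False y by (metis dvd_mod_iff dvd_refl int_dvd_int_iff)
  from fermat_theorem[OF assms this] have "[int y ^ (k - 1) = 1] (mod int k)"
    by (metis cong_int_iff of_nat_1 of_nat_power)
  then have "[int y ^ (k - 1) * int y = 1 * int y] (mod int k)" by (rule cong_mult) simp
  then have "[int y ^ k = int y] (mod int k)"
    using power_minus_mult[OF prime_gt_0_nat[OF assms], of "int y"] by simp
  then show ?thesis unfolding y by (simp add: Cong.cong_def power_mod)
qed

text \<open>The auxiliary polynomial is \<open>f ^ m * (\<Sum>j<J. (r\<^sub>j + f ^ q * s\<^sub>j) * X ^ (k * j))\<close> with \<open>r\<^sub>j\<close>, \<open>s\<^sub>j\<close> of degree
  less than \<open>D\<close>. On the counted set \<open>f ^ q = c\<close> and \<open>X ^ k = X\<close>, so that vanishing to order \<open>m\<close> there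
  follows from about \<open>m * D\<close> linear conditions on the \<open>2 * J * D = (m + 1) * D\<close> coefficients.\<close>

lemma stepanov_card_bound:
  fixes A :: "int set" and c :: int
  assumes k: "prime k" "k = 2 * q + 1"
    and A: "A \<noteq> {}" "A \<subseteq> {1..<int k}"
    and m: "m + 1 = 2 * J" "m \<le> k"
    and D: "2 * D + card A \<le> k + 1" "m * (m * card A + J) < D"
  shows "m * card {x \<in> {0..<int k}. [(\<Prod>a\<in>A. x + a) ^ q = c] (mod int k)}
    \<le> card A * (m + q) + D + (J - 1) * k"
proof -
  have fin: "finite A" using A(2) by (rule finite_subset) simp
  define n where "n = card A"
  define f where "f = (\<Prod>a\<in>A. [:a, 1:])"
  have pk: "prime (int k)" using k(1) by simp
  have degf: "degree f = n" unfolding f_def n_def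
    by (subst degree_prod_sum_eq) auto
  have polyf: "poly f x = (\<Prod>a\<in>A. x + a)" for x
    unfolding f_def by (simp add: poly_prod add.commute)
  obtain a where a: "a \<in> A" using A(1) by blast
  define h where "h = (\<Prod>b\<in>A - {a}. [:b, 1:])"
  have fh: "f = [:a, 1:] * h" unfolding f_def h_def using a fin by (simp add: prod.remove)
  have h: "\<not> int k dvd poly h (- a)"
  proof -
    have "\<not> int k dvd b - a" if "b \<in> A - {a}" for b
      using not_dvd_small[of a k b] that a A(2) by fastforce
    moreover have "poly h (- a) = (\<Prod>b\<in>A - {a}. b - a)"
      unfolding h_def by (simp add: poly_prod)
    ultimately show ?thesis using fin pk by (simp add: prime_dvd_prod_iff)
  qed
  have f0: "\<not> int k dvd coeff f 0"
  proof -
    have "coeff f 0 = (\<Prod>a\<in>A. a)" using polyf[of 0] by (simp add: poly_0_coeff_0)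
    moreover have "\<not> int k dvd b" if "b \<in> A" for b
      using that A(2) by (auto dest!: zdvd_imp_le)
    ultimately show ?thesis using fin pk by (simp add: prime_dvd_prod_iff)
  qed
  have D0: "D > 0" and J0: "J > 0" using D m by linarith+
  \<comment> \<open>The unknowns form one vector \<open>t\<close>, cut into blocks of D
    coefficients: blocks 0 to J - 1 are the r_j, blocks J to 2 J - 1 the s_j.\<close>
  define blk where "blk t b = (\<Sum>l<D. monom (t (D * b + l)) l)" for t :: "nat \<Rightarrow> int" and b
  have blk_deg: "degree (blk t b) < D" for t b
    unfolding blk_def using D0 by (intro degree_sum_less) (auto intro: le_less_trans[OF degree_monom_le])
  have blk_diff: "blk (\<lambda>x. t x - t' x) b = blk t b - blk t' b" for t t' b
    unfolding blk_def by (simp add: diff_monom[symmetric] sum_subtractf)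
  have blk_coeff: "coeff (blk t b) l = t (D * b + l)" if "l < D" for t b l
    unfolding blk_def using that by (simp add: coeff_sum)
  \<comment> \<open>On the counted set the i-th derivative of the auxiliary polynomial is
    \<open>f ^ (m - i)\<close> times \<open>C t i\<close>: here f ^ q has been replaced by c and X ^
    (k j) by X ^ j. The replacement brings the degree below \<open>E\<close>, so making
    \<open>C t i\<close> vanish costs only \<open>E\<close> conditions.\<close>
  define C where "C t i = (\<Sum>j<J. (deriv_factor f m i (blk t j)
      + smult c (deriv_factor f (m + q) i (blk t (J + j)))) * monom 1 j)" for t i
  have C_diff: "C (\<lambda>x. t x - t' x) i = C t i - C t' i" for t t' i
    unfolding C_def blk_diff deriv_factor_diff
    by (simp add: sum_subtractf[symmetric] smult_diff_right algebra_simps)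
  define E where "E = D + m * n + J"
  have C_deg: "degree (C t i) < E" if "i < m" for t i
  proof -
    have "degree (deriv_factor f e i (blk t b)) < D + m * n" for e b
    proof -
      have "i * n \<le> m * n" using that by simp
      then show ?thesis using degree_deriv_factor[of f e i "blk t b"] blk_deg[of t b] unfolding degf by linarith
    qed
    note dd = this
    have "degree ((deriv_factor f m i (blk t j) + smult c (deriv_factor f (m + q) i (blk t (J + j)))) * monom 1 j) < E"
      if "j < J" for j
    proof -
      have "degree (deriv_factor f m i (blk t j) + smult c (deriv_factor f (m + q) i (blk t (J + j)))) < D + m * n"
        by (intro degree_add_less dd le_less_trans[OF degree_smult_le dd])
      then show ?thesis using that unfolding E_def
        by (intro le_less_trans[OF degree_mult_le]) (simp add: degree_monom_eq)
    qed
    then show ?thesis unfolding C_def using J0 unfolding E_def by (intro degree_sum_less) auto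
  qed
  have E0: "E > 0" unfolding E_def using D0 by simp
  \<comment> \<open>The m E conditions exceed m D by m (m n + J), which is less than D, while there
    are (m + 1) D unknowns.\<close>
  have "m * E < 2 * J * D"
    using D(2) unfolding E_def n_def m(1)[symmetric] by (simp add: algebra_simps)
  then have "\<exists>t. (\<exists>i<2 * J * D. \<not> int k dvd t i)
      \<and> (\<forall>i<m * E. int k dvd coeff (C t (i div E)) (i mod E))"
    using prime_gt_1_nat[OF k(1)] by (intro pigeonhole_kernel_mod) (auto simp: C_diff)
  then obtain t i0 where i0: "i0 < 2 * J * D" "\<not> int k dvd t i0"
    and t: "\<And>i. i < m * E \<Longrightarrow> int k dvd coeff (C t (i div E)) (i mod E)" by blast
  define r where "r j = blk t j" for j
  define s where "s j = blk t (J + j)" for j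
  define P where "P = (\<Sum>j<J. (r j + f ^ q * s j) * monom 1 (k * j))"
  define R where "R = f ^ m * P"
  have Cdvd: "[:int k:] dvd C t i" if "i < m" for i
  proof -
    have "int k dvd coeff (C t i) l" for l
    proof (cases "l < E")
      case True
      have "i * E + l < m * E"
      proof -
        have "i * E + l < (i + 1) * E" using True by simp
        also have "\<dots> \<le> m * E" using that by (intro mult_right_mono) auto
        finally show ?thesis .
      qed
      from t[OF this] show ?thesis using True by simp
    next
      case False
      then show ?thesis using C_deg[OF that, of t] by (simp add: coeff_eq_0)
    qed
    then show ?thesis by (simp add: const_poly_dvd_iff)
  qed
  \<comment> \<open>The nontrivial unknown \<open>t i0\<close> is a coefficient of some r_j or s_j,
    and these would all vanish modulo k together with P.\<close>
  have "\<not> [:int k:] dvd P"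
  proof
    assume "[:int k:] dvd P"
    then have z: "\<forall>j<J. [:int k:] dvd r j \<and> [:int k:] dvd s j"
      unfolding P_def
      by (rule stepanov_nonvanishing[OF k fh h f0, rotated -1])
         (use D(1) in \<open>auto simp: degf n_def r_def s_def blk_deg\<close>)
    have b: "i0 div D < 2 * J" using i0(1) D0 by (simp add: less_mult_imp_div_less)
    have "[:int k:] dvd blk t (i0 div D)"
    proof (cases "i0 div D < J")
      case True
      then show ?thesis using z unfolding r_def by blast
    next
      case False
      then have "i0 div D - J < J" using b by linarith
      then show ?thesis using z False unfolding s_def by (metis le_add_diff_inverse linorder_not_less)
    qed
    then have "int k dvd coeff (blk t (i0 div D)) (i0 mod D)" unfolding const_poly_dvd_iff by blast
    then show False using i0(2) D0 by (simp add: blk_coeff)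
  qed
  moreover have "\<not> [:int k:] dvd f ^ m"
  proof
    assume "[:int k:] dvd f ^ m"
    then have "int k dvd coeff (f ^ m) 0" unfolding const_poly_dvd_iff by blast
    then show False using f0 pk by (simp add: coeff_0_power prime_dvd_power)
  qed
  ultimately have Rn: "\<not> [:int k:] dvd R" unfolding R_def using const_dvd_mult_iff[OF k(1)] by blast
  have degR: "degree R \<le> n * (m + q) + D + (J - 1) * k"
  proof -
    have "degree ((r j + f ^ q * s j) * monom 1 (k * j)) \<le> n * q + D + (J - 1) * k" if "j < J" for j
    proof -
      have "degree (r j) \<le> n * q + D" using blk_deg[of t j] unfolding r_def by linarith
      moreover have "degree (f ^ q * s j) \<le> n * q + D"
      proof -
        have "degree (f ^ q * s j) \<le> degree (f ^ q) + degree (s j)" by (rule degree_mult_le)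
        also have "degree (f ^ q) \<le> n * q" using degree_power_le[of f q] by (simp add: degf)
        finally show ?thesis using blk_deg[of t "J + j"] unfolding s_def by linarith
      qed
      ultimately have "degree (r j + f ^ q * s j) \<le> n * q + D" by (rule degree_add_le)
      moreover have "degree (monom (1::int) (k * j)) \<le> (J - 1) * k"
      proof -
        have "j \<le> J - 1" using that by simp
        then have "k * j \<le> (J - 1) * k" by (metis mult.commute mult_le_mono2)
        then show ?thesis using degree_monom_le order_trans by blast
      qed
      ultimately show ?thesis by (intro order_trans[OF degree_mult_le]) linarith
    qed
    then have "degree P \<le> n * q + D + (J - 1) * k" unfolding P_def by (intro degree_sum_le) auto
    moreover have "degree (f ^ m) \<le> n * m" using degree_power_le[of f m] by (simp add: degf)
    ultimately show ?thesis unfolding R_def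
      by (intro order_trans[OF degree_mult_le]) (simp add: algebra_simps)
  qed
  define S where "S = {x \<in> {0..<int k}. [(\<Prod>a\<in>A. x + a) ^ q = c] (mod int k)}"
  have Rsum: "R = (\<Sum>j<J. f ^ m * r j * monom 1 (k * j) + f ^ (m + q) * s j * monom 1 (k * j))"
    unfolding R_def P_def sum_distrib_left by (simp add: algebra_simps power_add)
  have "int k dvd poly ((pderiv ^^ i) R) x" if x: "x \<in> S" and i: "i < m" for x i
  proof -
    let ?u = "\<lambda>j. deriv_factor f m i (r j)" and ?v = "\<lambda>j. deriv_factor f (m + q) i (s j)"
    have fq: "[poly f x ^ q = c] (mod int k)" using x unfolding S_def polyf by simp
    have xp: "[x ^ (k * j) = x ^ j] (mod int k)" for j
      unfolding power_mult by (rule cong_pow[OF fermat_int[OF k(1)]])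
    have mq: "m + q - i = m - i + q" using i by simp
    have step: "[poly ((pderiv ^^ i) (f ^ e * u * monom 1 (k * j))) x
        = poly f x ^ (e - i) * poly (deriv_factor f e i u) x * x ^ (k * j)] (mod int k)"
      if "i \<le> e" for e u j
      using const_dvd_poly[OF higher_pderiv_deriv_factor[OF that], of k f u j x]
      by (simp add: cong_iff_dvd_diff poly_monom)
    have "[poly ((pderiv ^^ i) (f ^ m * r j * monom 1 (k * j) + f ^ (m + q) * s j * monom 1 (k * j))) x
        = poly f x ^ (m - i) * ((poly (?u j) x + c * poly (?v j) x) * x ^ j)] (mod int k)" for j
    proof -
      have "[poly ((pderiv ^^ i) (f ^ m * r j * monom 1 (k * j) + f ^ (m + q) * s j * monom 1 (k * j))) x
        = poly f x ^ (m - i) * poly (?u j) x * x ^ (k * j)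
          + poly f x ^ (m + q - i) * poly (?v j) x * x ^ (k * j)] (mod int k)"
        unfolding higher_pderiv_add poly_add using i by (intro cong_add step) auto
      also have "[poly f x ^ (m - i) * poly (?u j) x * x ^ (k * j)
          + poly f x ^ (m + q - i) * poly (?v j) x * x ^ (k * j)
        = poly f x ^ (m - i) * poly (?u j) x * x ^ j
          + (poly f x ^ (m - i) * c) * poly (?v j) x * x ^ j] (mod int k)"
        unfolding mq power_add by (intro cong_add cong_mult cong_refl fq xp)
      finally show ?thesis by (simp add: algebra_simps)
    qed
    then have "[poly ((pderiv ^^ i) R) x
      = (\<Sum>j<J. poly f x ^ (m - i) * ((poly (?u j) x + c * poly (?v j) x) * x ^ j))] (mod int k)"
      unfolding Rsum higher_pderiv_sum poly_sum by (intro cong_sum)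
    also have "(\<Sum>j<J. poly f x ^ (m - i) * ((poly (?u j) x + c * poly (?v j) x) * x ^ j))
      = poly f x ^ (m - i) * poly (C t i) x"
      unfolding C_def r_def s_def by (simp add: poly_sum poly_monom sum_distrib_left)
    finally show ?thesis using const_dvd_poly[OF Cdvd[OF i], of x]
      by (simp add: cong_dvd_iff)
  qed
  moreover have "finite S" "S \<subseteq> {0..<int k}"
    unfolding S_def by (rule finite_subset[of _ "{0..<int k}"]) auto
  ultimately have "(\<Sum>x\<in>S. m) \<le> degree R"
    by (intro sum_multiplicities_le_degree[OF k(1) _ _ Rn]) (use m(2) in simp_all)
  then have "m * card S \<le> degree R" by (simp add: mult.commute)
  also note degR
  finally show ?thesis unfolding S_def n_def .
qed

section \<open>From point counts to character sums\<close>

lemma Legendre_values: "Legendre a p \<in> {-1, 0, 1}"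
  unfolding Legendre_def by auto

lemma Legendre_eq_0_iff: "Legendre a p = 0 \<longleftrightarrow> [a = 0] (mod p)"
  unfolding Legendre_def by auto

lemma cong_small_eq:
  assumes "a \<in> {-1, 0, 1}" "b \<in> {-1, 0, 1}" "[a = b] (mod int k)" "k > 2"
  shows "a = b"
proof -
  have "int k dvd a - b" using assms(3) by (simp add: cong_iff_dvd_diff)
  moreover have "\<bar>a - b\<bar> < int k" using assms by auto
  ultimately show ?thesis using dvd_imp_le_int[of "a - b" "int k"] by force
qed

lemma prod_Legendre_cong:
  assumes "prime k" "k = 2 * q + 1" "k > 2"
  shows "[(\<Prod>a\<in>A. Legendre (x + a) (int k)) = (\<Prod>a\<in>A. x + a) ^ q] (mod int k)"
  unfolding prod_power_distrib
proof (rule cong_prod)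
  fix a
  show "[Legendre (x + a) (int k) = (x + a) ^ q] (mod int k)"
    using euler_criterion[of k "x + a"] assms by simp
qed

lemma prod_values:
  assumes "\<And>a. a \<in> A \<Longrightarrow> g a \<in> {-1, 0, 1 :: int}"
  shows "prod g A \<in> {-1, 0, 1}"
  using assms
proof (induction A rule: infinite_finite_induct)
  case (insert x F)
  then have "g x \<in> {-1, 0, 1}" "prod g F \<in> {-1, 0, 1}" by blast+
  with insert.hyps show ?case by auto
qed auto

lemma card_Legendre_zeros:
  assumes fin: "finite A"
  shows "card {x \<in> Zmod k. \<exists>a\<in>A. Legendre (x + a) (int k) = 0} \<le> card A"
proof (rule surj_card_le[OF fin, of _ "\<lambda>a. (- a) mod int k"], rule subsetI)
  fix x assume "x \<in> {x \<in> Zmod k. \<exists>a\<in>A. Legendre (x + a) (int k) = 0}"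
  then obtain a where a: "x \<in> Zmod k" "a \<in> A" "Legendre (x + a) (int k) = 0" by blast
  then have "x mod int k = (- a) mod int k"
    unfolding Legendre_eq_0_iff by (simp add: Cong.cong_def mod_eq_dvd_iff dvd_eq_mod_eq_0)
  then have "x = (- a) mod int k" using a(1) unfolding Zmod_def by simp
  then show "x \<in> (\<lambda>a. (- a) mod int k) ` A" using a by blast
qed

text \<open>With m = 2 J - 1, Stepanov's bound gives at most k/2 + nk/(2m) + O(n) arguments where
  the product of symbols is 1, and likewise for -1. The two classes together omit at most n
  residues, so upper bounds for both already control the difference of their sizes.\<close>

lemma legendre_sum_bound_nonzero:
  fixes A :: "int set" and J n k :: nat
  assumes k: "prime k" "k > 2"
    and A: "A \<noteq> {}" "A \<subseteq> {1..<int k}" "card A \<le> n"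
    and J: "J > 0" "2 * J \<le> k" "2 * (2 * J) * (2 * J * n + J) + n + 2 \<le> k"
  shows "\<bar>real_of_int (\<Sum>x\<in>Zmod k. \<Prod>a\<in>A. Legendre (x + a) (int k))\<bar>
    \<le> 3 * n + 1 + real n * k / real (2 * J - 1)"
proof -
  have "odd k" using k prime_odd_nat by blast
  then obtain q where q: "k = 2 * q + 1" by (rule oddE)
  have fin: "finite A" using A(2) by (rule finite_subset) simp
  define m where "m = 2 * J - 1"
  have m: "m + 1 = 2 * J" "m > 0" using J unfolding m_def by auto
  \<comment> \<open>With D about k/2 the term D + (J - 1) k is about m k / 2, which after division
    by m is the expected k/2.\<close>
  define D where "D = (k - card A) div 2"
  have D1: "2 * D + card A \<le> k" unfolding D_def using A(3) J by linarith
  have "m * (m * card A + J) < D"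
  proof -
    have "m * (m * card A + J) \<le> 2 * J * (2 * J * n + J)"
      using A(3) m by (intro mult_mono add_mono) auto
    also have "\<dots> < D" using J(3) A(3) unfolding D_def by linarith
    finally show ?thesis .
  qed
  note D2 = this
  define \<chi> where "\<chi> x = (\<Prod>a\<in>A. Legendre (x + a) (int k))" for x
  have \<chi>v: "\<chi> x \<in> {-1, 0, 1}" for x
    unfolding \<chi>_def by (rule prod_values) (rule Legendre_values)
  define S where "S c = {x \<in> Zmod k. \<chi> x = c}" for c
  have finS: "finite (S c)" for c unfolding S_def Zmod_def by (rule finite_subset[of _ "{0..<int k}"]) auto
  have Sc: "m * card (S c) \<le> card A * (m + q) + D + (J - 1) * k" if "c \<in> {-1, 0, 1}" for c
  proof -
    have "S c = {x \<in> {0..<int k}. [(\<Prod>a\<in>A. x + a) ^ q = c] (mod int k)}"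
    proof -
      have "\<chi> x = c \<longleftrightarrow> [(\<Prod>a\<in>A. x + a) ^ q = c] (mod int k)" for x
        using prod_Legendre_cong[OF k(1) q k(2), of x A] cong_small_eq[OF \<chi>v that, of x k] k(2)
        unfolding \<chi>_def[symmetric] by (meson cong_sym cong_trans cong_refl)
      then show ?thesis unfolding S_def Zmod_def by blast
    qed
    then show ?thesis
      using stepanov_card_bound[OF k(1) q A(1,2) m(1) _ _ D2, of c] D1 J m by simp
  qed
  define B where "B = real n + real n * k / (2 * m) + 1 / (2 * m) + k / 2"
  have Sb: "real (card (S c)) \<le> B" if "c \<in> {-1, 0, 1}" for c
  proof -
    have "2 * (m * card (S c)) \<le> 2 * (card A * (m + q) + D + (J - 1) * k)"
      using Sc[OF that] by simp
    also have "\<dots> = 2 * m * card A + card A * (2 * q) + 2 * D + (2 * J - 2) * k"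
      by (simp add: algebra_simps)
    also have "2 * J - 2 = m - 1" using m by simp
    also have "2 * m * card A + card A * (2 * q) + 2 * D + (m - 1) * k
        \<le> 2 * m * n + n * k + k + (m - 1) * k"
      using A(3) D1 q by (intro add_mono mult_mono) auto
    also have "\<dots> = 2 * m * n + n * k + m * k" using m by (cases m) auto
    finally have "real (2 * (m * card (S c))) \<le> real (2 * m * n + n * k + m * k)"
      by (rule of_nat_mono)
    then have "real (card (S c)) * (2 * m) \<le> 2 * m * real n + real n * k + m * real k" by (simp add: algebra_simps)
    then have "real (card (S c)) \<le> (2 * m * real n + real n * k + m * real k) / (2 * m)"
      using m by (simp add: pos_le_divide_eq)
    also have "\<dots> = real n + real n * k / (2 * m) + k / 2" using m by (simp add: field_simps)
    finally show ?thesis unfolding B_def using m by (smt (verit) divide_nonneg_nonneg of_nat_0_le_iff)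
  qed
  have S0: "card (S 0) \<le> n"
  proof -
    have "S 0 \<subseteq> {x \<in> Zmod k. \<exists>a\<in>A. Legendre (x + a) (int k) = 0}"
      unfolding S_def \<chi>_def using fin by auto
    moreover have "finite {x \<in> Zmod k. \<exists>a\<in>A. Legendre (x + a) (int k) = 0}"
      by (rule finite_subset[of _ "{0..<int k}"]) (auto simp: Zmod_def)
    ultimately have "card (S 0) \<le> card A"
      using card_Legendre_zeros[OF fin, of k] card_mono by (meson order_trans)
    then show ?thesis using A(3) by simp
  qed
  have un: "Zmod k = S 1 \<union> (S (-1) \<union> S 0)" using \<chi>v unfolding S_def by auto
  have disj: "S 1 \<inter> (S (-1) \<union> S 0) = {}" "S (-1) \<inter> S 0 = {}" unfolding S_def by auto
  have "card (Zmod k) = card (S 1) + (card (S (-1)) + card (S 0))"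
    unfolding un using finS disj by (simp add: card_Un_disjoint)
  then have tot: "real k = real (card (S 1)) + real (card (S (-1))) + real (card (S 0))"
    unfolding Zmod_def by simp
  have "(\<Sum>x\<in>Zmod k. \<chi> x) = (\<Sum>x\<in>S 1. \<chi> x) + ((\<Sum>x\<in>S (-1). \<chi> x) + (\<Sum>x\<in>S 0. \<chi> x))"
    unfolding un using finS disj by (simp add: sum.union_disjoint)
  also have "(\<Sum>x\<in>S 1. \<chi> x) = int (card (S 1))" by (simp add: S_def)
  also have "(\<Sum>x\<in>S (-1). \<chi> x) = - int (card (S (-1)))" by (simp add: S_def)
  also have "(\<Sum>x\<in>S 0. \<chi> x) = 0" by (simp add: S_def)
  finally have "real_of_int (\<Sum>x\<in>Zmod k. \<chi> x) = real (card (S 1)) - real (card (S (-1)))" by simp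
  then have "\<bar>real_of_int (\<Sum>x\<in>Zmod k. \<chi> x)\<bar> \<le> 2 * B - k + n"
    using tot S0 Sb[of 1] Sb[of "-1"] by simp
  also have "2 * B - k + n = 3 * n + 1 / m + real n * k / m" unfolding B_def using m by (simp add: field_simps)
  also have "\<dots> \<le> 3 * n + 1 + real n * k / m" using m by simp
  also have "m = 2 * J - 1" using m by linarith
  finally show ?thesis unfolding \<chi>_def .
qed

lemma Zmod_shift_bij:
  assumes "k > 0"
  shows "bij_betw (\<lambda>x. (x + t) mod int k) (Zmod k) (Zmod k)"
proof (rule bij_betwI[where g = "\<lambda>x. (x - t) mod int k"])
  show "(\<lambda>x. (x + t) mod int k) \<in> Zmod k \<rightarrow> Zmod k" "(\<lambda>x. (x - t) mod int k) \<in> Zmod k \<rightarrow> Zmod k"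
    using assms by (auto simp: Zmod_def)
  show "((x + t) mod int k - t) mod int k = x" if "x \<in> Zmod k" for x
    using that by (simp add: Zmod_def mod_simps)
  show "((x - t) mod int k + t) mod int k = x" if "x \<in> Zmod k" for x
    using that by (simp add: Zmod_def mod_simps)
qed

text \<open>Translating the summation variable moves A away from 0, which the previous bound
  excludes because it needs the auxiliary f to have a nonzero constant term.\<close>

lemma legendre_sum_bound:
  fixes A :: "int set" and J n k :: nat
  assumes k: "prime k" "k > 2"
    and A: "A \<noteq> {}" "A \<subseteq> Zmod k" "card A \<le> n"
    and J: "J > 0" "2 * J \<le> k" "2 * (2 * J) * (2 * J * n + J) + n + 2 \<le> k"
  shows "\<bar>real_of_int (\<Sum>x\<in>Zmod k. \<Prod>a\<in>A. Legendre (x + a) (int k))\<bar>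
    \<le> 3 * n + 1 + real n * k / real (2 * J - 1)"
proof -
  have k0: "k > 0" using k by simp
  have fin: "finite A" using A(2) by (rule finite_subset) (simp add: Zmod_def)
  have "card ((\<lambda>a. (- a) mod int k) ` A) \<le> n" using card_image_le[OF fin] A(3) by (rule order_trans)
  moreover have "n < card (Zmod k)" using J by (simp add: Zmod_def)
  ultimately have "\<not> Zmod k \<subseteq> (\<lambda>a. (- a) mod int k) ` A"
    using card_mono[OF finite_imageI[OF fin]] by fastforce
  then obtain t where t: "t \<in> Zmod k" "t \<notin> (\<lambda>a. (- a) mod int k) ` A" by blast
  define g where "g a = (a + t) mod int k" for a
  have inj: "inj_on g A" using Zmod_shift_bij[OF k0, of t] A(2)
    unfolding g_def bij_betw_def by (meson inj_on_subset)
  have "g ` A \<subseteq> {1..<int k}"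
  proof
    fix b assume "b \<in> g ` A"
    then obtain a where a: "a \<in> A" "b = (a + t) mod int k" unfolding g_def by blast
    have "b \<noteq> 0"
    proof
      assume "b = 0"
      then have "t mod int k = (- a) mod int k" using a(2) by (simp add: mod_eq_dvd_iff dvd_eq_mod_eq_0 add.commute)
      then have "t = (- a) mod int k" using t(1) by (simp add: Zmod_def)
      then show False using t(2) a(1) by blast
    qed
    moreover have "0 \<le> b" "b < int k" using a k0 by auto
    ultimately show "b \<in> {1..<int k}" by simp
  qed
  then have "\<bar>real_of_int (\<Sum>x\<in>Zmod k. \<Prod>a\<in>g ` A. Legendre (x + a) (int k))\<bar>
    \<le> 3 * n + 1 + real n * k / real (2 * J - 1)"
    using A by (intro legendre_sum_bound_nonzero[OF k _ _ _ J]) (auto simp: card_image[OF inj])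
  also have "(\<Sum>x\<in>Zmod k. \<Prod>a\<in>g ` A. Legendre (x + a) (int k))
    = (\<Sum>x\<in>Zmod k. \<Prod>a\<in>A. Legendre ((x + t) mod int k + a) (int k))"
    unfolding prod.reindex[OF inj] o_def g_def
    by (intro sum.cong prod.cong refl Legendre_cong) (simp add: Cong.cong_def mod_simps algebra_simps)
  also have "\<dots> = (\<Sum>x\<in>Zmod k. \<Prod>a\<in>A. Legendre (x + a) (int k))"
    by (rule sum.reindex_bij_betw[OF Zmod_shift_bij[OF k0]])
  finally show ?thesis .
qed

text \<open>J is fixed first, of order n/\<epsilon>, so that the term linear in k is small; only
  then is k taken large enough for the constants depending on n and J.\<close>

lemma legendre_sum_small:
  fixes \<epsilon> :: real
  assumes "\<epsilon> > 0"
  shows "\<exists>K. \<forall>k\<ge>K. prime k \<longrightarrow> (\<forall>A. A \<noteq> {} \<and> A \<subseteq> Zmod k \<and> card A \<le> n \<longrightarrow>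
    \<bar>real_of_int (\<Sum>x\<in>Zmod k. \<Prod>a\<in>A. Legendre (x + a) (int k))\<bar> \<le> \<epsilon> * k)"
proof -
  obtain J0 :: nat where J0: "2 * real n / \<epsilon> + 1 < J0" using reals_Archimedean2 by blast
  define J where "J = Suc J0"
  have J: "2 * real n / \<epsilon> \<le> real (2 * J - 1)" "J > 0" using J0 unfolding J_def by auto
  obtain K0 :: nat where K0: "2 * (3 * n + 1) / \<epsilon> < K0" using reals_Archimedean2 by blast
  define K where "K = 3 + 2 * J + (2 * (2 * J) * (2 * J * n + J) + n + 2) + K0"
  show ?thesis
  proof (intro exI[of _ K] allI impI, elim conjE)
    fix k A assume k: "k \<ge> K" "prime k" and A: "A \<noteq> {}" "A \<subseteq> Zmod k" "card A \<le> n"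
    have "\<bar>real_of_int (\<Sum>x\<in>Zmod k. \<Prod>a\<in>A. Legendre (x + a) (int k))\<bar>
      \<le> 3 * n + 1 + real n * k / real (2 * J - 1)"
      by (rule legendre_sum_bound) (use k J(2) A in \<open>auto simp: K_def\<close>)
    also have "3 * n + 1 \<le> \<epsilon> / 2 * k"
    proof -
      have "2 * (3 * n + 1) / \<epsilon> \<le> k" using K0 k(1) unfolding K_def by linarith
      then show ?thesis using assms by (simp add: field_simps)
    qed
    also have "real n * k / real (2 * J - 1) \<le> \<epsilon> / 2 * k"
    proof -
      have "real n / real (2 * J - 1) \<le> \<epsilon> / 2"
        using J assms by (simp add: field_simps)
      from mult_right_mono[OF this, of k] show ?thesis by simp
    qed
    finally show "\<bar>real_of_int (\<Sum>x\<in>Zmod k. \<Prod>a\<in>A. Legendre (x + a) (int k))\<bar> \<le> \<epsilon> * k"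
      by (simp add: field_simps)
  qed
qed

section \<open>Codegrees\<close>

lemma finite_Zmod [simp]: "finite (Zmod k)"
  by (simp add: Zmod_def)

lemma card_Zmod [simp]: "card (Zmod k) = k"
  by (simp add: Zmod_def)

lemma finite_subset_Zmod: "A \<subseteq> Zmod k \<Longrightarrow> finite A"
  by (rule finite_subset[OF _ finite_Zmod])

text \<open>Expand the product of \<open>\<chi> x a + 1\<close> over subsets of A and sum over x:
  the empty subset contributes k, every other one a small character sum. The product is 2 ^ card A
  on \<open>Q_set k A\<close> and 0 off it, except at the at most card A points where some symbol is
  0; there it still lies between 0 and 2 ^ card A.\<close>

lemma card_Q_set:
  fixes \<epsilon> :: real
  assumes "\<epsilon> > 0"
  shows "\<exists>K. \<forall>k\<ge>K. prime k \<longrightarrow> (\<forall>A. A \<subseteq> Zmod k \<and> card A \<le> N \<longrightarrow>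
    \<bar>real (card (Q_set k A)) - k / 2 ^ card A\<bar> \<le> \<epsilon> * k)"
proof -
  obtain K1 where K1: "\<forall>k\<ge>K1. prime k \<longrightarrow> (\<forall>A. A \<noteq> {} \<and> A \<subseteq> Zmod k \<and> card A \<le> N \<longrightarrow>
    \<bar>real_of_int (\<Sum>x\<in>Zmod k. \<Prod>a\<in>A. Legendre (x + a) (int k))\<bar> \<le> \<epsilon> / 2 * k)"
    using legendre_sum_small[of "\<epsilon> / 2" N] assms by auto
  obtain K2 :: nat where K2: "2 * real N / \<epsilon> < K2" using reals_Archimedean2 by blast
  show ?thesis
  proof (intro exI[of _ "max K1 K2"] allI impI, elim conjE)
    fix k A assume k: "max K1 K2 \<le> k" "prime k" and A: "A \<subseteq> Zmod k" "card A \<le> N"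
    have fin: "finite A" using A(1) by (rule finite_subset_Zmod)
    define s where "s = card A"
    define \<chi> where "\<chi> x a = Legendre (x + a) (int k)" for x a
    have v0: "0 \<le> \<chi> x a + 1 \<and> \<chi> x a + 1 \<le> 2" for x a
      using Legendre_values[of "x + a" "int k"] unfolding \<chi>_def by auto
    define F where "F B = (\<Sum>x\<in>Zmod k. \<Prod>b\<in>B. \<chi> x b)" for B
    define G where "G x = (\<Prod>a\<in>A. \<chi> x a + 1)" for x
    have "(\<Sum>x\<in>Zmod k. G x) = (\<Sum>x\<in>Zmod k. \<Sum>B\<in>Pow A. \<Prod>b\<in>B. \<chi> x b)"
      unfolding G_def by (simp add: prod_add[OF fin])
    also have "\<dots> = (\<Sum>B\<in>Pow A. F B)" unfolding F_def by (rule sum.swap)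
    also have "\<dots> = F {} + (\<Sum>B\<in>Pow A - {{}}. F B)" using fin by (simp add: sum.remove)
    also have "F {} = int k" by (simp add: F_def)
    finally have e: "(\<Sum>x\<in>Zmod k. G x) - int k = (\<Sum>B\<in>Pow A - {{}}. F B)" by simp
    have "\<bar>real_of_int (F B)\<bar> \<le> \<epsilon> / 2 * k" if "B \<in> Pow A - {{}}" for B
    proof -
      have "B \<noteq> {}" "B \<subseteq> Zmod k" using that A(1) by auto
      moreover have "card B \<le> N" using that A(2) card_mono[OF fin, of B] by auto
      ultimately show ?thesis using K1 k unfolding F_def \<chi>_def by (meson max.bounded_iff)
    qed
    note FB = this
    have "\<bar>real_of_int ((\<Sum>x\<in>Zmod k. G x) - int k)\<bar> \<le> (\<Sum>B\<in>Pow A - {{}}. \<bar>real_of_int (F B)\<bar>)"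
      unfolding e of_int_sum by (rule sum_abs)
    also have "\<dots> \<le> (\<Sum>B\<in>Pow A - {{}}. \<epsilon> / 2 * k)" by (rule sum_mono) (rule FB)
    also have "\<dots> = real (card (Pow A - {{}})) * (\<epsilon> / 2 * k)" by simp
    also have "\<dots> \<le> 2 ^ s * (\<epsilon> / 2 * k)"
      using assms fin unfolding s_def by (intro mult_right_mono) (simp_all add: card_Pow)
    finally have G1: "\<bar>real_of_int (\<Sum>x\<in>Zmod k. G x) - k\<bar> \<le> 2 ^ s * (\<epsilon> / 2 * k)" by simp
    define Z where "Z = {x \<in> Zmod k. \<exists>a\<in>A. Legendre (x + a) (int k) = 0}"
    have Z: "card Z \<le> s" "Z \<subseteq> Zmod k" "finite Z"
      using card_Legendre_zeros[OF fin, of k] unfolding Z_def s_def by (auto intro: finite_subset_Zmod[of _ k])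
    define I where "I x = (if x \<in> Q_set k A then 2 ^ s else 0 :: int)" for x
    have GI: "\<bar>G x - I x\<bar> \<le> (if x \<in> Z then 2 ^ s else 0)" if "x \<in> Zmod k" for x
    proof (cases "x \<in> Z")
      case True
      then obtain a where "a \<in> A" "Legendre (x + a) (int k) = 0" unfolding Z_def by blast
      then have "I x = 0" unfolding I_def Q_set_def by force
      moreover have "0 \<le> G x" unfolding G_def by (rule prod_nonneg) (use v0 in blast)
      moreover have "G x \<le> (\<Prod>a\<in>A. 2)" unfolding G_def by (rule prod_mono) (use v0 in blast)
      ultimately show ?thesis using True unfolding s_def by simp
    next
      case False
      then have v: "\<chi> x a = 1 \<or> \<chi> x a = -1" if "a \<in> A" for a
        using that \<open>x \<in> Zmod k\<close> Legendre_values[of "x + a" "int k"] unfolding Z_def \<chi>_def by auto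
      show ?thesis
      proof (cases "x \<in> Q_set k A")
        case True
        then have "G x = (\<Prod>a\<in>A. 2)" unfolding G_def by (intro prod.cong) (auto simp: Q_set_def \<chi>_def)
        then show ?thesis using True False unfolding I_def s_def by simp
      next
        case nQ: False
        then obtain a where a: "a \<in> A" "\<chi> x a \<noteq> 1" using \<open>x \<in> Zmod k\<close> unfolding Q_set_def \<chi>_def by blast
        then have "\<chi> x a + 1 = 0" using v[OF a(1)] by simp
        then have "G x = 0" unfolding G_def using a(1) fin by (intro prod_zero) auto
        then show ?thesis using nQ False unfolding I_def by simp
      qed
    qed
    have Qs: "Q_set k A \<subseteq> Zmod k" unfolding Q_set_def by auto
    have "\<bar>(\<Sum>x\<in>Zmod k. G x) - (\<Sum>x\<in>Zmod k. I x)\<bar> \<le> (\<Sum>x\<in>Zmod k. \<bar>G x - I x\<bar>)"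
      unfolding sum_subtractf[symmetric] by (rule sum_abs)
    also have "\<dots> \<le> (\<Sum>x\<in>Zmod k. if x \<in> Z then 2 ^ s else 0)" by (rule sum_mono) (rule GI)
    also have "\<dots> = int (card Z) * 2 ^ s"
      using Z(2) by (simp add: sum.If_cases Int_absorb1)
    also have "\<dots> \<le> int s * 2 ^ s" using Z(1) by simp
    finally have "\<bar>(\<Sum>x\<in>Zmod k. G x) - (\<Sum>x\<in>Zmod k. I x)\<bar> \<le> int s * 2 ^ s" .
    moreover have "(\<Sum>x\<in>Zmod k. I x) = int (card (Q_set k A)) * 2 ^ s"
      unfolding I_def using Qs by (simp add: sum.If_cases Int_absorb1)
    ultimately have "\<bar>(\<Sum>x\<in>Zmod k. G x) - int (card (Q_set k A)) * 2 ^ s\<bar> \<le> int s * 2 ^ s" by simp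
    then have "real_of_int \<bar>(\<Sum>x\<in>Zmod k. G x) - int (card (Q_set k A)) * 2 ^ s\<bar> \<le> real_of_int (int s * 2 ^ s)"
      by (simp only: of_int_le_iff)
    then have G2: "\<bar>real_of_int (\<Sum>x\<in>Zmod k. G x) - card (Q_set k A) * 2 ^ s\<bar> \<le> s * 2 ^ s" by simp
    have "\<bar>card (Q_set k A) * 2 ^ s - real k\<bar> \<le> (\<epsilon> / 2 * k + s) * 2 ^ s"
    proof -
      have "(\<epsilon> / 2 * k + s) * 2 ^ s = 2 ^ s * (\<epsilon> / 2 * k) + s * 2 ^ s" by (simp add: algebra_simps)
      then show ?thesis using G1 G2 by linarith
    qed
    moreover have "card (Q_set k A) * 2 ^ s - real k = (card (Q_set k A) - k / 2 ^ s) * 2 ^ s"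
      by (simp add: field_simps)
    ultimately have "\<bar>card (Q_set k A) - k / 2 ^ s\<bar> * 2 ^ s \<le> (\<epsilon> / 2 * k + s) * 2 ^ s"
      by (simp add: abs_mult)
    then have "\<bar>card (Q_set k A) - k / 2 ^ s\<bar> \<le> \<epsilon> / 2 * k + s" by simp
    moreover have "real s \<le> \<epsilon> / 2 * k"
    proof -
      have "2 * real N / \<epsilon> \<le> k" using K2 k(1) by linarith
      then have "real N \<le> \<epsilon> / 2 * k" using assms by (simp add: field_simps)
      then show ?thesis using A(2) unfolding s_def by simp
    qed
    ultimately show "\<bar>real (card (Q_set k A)) - k / 2 ^ card A\<bar> \<le> \<epsilon> * k"
      unfolding s_def by linarith
  qed
qed

section \<open>Codegrees and representations of differences\<close>

text \<open>This is the number called r in the overview.\<close>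

definition diff_count :: "nat \<Rightarrow> int set \<Rightarrow> int \<Rightarrow> nat" where
  "diff_count k A d = card {(a, b). a \<in> A \<and> b \<in> A \<and> [a - b = d] (mod int k)}"

definition shift :: "nat \<Rightarrow> int \<Rightarrow> int set \<Rightarrow> int set" where
  "shift k t A = (\<lambda>a. (a + t) mod int k) ` A"

lemma shift_subset: "k > 0 \<Longrightarrow> shift k t A \<subseteq> Zmod k"
  unfolding shift_def Zmod_def by auto

lemma card_shift: "\<lbrakk>k > 0; A \<subseteq> Zmod k\<rbrakk> \<Longrightarrow> card (shift k t A) = card A"
  unfolding shift_def
  by (rule card_image, rule inj_on_subset[OF bij_betw_imp_inj_on[OF Zmod_shift_bij]])

lemma card_shift_Int:
  assumes k: "k > 0" and A: "A \<subseteq> Zmod k"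
  shows "card (shift k (- u) A \<inter> shift k (- v) A) = diff_count k A (u - v)"
proof -
  let ?P = "{(a, b). a \<in> A \<and> b \<in> A \<and> [a - b = u - v] (mod int k)}"
  let ?g = "\<lambda>(a, b). (a + - u) mod int k"
  have c: "[a - b = u - v] (mod int k) \<longleftrightarrow> (a + - u) mod int k = (b + - v) mod int k" for a b
    unfolding Cong.cong_def mod_eq_dvd_iff by (simp add: algebra_simps)
  have inj: "a = a'" if "a \<in> A" "a' \<in> A" "(a + t) mod int k = (a' + t) mod int k" for a a' t
    using that Zmod_shift_bij[OF k, of t] A unfolding bij_betw_def inj_on_def by blast
  have "inj_on ?g ?P"
  proof (rule inj_onI, clarify)
    fix a b a' b'
    assume h: "a \<in> A" "a' \<in> A" "b \<in> A" "b' \<in> A" "[a - b = u - v] (mod int k)"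
      "[a' - b' = u - v] (mod int k)" "(a + - u) mod int k = (a' + - u) mod int k"
    then have "(b + - v) mod int k = (b' + - v) mod int k" unfolding c by simp
    then show "a = a' \<and> b = b'" using inj h by blast
  qed
  moreover have "?g ` ?P = shift k (- u) A \<inter> shift k (- v) A"
    unfolding shift_def c by force
  ultimately show ?thesis unfolding diff_count_def using card_image[of ?g ?P] by simp
qed

lemma card_abs_diff_le:
  assumes "finite X" "finite Y" "(X - Y) \<union> (Y - X) \<subseteq> E" "finite E"
  shows "\<bar>real (card X) - real (card Y)\<bar> \<le> card E"
proof -
  have "card X \<le> card (Y \<union> E)" "card Y \<le> card (X \<union> E)"
    using assms by (auto intro!: card_mono)
  then have "card X \<le> card Y + card E" "card Y \<le> card X + card E"
    using card_Un_le[of Y E] card_Un_le[of X E] by linarith+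
  then show ?thesis by linarith
qed

definition common_nbrs :: "nat \<Rightarrow> int set \<Rightarrow> int \<Rightarrow> int \<Rightarrow> int set" where
  "common_nbrs k S u v = {w. cayley_adj k S u w \<and> cayley_adj k S v w}"

lemma common_nbrs_subset: "common_nbrs k S u v \<subseteq> Zmod k"
  unfolding common_nbrs_def cayley_adj_def by auto

text \<open>Up to few exceptions the common neighbours of u and v are the points of Q for the union
  of A - u and A - v. The intersection of these two translates is counted by
  \<open>diff_count k A (u - v)\<close>, hence the exponent.\<close>

lemma codegree_approx:
  fixes \<epsilon> :: real
  assumes "\<epsilon> > 0"
  shows "\<exists>K. \<forall>k\<ge>K. prime k \<longrightarrow> (\<forall>A S E u v. A \<subseteq> Zmod k \<and> card A \<le> N \<and> finite E \<and> card E \<le> e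
    \<and> (S - Q_set k A) \<union> (Q_set k A - S) \<subseteq> E \<and> u \<in> Zmod k \<and> v \<in> Zmod k \<longrightarrow>
    \<bar>real (card (common_nbrs k S u v)) - k / 2 ^ (2 * card A - diff_count k A (u - v))\<bar> \<le> \<epsilon> * k)"
proof -
  obtain K1 where K1: "\<forall>k\<ge>K1. prime k \<longrightarrow> (\<forall>A. A \<subseteq> Zmod k \<and> card A \<le> 2 * N \<longrightarrow>
    \<bar>real (card (Q_set k A)) - k / 2 ^ card A\<bar> \<le> \<epsilon> / 2 * k)"
    using card_Q_set[of "\<epsilon> / 2" "2 * N"] assms by auto
  obtain K2 :: nat where K2: "2 * real (2 * e + 2) / \<epsilon> < K2" using reals_Archimedean2 by blast
  show ?thesis
  proof (intro exI[of _ "max K1 K2"] allI impI, elim conjE)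
    fix k A S E u v
    assume k: "max K1 K2 \<le> k" "prime k" and A: "A \<subseteq> Zmod k" "card A \<le> N"
      and E: "finite E" "card E \<le> e" "(S - Q_set k A) \<union> (Q_set k A - S) \<subseteq> E"
      and uv: "u \<in> Zmod k" "v \<in> Zmod k"
    have k0: "k > 0" using k(2) prime_gt_0_nat by blast
    define B where "B = shift k (- u) A \<union> shift k (- v) A"
    have BZ: "B \<subseteq> Zmod k" unfolding B_def using shift_subset[OF k0] by simp
    have fs: "finite (shift k t A)" for t using shift_subset[OF k0] finite_subset_Zmod by blast
    have "card (shift k (- u) A) + card (shift k (- v) A)
      = card B + card (shift k (- u) A \<inter> shift k (- v) A)"
      unfolding B_def by (rule card_Un_Int[OF fs fs])
    then have cB: "card B = 2 * card A - diff_count k A (u - v)"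
      unfolding card_shift_Int[OF k0 A(1)] card_shift[OF k0 A(1)] by simp
    then have "card B \<le> 2 * N" using A(2) by simp
    then have 1: "\<bar>real (card (Q_set k B)) - k / 2 ^ (2 * card A - diff_count k A (u - v))\<bar> \<le> \<epsilon> / 2 * k"
      using K1 k BZ unfolding cB[symmetric] by simp
    have Lc: "Legendre (w + (a + - t) mod int k) (int k) = Legendre ((w - t) mod int k + a) (int k)" for w a t
      by (rule Legendre_cong) (simp add: Cong.cong_def mod_simps algebra_simps)
    have QB: "w \<in> Q_set k B \<longleftrightarrow> w \<in> Zmod k \<and> (w - u) mod int k \<in> Q_set k A \<and> (w - v) mod int k \<in> Q_set k A" for w
    proof -
      have "(\<forall>b\<in>shift k (- t) A. Legendre (w + b) (int k) = 1)
          \<longleftrightarrow> (\<forall>a\<in>A. Legendre ((w - t) mod int k + a) (int k) = 1)" for t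
        unfolding shift_def by (simp only: ball_simps Lc)
      moreover have "(w - t) mod int k \<in> Zmod k" for t using k0 by (simp add: Zmod_def)
      ultimately show ?thesis unfolding Q_set_def B_def ball_Un by blast
    qed
    \<comment> \<open>A vertex w can be misjudged only if w - u or w - v is exceptional, or if w is
      u or v itself, since adjacency requires distinct vertices; hence 2 e + 2.\<close>
    define E' where "E' = {u, v} \<union> (shift k u E \<union> shift k v E)"
    have E': "finite E'" "card E' \<le> 2 * e + 2"
    proof -
      show "finite E'" unfolding E'_def shift_def using E(1) by simp
      have "card (shift k t E) \<le> e" for t unfolding shift_def using card_image_le[OF E(1)] E(2) order_trans by blast
      note this[of u] this[of v]
      moreover have "card {u, v} \<le> 2" by (simp add: card_insert_le_m1)
      ultimately show "card E' \<le> 2 * e + 2" unfolding E'_def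
        using card_Un_le[of "{u, v}" "shift k u E \<union> shift k v E"] card_Un_le[of "shift k u E" "shift k v E"] by linarith
    qed
    have sh: "w \<in> shift k t E" if "w \<in> Zmod k" "(w - t) mod int k \<in> E" for w t
    proof -
      have "w = ((w - t) mod int k + t) mod int k" using that(1) by (simp add: Zmod_def mod_simps)
      then show ?thesis unfolding shift_def using that(2) by blast
    qed
    have cong: "((w - t) mod int k \<in> S) = ((w - t) mod int k \<in> Q_set k A)"
      if "w \<in> Zmod k" "w \<notin> shift k t E" for w t
      using sh that E(3) by blast
    have "(common_nbrs k S u v - Q_set k B) \<union> (Q_set k B - common_nbrs k S u v) \<subseteq> E'"
    proof
      fix w assume w: "w \<in> (common_nbrs k S u v - Q_set k B) \<union> (Q_set k B - common_nbrs k S u v)"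
      then have wZ: "w \<in> Zmod k" using QB common_nbrs_subset by blast
      show "w \<in> E'"
      proof (rule ccontr)
        assume "w \<notin> E'"
        then have "w \<noteq> u" "w \<noteq> v" "w \<notin> shift k u E" "w \<notin> shift k v E" unfolding E'_def by auto
        then have "w \<in> common_nbrs k S u v \<longleftrightarrow> w \<in> Q_set k B"
          unfolding QB common_nbrs_def cayley_adj_def using cong[OF wZ] wZ uv by auto
        then show False using w by blast
      qed
    qed
    moreover have "finite (common_nbrs k S u v)" by (rule finite_subset_Zmod[OF common_nbrs_subset])
    moreover have "Q_set k B \<subseteq> Zmod k" unfolding Q_set_def by blast
    then have "finite (Q_set k B)" by (rule finite_subset_Zmod)
    ultimately have "\<bar>real (card (common_nbrs k S u v)) - real (card (Q_set k B))\<bar> \<le> card E'"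
      using E'(1) by (intro card_abs_diff_le)
    then have 2: "\<bar>real (card (common_nbrs k S u v)) - real (card (Q_set k B))\<bar> \<le> real (2 * e + 2)"
      using E'(2) by linarith
    have "2 * real (2 * e + 2) / \<epsilon> \<le> k" using K2 k(1) by linarith
    then have "real (2 * e + 2) \<le> \<epsilon> / 2 * k" using assms by (simp add: field_simps)
    then show "\<bar>real (card (common_nbrs k S u v)) - k / 2 ^ (2 * card A - diff_count k A (u - v))\<bar> \<le> \<epsilon> * k"
      using 1 2 by linarith
  qed
qed

lemma diff_count_le:
  assumes "k > 0" "A \<subseteq> Zmod k"
  shows "diff_count k A d \<le> card A"
proof -
  have "diff_count k A d = diff_count k A (d - 0)" by simp
  also have "\<dots> = card (shift k (- d) A \<inter> shift k (- 0) A)" using card_shift_Int[OF assms] by metis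
  also have "\<dots> \<le> card (shift k (- d) A)"
    using shift_subset[OF assms(1)] finite_subset_Zmod by (intro card_mono) blast+
  finally show ?thesis using card_shift[OF assms] by simp
qed

text \<open>The main terms are 2 ^ r k / 4 ^ s with s = card A, so different values of r are at
  least k / 4 ^ N apart. The tolerance 1/2 and the two approximation errors of 1/8 use up only 3/4
  of that gap.\<close>

lemma codegree_determines_diff_count:
  "\<exists>K. \<forall>k\<ge>K. prime k \<longrightarrow> (\<forall>A S E u v u' v'. A \<subseteq> Zmod k \<and> card A \<le> N \<and> finite E \<and> card E \<le> e
    \<and> (S - Q_set k A) \<union> (Q_set k A - S) \<subseteq> E \<and> u \<in> Zmod k \<and> v \<in> Zmod k \<and> u' \<in> Zmod k \<and> v' \<in> Zmod k
    \<and> \<bar>real (card (common_nbrs k S u v)) - real (card (common_nbrs k S u' v'))\<bar> \<le> k / 4 ^ N / 2 \<longrightarrow>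
    diff_count k A (u - v) = diff_count k A (u' - v'))"
proof -
  define \<epsilon> :: real where "\<epsilon> = 1 / 4 ^ N / 8"
  have "\<epsilon> > 0" by (simp add: \<epsilon>_def)
  from codegree_approx[OF this, of N e] obtain K where K: "\<forall>k\<ge>K. prime k \<longrightarrow>
    (\<forall>A S E u v. A \<subseteq> Zmod k \<and> card A \<le> N \<and> finite E \<and> card E \<le> e
    \<and> (S - Q_set k A) \<union> (Q_set k A - S) \<subseteq> E \<and> u \<in> Zmod k \<and> v \<in> Zmod k \<longrightarrow>
    \<bar>real (card (common_nbrs k S u v)) - k / 2 ^ (2 * card A - diff_count k A (u - v))\<bar> \<le> \<epsilon> * k)" by blast
  show ?thesis
  proof (intro exI[of _ K] allI impI, elim conjE, rule ccontr)
    fix k A S E u v u' v'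
    assume k: "K \<le> k" "prime k" and A: "A \<subseteq> Zmod k" "card A \<le> N" "finite E" "card E \<le> e"
      "(S - Q_set k A) \<union> (Q_set k A - S) \<subseteq> E"
      and uv: "u \<in> Zmod k" "v \<in> Zmod k" "u' \<in> Zmod k" "v' \<in> Zmod k"
      and close: "\<bar>real (card (common_nbrs k S u v)) - real (card (common_nbrs k S u' v'))\<bar> \<le> k / 4 ^ N / 2"
      and neq: "diff_count k A (u - v) \<noteq> diff_count k A (u' - v')"
    define s where "s = card A"
    define r where "r = diff_count k A (u - v)"
    define r' where "r' = diff_count k A (u' - v')"
    have k0: "k > 0" using k(2) prime_gt_0_nat by blast
    have r: "r \<le> 2 * s" "r' \<le> 2 * s"
      using diff_count_le[OF k0 A(1), of "u - v"] diff_count_le[OF k0 A(1), of "u' - v'"]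
      unfolding r_def r'_def s_def by linarith+
    have a: "\<bar>real (card (common_nbrs k S u v)) - k / 2 ^ (2 * s - r)\<bar> \<le> \<epsilon> * k"
      "\<bar>real (card (common_nbrs k S u' v')) - k / 2 ^ (2 * s - r')\<bar> \<le> \<epsilon> * k"
      using K k A uv unfolding s_def r_def r'_def by blast+
    have b: "\<bar>k / 2 ^ (2 * s - r) - k / 2 ^ (2 * s - r')\<bar> \<le> 2 * \<epsilon> * k + k / 4 ^ N / 2"
      using a close by linarith
    have p: "k / 2 ^ (2 * s - i) = k / 4 ^ s * 2 ^ i" if "i \<le> 2 * s" for i
    proof -
      have "(4::real) ^ s = 2 ^ (2 * s - i) * 2 ^ i" using that by (simp add: power_mult flip: power_add)
      then show ?thesis by (simp add: field_simps)
    qed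
    have "1 \<le> \<bar>(2::int) ^ r - 2 ^ r'\<bar>" using neq unfolding r_def r'_def by (simp add: int_one_le_iff_zero_less)
    then have "real_of_int 1 \<le> real_of_int \<bar>(2::int) ^ r - 2 ^ r'\<bar>" by (simp only: of_int_le_iff)
    then have "1 \<le> \<bar>(2::real) ^ r - 2 ^ r'\<bar>" by simp
    then have "k / 4 ^ s * 1 \<le> k / 4 ^ s * \<bar>(2::real) ^ r - 2 ^ r'\<bar>" by (rule mult_left_mono) simp
    also have "\<dots> = \<bar>k / 2 ^ (2 * s - r) - k / 2 ^ (2 * s - r')\<bar>"
      unfolding p[OF r(1)] p[OF r(2)] right_diff_distrib[symmetric] by (simp add: abs_mult)
    also note b
    also have "k / 4 ^ N \<le> k / (4::real) ^ s" using A(2) unfolding s_def by (simp add: frac_le power_increasing)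
    then have "2 * \<epsilon> * k + k / 4 ^ N / 2 \<le> 3 / 4 * (k / 4 ^ s)" unfolding \<epsilon>_def by simp
    finally have "k / (4::real) ^ s \<le> 3 / 4 * (k / 4 ^ s)" by simp
    moreover have "k / (4::real) ^ s > 0" using k0 by simp
    ultimately show False by linarith
  qed
qed

section \<open>Differences in the set \<open>A\<^sub>0\<close>\<close>

lemma SidonD: "\<lbrakk>Sidon A; a \<in> A; b \<in> A; c \<in> A; d \<in> A; a + b = c + d\<rbrakk> \<Longrightarrow> {a, b} = {c, d}"
  unfolding Sidon_def by blast

text \<open>A sum involving n exceeds every sum of two elements of A, so n must occur on both sides
  and can be cancelled. In particular the greedy choice never gets stuck, and its
  \<open>LEAST\<close> is attained.\<close>

lemma Sidon_insert_large:
  fixes A :: "nat set"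
  assumes A: "Sidon A" and n: "\<And>a. a \<in> A \<Longrightarrow> 2 * a < n"
  shows "Sidon (insert n A)"
  unfolding Sidon_def
proof (intro ballI impI)
  fix a b c d assume h: "a \<in> insert n A" "b \<in> insert n A" "c \<in> insert n A" "d \<in> insert n A" "a + b = c + d"
  have l: "x = n \<or> (x \<in> A \<and> 2 * x < n)" if "x \<in> insert n A" for x using that n by blast
  show "{a, b} = {c, d}"
  proof (cases "a \<in> A \<and> b \<in> A \<and> c \<in> A \<and> d \<in> A")
    case True
    then show ?thesis using SidonD[OF A] h(5) by blast
  next
    case False
    then have "a = c \<or> a = d" using l[OF h(1)] l[OF h(2)] l[OF h(3)] l[OF h(4)] h(5) by (elim disjE conjE) auto
    then show ?thesis using h(5) by (auto simp: insert_commute)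
  qed
qed

lemma greedy_sidon_step:
  "Sidon (greedy_sidon ` {1..j}) \<and> (2 \<le> j \<longrightarrow> greedy_sidon (j - 1) < greedy_sidon j)"
proof (induction j)
  case 0
  then show ?case by (simp add: Sidon_def)
next
  case (Suc j)
  show ?case
  proof (cases "j = 0")
    case True
    then show ?thesis by (simp add: Sidon_def)
  next
    case False
    let ?A = "greedy_sidon ` {1..j}"
    let ?P = "\<lambda>n. greedy_sidon j < n \<and> Sidon (insert n ?A)"
    define n where "n = Suc (2 * Max ?A)"
    have n: "2 * a < n" if "a \<in> ?A" for a
    proof -
      have "a \<le> Max ?A" using that by (intro Max_ge) auto
      then show ?thesis unfolding n_def by simp
    qed
    have "greedy_sidon j \<in> ?A" using False by auto
    then have "?P n" using Sidon_insert_large[of ?A n] n Suc by force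
    then have "?P (LEAST n. ?P n)" by (rule LeastI)
    moreover have "greedy_sidon (Suc j) = (LEAST n. ?P n)"
      using False by (subst greedy_sidon.simps) simp
    moreover have "greedy_sidon ` {1..Suc j} = insert (greedy_sidon (Suc j)) ?A"
      by (simp add: atLeastAtMostSuc_conv)
    ultimately show ?thesis by simp
  qed
qed

lemma greedy_sidon_Sidon: "Sidon (greedy_sidon ` {1..j})"
  using greedy_sidon_step by blast

lemma greedy_sidon_less: "\<lbrakk>1 \<le> i; i < j\<rbrakk> \<Longrightarrow> greedy_sidon i < greedy_sidon j"
proof (induction j)
  case (Suc j)
  have "greedy_sidon j < greedy_sidon (Suc j)" using greedy_sidon_step[of "Suc j"] Suc.prems by simp
  then show ?case using Suc by (cases "i = j") auto
qed simp

lemma greedy_sidon_le: "\<lbrakk>1 \<le> i; i \<le> j\<rbrakk> \<Longrightarrow> greedy_sidon i \<le> greedy_sidon j"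
  using greedy_sidon_less[of i j] by (cases "i = j") auto

lemma greedy_sidon_eq_iff: "\<lbrakk>1 \<le> i; 1 \<le> j\<rbrakk> \<Longrightarrow> greedy_sidon i = greedy_sidon j \<longleftrightarrow> i = j"
  using greedy_sidon_less[of i j] greedy_sidon_less[of j i] by (cases i j rule: linorder_cases) auto

lemma greedy_sidon_pos: "1 \<le> j \<Longrightarrow> 1 \<le> greedy_sidon j"
proof -
  assume "1 \<le> j"
  then have "greedy_sidon 1 \<le> greedy_sidon j" by (intro greedy_sidon_le) auto
  moreover have "greedy_sidon 1 = 1" by (subst greedy_sidon.simps) simp
  ultimately show ?thesis by linarith
qed

section \<open>Uniqueness of lacunary expansions\<close>

text \<open>A partial sum below T n plus a term of size at most 4 T n stays below 5 T n. The bound 4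
  on the coefficients fits the comparison of two differences of elements of \<open>A0\<close>: four
  terms, each with coefficients of absolute value at most 1.\<close>

lemma lacunary_abs_bound:
  fixes T c :: "nat \<Rightarrow> int"
  assumes "\<And>i. i \<in> {1..n} \<Longrightarrow> 5 * T i \<le> T (Suc i)" "\<And>i. i \<in> {1..n} \<Longrightarrow> \<bar>c i\<bar> \<le> 4" "\<bar>c0\<bar> < T 1"
  shows "\<bar>(\<Sum>i = 1..n. c i * T i) + c0\<bar> < T (Suc n)"
  using assms
proof (induction n)
  case (Suc n)
  have IH: "\<bar>(\<Sum>i = 1..n. c i * T i) + c0\<bar> < T (Suc n)" by (rule Suc.IH) (use Suc.prems in auto)
  have "\<bar>c (Suc n) * T (Suc n)\<bar> \<le> 4 * T (Suc n)"
  proof -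
    have "T (Suc n) > 0" using IH by linarith
    then show ?thesis using Suc.prems(2)[of "Suc n"] by (simp add: abs_mult)
  qed
  then show ?case using IH Suc.prems(1)[of "Suc n"] by simp
qed simp

lemma lacunary_zero:
  fixes T c :: "nat \<Rightarrow> int"
  assumes "\<And>i. i \<in> {1..n} \<Longrightarrow> 5 * T i \<le> T (Suc i)" "\<And>i. i \<in> {1..n} \<Longrightarrow> \<bar>c i\<bar> \<le> 4" "\<bar>c0\<bar> < T 1"
    and "(\<Sum>i = 1..n. c i * T i) + c0 = 0"
  shows "c0 = 0 \<and> (\<forall>i\<in>{1..n}. c i = 0)"
  using assms
proof (induction n)
  case (Suc n)
  have b: "\<bar>(\<Sum>i = 1..n. c i * T i) + c0\<bar> < T (Suc n)"
    by (rule lacunary_abs_bound) (use Suc.prems in auto)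
  have e: "(\<Sum>i = 1..n. c i * T i) + c0 = - (c (Suc n) * T (Suc n))" using Suc.prems(4) by simp
  have z: "c (Suc n) = 0"
  proof (rule ccontr)
    assume "c (Suc n) \<noteq> 0"
    then have "1 \<le> \<bar>c (Suc n)\<bar>" by simp
    then have "T (Suc n) \<le> \<bar>c (Suc n)\<bar> * T (Suc n)" using b mult_right_mono[of 1 "\<bar>c (Suc n)\<bar>" "T (Suc n)"] by linarith
    also have "\<dots> = \<bar>- (c (Suc n) * T (Suc n))\<bar>" using b by (simp add: abs_mult)
    also have "\<dots> < T (Suc n)" using b unfolding e .
    finally show False by simp
  qed
  have "(\<Sum>i = 1..n. c i * T i) + c0 = 0" using Suc.prems(4) z by simp
  then have "c0 = 0 \<and> (\<forall>i\<in>{1..n}. c i = 0)"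
    by (intro Suc.IH Suc.prems(1,2,3)) simp_all
  moreover have "{1..Suc n} = insert (Suc n) {1..n}" by auto
  ultimately show ?case using z by (metis insert_iff)
qed simp

text \<open>The modulus is treated as one further scale: the expansion is smaller than it, so
  divisibility already means being zero.\<close>

lemma lacunary_zero_mod:
  fixes T c :: "nat \<Rightarrow> int"
  assumes "\<And>i. i \<in> {1..n} \<Longrightarrow> 5 * T i \<le> T (Suc i)" "\<And>i. i \<in> {1..n} \<Longrightarrow> \<bar>c i\<bar> \<le> 4" "\<bar>c0\<bar> < T 1"
    and "T (Suc n) dvd (\<Sum>i = 1..n. c i * T i) + c0"
  shows "c0 = 0 \<and> (\<forall>i\<in>{1..n}. c i = 0)"
proof (rule lacunary_zero[OF assms(1-3)])
  have "\<bar>(\<Sum>i = 1..n. c i * T i) + c0\<bar> < T (Suc n)" by (rule lacunary_abs_bound[OF assms(1-3)])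
  then show "(\<Sum>i = 1..n. c i * T i) + c0 = 0"
    using assms(4) dvd_imp_le_int[of "(\<Sum>i = 1..n. c i * T i) + c0" "T (Suc n)"] by linarith
qed auto

section \<open>Labels for the elements of \<open>A0\<close>\<close>

type_synonym label = "nat \<times> int \<times> nat \<times> int"

text \<open>\<open>T_large\<close>, \<open>T_lacunary\<close> and \<open>T_small\<close> are what a
  large k has to supply. The left side of \<open>T_large\<close> bounds the contribution of four
  Sidon elements and four bits to a comparison of two differences.\<close>

locale sidon_construction =
  fixes M :: "nat \<Rightarrow> nat" and L k :: nat
  assumes M_odd: "i \<in> {1..6} \<Longrightarrow> odd (M i)"
    and M_ge: "i \<in> {1..6} \<Longrightarrow> 11 \<le> M i"
    and M_inj: "inj_on M {1..6}"
    and L_gt: "L > (\<Sum>i = 1..6. M i)"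
    and k_pos: "k > 0"
    and T_large: "4 * (int L * int (greedy_sidon L) + 1) < T_val k 1"
    and T_lacunary: "i \<in> {1..5} \<Longrightarrow> 5 * T_val k i \<le> T_val k (Suc i)"
    and T_small: "5 * T_val k 6 \<le> int k"
begin

definition offset :: "nat \<Rightarrow> int" where
  "offset i = (if i = 0 then 0 else T_val k i)"

text \<open>Block 0 contains all the others, because m_6 < L, whereas the others are pairwise
  disjoint. This overlap is the source of the representations of T_i as (T_i + g + e) - (g +
  e).\<close>

definition blk :: "nat \<Rightarrow> nat set" where
  "blk i = (if i = 0 then {1..L} else {m_sum M (i - 1) + 1..m_sum M i})"

text \<open>The label \<open>(i, s, j, e)\<close> stands for the element \<open>s (T\<^sub>i + g\<^sub>j + e)\<close>, with \<open>T\<^sub>0 = 0\<close>.\<close>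

definition labels :: "label set" where
  "labels = {(i, s, j, e). i \<le> 6 \<and> s \<in> {1, -1} \<and> j \<in> blk i \<and> e \<in> {0, 1}}"

fun label_val :: "label \<Rightarrow> int" where
  "label_val (i, s, j, e) = s * (offset i + g_val L j + e)"

text \<open>\<open>V_part\<close>, \<open>H_part\<close> and \<open>E_part\<close> are the digits of
  a label value with respect to the scales T_h, L and 1. \<open>V_part\<close> is read only at h
  from 1 to 6, so all these digits vanish for block 0.\<close>

fun V_part :: "label \<Rightarrow> nat \<Rightarrow> int" where
  "V_part (i, s, j, e) h = (if h = i then s else 0)"

fun H_part :: "label \<Rightarrow> int" where
  "H_part (i, s, j, e) = s * int (greedy_sidon j)"

fun E_part :: "label \<Rightarrow> int" where
  "E_part (i, s, j, e) = s * e"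

abbreviation "A0 \<equiv> A0_set M L k"

lemma m_sum_Suc: "m_sum M (Suc i) = m_sum M i + M (Suc i)"
  by (simp add: m_sum_def)

lemma m_sum_mono: "i \<le> j \<Longrightarrow> m_sum M i \<le> m_sum M j"
  by (induction j rule: dec_induct) (auto simp: m_sum_Suc)

lemma blk_card: "i \<noteq> 0 \<Longrightarrow> card (blk i) = M i"
  by (cases i) (auto simp: blk_def m_sum_Suc)

lemma blk_subset: "i \<le> 6 \<Longrightarrow> blk i \<subseteq> {1..L}"
  using m_sum_mono[of i 6] L_gt unfolding blk_def m_sum_def by auto

lemma blk_disjoint: "\<lbrakk>j \<in> blk i; j \<in> blk i'; i \<noteq> 0; i' \<noteq> 0\<rbrakk> \<Longrightarrow> i = i'"
proof (induction i i' rule: linorder_wlog)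
  case (le i i')
  show ?case
  proof (rule ccontr)
    assume "i \<noteq> i'"
    then have "m_sum M i \<le> m_sum M (i' - 1)" using le by (intro m_sum_mono) linarith
    then show False using le.prems unfolding blk_def by auto
  qed
qed auto

lemma finite_blk: "finite (blk i)"
  by (auto simp: blk_def)

lemma labels_finite: "finite labels"
proof (rule finite_subset)
  show "labels \<subseteq> {0..6} \<times> {1, -1} \<times> {1..L} \<times> {0, 1}"
    using blk_subset unfolding labels_def by fastforce
qed auto

lemma L_ge: "L > 66"
proof -
  have "(\<Sum>i = 1..6. M i) \<ge> (\<Sum>i = 1..(6::nat). 11)" by (rule sum_mono) (rule M_ge)
  then show ?thesis using L_gt by simp
qed

lemma A0_labels: "A0 = (\<lambda>l. label_val l mod int k) ` labels"
proof -
  define W where "W = B0_set L \<union> (\<Union>i\<in>{1..6}. {T_val k i + b | b. b \<in> B_set M L i} \<union> {- T_val k i - b | b. b \<in> B_set M L i})"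
  have "W = label_val ` labels"
  proof (rule subset_antisym; rule subsetI)
    fix x assume "x \<in> W"
    then consider (p) j e where "j \<in> {1..L}" "e \<in> {0,1}" "x = g_val L j + e"
      | (m) j e where "j \<in> {1..L}" "e \<in> {0,1}" "x = - g_val L j - e"
      | (tp) i j e where "i \<in> {1..6}" "j \<in> {m_sum M (i - 1) + 1..m_sum M i}" "e \<in> {0,1}" "x = T_val k i + (g_val L j + e)"
      | (tm) i j e where "i \<in> {1..6}" "j \<in> {m_sum M (i - 1) + 1..m_sum M i}" "e \<in> {0,1}" "x = - T_val k i - (g_val L j + e)"
      unfolding W_def B0_set_def G0_set_def B_set_def G_set_def by blast
    then show "x \<in> label_val ` labels"
    proof cases
      case p
      then show ?thesis by (intro image_eqI[of _ _ "(0, 1, j, e)"]) (auto simp: labels_def blk_def offset_def)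
    next
      case m
      then show ?thesis by (intro image_eqI[of _ _ "(0, -1, j, e)"]) (auto simp: labels_def blk_def offset_def)
    next
      case tp
      then show ?thesis by (intro image_eqI[of _ _ "(i, 1, j, e)"]) (auto simp: labels_def blk_def offset_def)
    next
      case tm
      then show ?thesis by (intro image_eqI[of _ _ "(i, -1, j, e)"]) (auto simp: labels_def blk_def offset_def)
    qed
  next
    fix x assume "x \<in> label_val ` labels"
    then obtain p where p: "p \<in> labels" "x = label_val p" by blast
    obtain i s j e where pe: "p = (i, s, j, e)" by (cases p) auto
    have l: "i \<le> 6" "s \<in> {1, -1}" "j \<in> blk i" "e \<in> {0, 1}" "x = s * (offset i + g_val L j + e)"
      using p unfolding pe labels_def by simp_all
    show "x \<in> W"
    proof (cases "i = 0")
      case True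
      then have "g_val L j \<in> G0_set L" using l(3) unfolding blk_def G0_set_def by auto
      moreover have "x = g_val L j + e \<or> x = - g_val L j - e" using l(2,5) True by (auto simp: offset_def)
      ultimately have "x \<in> B0_set L" using l(4) unfolding B0_set_def by blast
      then show ?thesis unfolding W_def by blast
    next
      case False
      then have "g_val L j \<in> G_set M L i" using l(3) unfolding blk_def G_set_def by auto
      then have "g_val L j + e \<in> B_set M L i" using l(4) unfolding B_set_def by blast
      moreover have "x = T_val k i + (g_val L j + e) \<or> x = - T_val k i - (g_val L j + e)"
        using l(2,5) False by (auto simp: offset_def)
      moreover have "i \<in> {1..6}" using False l(1) by simp
      ultimately show ?thesis unfolding W_def by blast
    qed
  qed
  then show ?thesis unfolding A0_set_def residues_of_def W_def[symmetric] by (simp add: image_image)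
qed

lemma label_val_parts:
  assumes "l \<in> labels"
  shows "label_val l = (\<Sum>h = 1..6. V_part l h * T_val k h) + (int L * H_part l + E_part l)"
proof -
  obtain i s j e where l: "l = (i, s, j, e)" by (cases l) auto
  have "i \<le> 6" using assms unfolding l labels_def by simp
  moreover have "(\<Sum>h = 1..6. V_part l h * T_val k h) = (\<Sum>h = 1..6. if h = i then s * T_val k i else 0)"
    unfolding l by (rule sum.cong) auto
  ultimately have "(\<Sum>h = 1..6. V_part l h * T_val k h) = s * offset i"
    by (simp add: offset_def)
  then show ?thesis unfolding l by (simp add: g_val_def algebra_simps)
qed

lemma part_bounds:
  assumes "l \<in> labels"
  shows "\<bar>V_part l h\<bar> \<le> 1" "\<bar>H_part l\<bar> \<le> int (greedy_sidon L)" "\<bar>E_part l\<bar> \<le> 1"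
proof -
  obtain i s j e where l: "l = (i, s, j, e)" by (cases l) auto
  have m: "i \<le> 6" "s \<in> {1, -1}" "j \<in> blk i" "e \<in> {0, 1}" using assms unfolding l labels_def by auto
  then have "j \<in> {1..L}" using blk_subset by blast
  then have "greedy_sidon j \<le> greedy_sidon L" by (intro greedy_sidon_le) auto
  then show "\<bar>V_part l h\<bar> \<le> 1" "\<bar>H_part l\<bar> \<le> int (greedy_sidon L)" "\<bar>E_part l\<bar> \<le> 1"
    using m(2,4) unfolding l by auto
qed

text \<open>The scales are so far apart that a congruence modulo k between two differences holds
  digit by digit. The T digits are separated first, leaving \<open>int L * dH + dE = 0\<close>; then
  \<open>dE\<close>, of absolute value at most 4 and divisible by L > 66, must be 0.\<close>

lemma label_diff_cong:
  assumes l: "p \<in> labels" "q \<in> labels" "p' \<in> labels" "q' \<in> labels"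
    and c: "[label_val p - label_val q = label_val p' - label_val q'] (mod int k)"
  shows "\<forall>h\<in>{1..6}. V_part p h - V_part q h = V_part p' h - V_part q' h"
    and "H_part p - H_part q = H_part p' - H_part q'"
    and "E_part p - E_part q = E_part p' - E_part q'"
proof -
  define c where "c h = V_part p h - V_part q h - (V_part p' h - V_part q' h)" for h
  define dH where "dH = H_part p - H_part q - (H_part p' - H_part q')"
  define dE where "dE = E_part p - E_part q - (E_part p' - E_part q')"
  define T where "T h = (if h = 7 then int k else T_val k h)" for h :: nat
  have dH: "\<bar>dH\<bar> \<le> 4 * int (greedy_sidon L)" and dE: "\<bar>dE\<bar> \<le> 4"
    using part_bounds(2,3)[OF l(1)] part_bounds(2,3)[OF l(2)] part_bounds(2,3)[OF l(3)] part_bounds(2,3)[OF l(4)]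
    unfolding dH_def dE_def by linarith+
  have "c0 = 0 \<and> (\<forall>i\<in>{1..6}. c i = 0)" if "c0 = int L * dH + dE" for c0
  proof (rule lacunary_zero_mod[of 6 T c c0])
    fix i :: nat assume i: "i \<in> {1..6}"
    show "5 * T i \<le> T (Suc i)"
    proof (cases "i = 6")
      case False
      then show ?thesis using i T_lacunary[of i] unfolding T_def by auto
    qed (use T_small in \<open>simp add: T_def\<close>)
    show "\<bar>c i\<bar> \<le> 4"
      using part_bounds(1)[OF l(1), of i] part_bounds(1)[OF l(2), of i] part_bounds(1)[OF l(3), of i] part_bounds(1)[OF l(4), of i]
      unfolding c_def by linarith
  next
    have "\<bar>int L * dH\<bar> \<le> int L * (4 * int (greedy_sidon L))"
      using dH by (simp add: abs_mult mult_left_mono)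
    then show "\<bar>c0\<bar> < T 1" using dE T_large unfolding that T_def by simp
  next
    have "(\<Sum>i = 1..6. c i * T i) = (\<Sum>i = 1..6. c i * T_val k i)" unfolding T_def by (rule sum.cong) auto
    then have "(\<Sum>i = 1..6. c i * T i) + c0 = label_val p - label_val q - (label_val p' - label_val q')"
      unfolding that c_def dH_def dE_def label_val_parts[OF l(1)] label_val_parts[OF l(2)]
        label_val_parts[OF l(3)] label_val_parts[OF l(4)]
      by (simp add: algebra_simps sum_subtractf sum.distrib)
    then show "T (Suc 6) dvd (\<Sum>i = 1..6. c i * T i) + c0"
      using \<open>[label_val p - label_val q = label_val p' - label_val q'] (mod int k)\<close>
      unfolding T_def by (simp add: cong_iff_dvd_diff)
  qed
  then have z: "int L * dH + dE = 0" "\<forall>i\<in>{1..6}. c i = 0" by auto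
  have "int L dvd dE" using z(1) by (metis dvd_add_right_iff dvd_triv_left dvd_0_right)
  then have "dE = 0" using dE L_ge dvd_imp_le_int[of dE "int L"] by fastforce
  moreover from this have "dH = 0" using z(1) L_ge by simp
  ultimately show "\<forall>h\<in>{1..6}. V_part p h - V_part q h = V_part p' h - V_part q' h"
    "H_part p - H_part q = H_part p' - H_part q'" "E_part p - E_part q = E_part p' - E_part q'"
    using z(2) unfolding c_def dH_def dE_def by auto
qed

lemma signed_sidon_eq:
  assumes "s \<in> {1, -1}" "s' \<in> {1, -1}" "1 \<le> j" "1 \<le> j'" "s * int (greedy_sidon j) = s' * int (greedy_sidon j')"
  shows "s = s' \<and> j = j'"
proof -
  have "s = s'" using assms greedy_sidon_pos[of j] greedy_sidon_pos[of j'] by auto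
  then have "greedy_sidon j = greedy_sidon j'" using assms by auto
  then show ?thesis using assms \<open>s = s'\<close> greedy_sidon_eq_iff by blast
qed

text \<open>As the Sidon elements are positive and distinct, the H digit reveals the sign and the
  index; the E digit then gives the bit, and the position of the nonzero T digit, if any, gives the
  block.\<close>

lemma label_eqI:
  assumes p: "p \<in> labels" "p' \<in> labels"
    and "\<forall>h\<in>{1..6}. V_part p h = V_part p' h" "H_part p = H_part p'" "E_part p = E_part p'"
  shows "p = p'"
proof -
  obtain i s j e i' s' j' e' where l: "p = (i, s, j, e)" "p' = (i', s', j', e')" by (cases p, cases p') auto
  have m: "i \<le> 6" "s \<in> {1, -1}" "j \<in> blk i" "i' \<le> 6" "s' \<in> {1, -1}" "j' \<in> blk i'"
    using p unfolding l labels_def by auto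
  then have "j \<in> {1..L}" "j' \<in> {1..L}" using blk_subset by blast+
  then have "1 \<le> j" "1 \<le> j'" by simp_all
  from signed_sidon_eq[OF m(2,5) this] have sj: "s = s' \<and> j = j'" using assms(4) unfolding l by (simp only: H_part.simps)
  moreover have "e = e'" using assms(5) sj m(2) unfolding l by auto
  moreover have "i = i'"
  proof (rule ccontr)
    assume ne: "i \<noteq> i'"
    have s0: "s \<noteq> 0" using m(2) by auto
    have "s = 0" if "i \<in> {1..6}"
      using bspec[OF assms(3) that] ne unfolding l by simp
    moreover have "s' = 0" if "i' \<in> {1..6}"
      using bspec[OF assms(3) that] ne unfolding l by simp
    ultimately have "i \<notin> {1..6}" "i' \<notin> {1..6}" using sj s0 by blast+
    then show False using ne m(1,4) by simp
  qed
  ultimately show ?thesis unfolding l by simp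
qed

lemma label_inj: "inj_on (\<lambda>l. label_val l mod int k) labels"
proof (rule inj_onI)
  fix p p' assume p: "p \<in> labels" "p' \<in> labels" and e: "label_val p mod int k = label_val p' mod int k"
  then have "[label_val p - label_val p = label_val p' - label_val p] (mod int k)"
    by (intro cong_diff) (auto simp: Cong.cong_def)
  from label_diff_cong[OF p(1,1) p(2) p(1) this] show "p = p'"
    by (intro label_eqI[OF p]) auto
qed

lemma A0_subset: "A0 \<subseteq> Zmod k"
  unfolding A0_labels Zmod_def using k_pos by auto

definition label_pairs :: "int \<Rightarrow> (label \<times> label) set" where
  "label_pairs d = {(p, q). p \<in> labels \<and> q \<in> labels \<and> [label_val p - label_val q = d] (mod int k)}"

lemma diff_count_label_pairs: "diff_count k A0 d = card (label_pairs d)"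
proof -
  let ?g = "\<lambda>l. label_val l mod int k"
  have "inj_on (map_prod ?g ?g) (labels \<times> labels)" using label_inj by (rule map_prod_inj_on) (rule label_inj)
  moreover have "label_pairs d \<subseteq> labels \<times> labels" unfolding label_pairs_def by auto
  ultimately have i: "inj_on (map_prod ?g ?g) (label_pairs d)" by (rule inj_on_subset)
  have c: "[?g p - ?g q = d] (mod int k) \<longleftrightarrow> [label_val p - label_val q = d] (mod int k)" for p q
    by (simp add: Cong.cong_def mod_simps)
  have "{(a, b). a \<in> A0 \<and> b \<in> A0 \<and> [a - b = d] (mod int k)} = map_prod ?g ?g ` label_pairs d"
    unfolding A0_labels label_pairs_def using c by force
  then show ?thesis unfolding diff_count_def using card_image[OF i] by simp
qed

lemma finite_label_pairs: "finite (label_pairs d)"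
  by (rule finite_subset[of _ "labels \<times> labels"]) (auto simp: label_pairs_def labels_finite)

lemma card_A0: "card A0 = card labels"
  unfolding A0_labels by (rule card_image[OF label_inj])

end

section \<open>Counting the representations of a difference\<close>

lemma card_fibres_le:
  assumes "finite P" "key ` P \<subseteq> Q" "finite Q" "\<And>x. x \<in> P \<Longrightarrow> card {y \<in> P. key y = key x} \<le> b"
  shows "card P \<le> card Q * b"
proof -
  have "P = (\<Union>\<kappa>\<in>key ` P. {y \<in> P. key y = \<kappa>})" by blast
  then have "card P \<le> (\<Sum>\<kappa>\<in>key ` P. card {y \<in> P. key y = \<kappa>})"
    using card_UN_le[OF finite_imageI[OF assms(1), of key], of "\<lambda>\<kappa>. {y \<in> P. key y = \<kappa>}"] by simp
  also have "\<dots> \<le> (\<Sum>\<kappa>\<in>key ` P. b)" by (rule sum_mono) (use assms(4) in blast)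
  also have "\<dots> = card (key ` P) * b" by simp
  also have "\<dots> \<le> card Q * b" using card_mono[OF assms(3,2)] by simp
  finally show ?thesis .
qed

context sidon_construction
begin

lemma label_pairs_diff:
  assumes "(p, q) \<in> label_pairs d" "(p', q') \<in> label_pairs d"
  shows "\<forall>h\<in>{1..6}. V_part p h - V_part q h = V_part p' h - V_part q' h"
    and "H_part p - H_part q = H_part p' - H_part q'"
    and "E_part p - E_part q = E_part p' - E_part q'"
proof -
  have "p \<in> labels" "q \<in> labels" "p' \<in> labels" "q' \<in> labels"
    "[label_val p - label_val q = label_val p' - label_val q'] (mod int k)"
    using assms unfolding label_pairs_def by (auto simp: Cong.cong_def)
  from label_diff_cong[OF this] show
    "\<forall>h\<in>{1..6}. V_part p h - V_part q h = V_part p' h - V_part q' h"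
    "H_part p - H_part q = H_part p' - H_part q'" "E_part p - E_part q = E_part p' - E_part q'" by auto
qed

text \<open>An index lies in at most one block besides block 0, so knowing whether the block number
  is 0 determines it.\<close>

lemma label_eq_from_block:
  assumes l: "(i, s, j, e) \<in> labels" "(i', s, j, e') \<in> labels"
    and z: "i = 0 \<longleftrightarrow> i' = 0"
  shows "i = i'"
proof (cases "i = 0")
  case False
  then show ?thesis using l z blk_disjoint[of j i i'] unfolding labels_def by auto
qed (use z in simp)

lemma label_index: "(i, s, j, e) \<in> labels \<Longrightarrow> 1 \<le> j \<and> j \<le> L \<and> s \<in> {1, -1} \<and> e \<in> {0, 1} \<and> i \<le> 6 \<and> j \<in> blk i"
  using blk_subset[of i] unfolding labels_def by auto

text \<open>Once the signs, the vanishing of the first block index and the first bit are fixed (16 choices),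
  the Sidon property leaves at most two pairs.\<close>

lemma card_label_pairs_le:
  assumes base: "(p0, q0) \<in> label_pairs d" "H_part p0 \<noteq> H_part q0"
  shows "card (label_pairs d) \<le> 32"
proof -
  define key where "key = (\<lambda>(p :: label, q :: label). (fst (snd p), fst (snd q), fst p = 0, snd (snd (snd p))))"
  define Q where "Q = {1, -1 :: int} \<times> {1, -1 :: int} \<times> (UNIV :: bool set) \<times> {0, 1 :: int}"
  have Q: "finite Q" "card Q = 16" unfolding Q_def by (simp_all add: card_cartesian_product)
  have kQ: "key ` label_pairs d \<subseteq> Q"
    unfolding key_def Q_def label_pairs_def labels_def by auto
  have "card {y \<in> label_pairs d. key y = key x} \<le> 2" if x: "x \<in> label_pairs d" for x
  proof -
    obtain i1 s j1 e i1' s' j1' e1' where xe: "x = ((i1, s, j1, e), (i1', s', j1', e1'))"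
      by (cases x) auto
    note xl = x[unfolded xe]
    have xL: "(i1, s, j1, e) \<in> labels" "(i1', s', j1', e1') \<in> labels" using xl unfolding label_pairs_def by auto
    note x1 = label_index[OF xL(1)] and x2 = label_index[OF xL(2)]
    define F where "F = {y \<in> label_pairs d. key y = key x}"
    define g where "g = (\<lambda>(p :: label, q :: label). fst (snd (snd p)))"
    have Fe: "\<exists>i j i' j' e'. y = ((i, s, j, e), (i', s', j', e')) \<and> (i, s, j, e) \<in> labels \<and> (i', s', j', e') \<in> labels
        \<and> (i = 0 \<longleftrightarrow> i1 = 0) \<and> ((i, s, j, e), (i', s', j', e')) \<in> label_pairs d" if "y \<in> F" for y
    proof -
      obtain i s2 j e2 i' s2' j' e' where ye: "y = ((i, s2, j, e2), (i', s2', j', e'))" by (cases y) auto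
      have "s2 = s" "s2' = s'" "e2 = e" "i = 0 \<longleftrightarrow> i1 = 0"
        using that unfolding F_def ye xe key_def by auto
      then show ?thesis using that unfolding F_def ye by (auto simp: label_pairs_def)
    qed
    have "inj_on g F"
    proof (rule inj_onI)
      fix y z assume y: "y \<in> F" and z: "z \<in> F" and eq: "g y = g z"
      from Fe[OF y] obtain i j i' j' e' where ye: "y = ((i, s, j, e), (i', s', j', e'))"
        "(i, s, j, e) \<in> labels" "(i', s', j', e') \<in> labels" "i = 0 \<longleftrightarrow> i1 = 0" "((i, s, j, e), (i', s', j', e')) \<in> label_pairs d"
        by blast
      from Fe[OF z] obtain ii jj ii' jj' ee' where ze: "z = ((ii, s, jj, e), (ii', s', jj', ee'))"
        "(ii, s, jj, e) \<in> labels" "(ii', s', jj', ee') \<in> labels" "ii = 0 \<longleftrightarrow> i1 = 0" "((ii, s, jj, e), (ii', s', jj', ee')) \<in> label_pairs d"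
        by blast
      have j: "jj = j" using eq unfolding g_def ye ze by simp
      have i: "ii = i" using label_eq_from_block[OF ye(2)] ze(2,4) ye(4) unfolding j by blast
      have p: "(ii, s, jj, e) = (i, s, j, e)" using i j by simp
      note D = label_pairs_diff[OF ye(5) ze(5)[unfolded p]]
      have "(i', s', j', e') = (ii', s', jj', ee')"
        using D by (intro label_eqI[OF ye(3) ze(3)]) auto
      then show "y = z" unfolding ye(1) ze(1) p by simp
    qed
    moreover have "g ` F \<subseteq> {j1, j1'}"
    proof
      fix j assume "j \<in> g ` F"
      then obtain y where y: "y \<in> F" "j = g y" by blast
      from Fe[OF y(1)] obtain i j2 i' j' e' where ye: "y = ((i, s, j2, e), (i', s', j', e'))"
        "(i, s, j2, e) \<in> labels" "(i', s', j', e') \<in> labels" "((i, s, j2, e), (i', s', j', e')) \<in> label_pairs d"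
        by blast
      have j2: "j2 = j" using y(2) unfolding ye(1) g_def by simp
      note y1 = label_index[OF ye(2)[unfolded j2]] and y2 = label_index[OF ye(3)]
      define a where "a = greedy_sidon"
      have D: "s * int (a j) - s' * int (a j') = s * int (a j1) - s' * int (a j1')"
        using label_pairs_diff(2)[OF ye(4)[unfolded j2] xl] unfolding a_def by simp
      have ne: "s * int (a j1) \<noteq> s' * int (a j1')"
        using label_pairs_diff(2)[OF xl base(1)] base(2) unfolding a_def by auto
      have aj: "a j \<in> a ` {1..L}" "a j' \<in> a ` {1..L}" "a j1 \<in> a ` {1..L}" "a j1' \<in> a ` {1..L}"
        using x1 x2 y1 y2 by auto
      have S: "Sidon (a ` {1..L})" unfolding a_def by (rule greedy_sidon_Sidon)
      \<comment> \<open>Opposite signs give a Sidon relation directly. Equal signs give one after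
        exchanging terms across the equation, and its unwanted solution would make the two H digits
        of the pair equal, contrary to \<open>ne\<close>.\<close>
      have "a j \<in> {a j1, a j1'}"
      proof (cases "s = s'")
        case True
        then have "s = s' \<and> (s = 1 \<or> s = -1)" using x1 by auto
        then have "a j + a j1' = a j1 + a j'" using D by auto
        from SidonD[OF S aj(1,4,3,2) this] have "a j = a j1 \<or> (a j = a j' \<and> a j1' = a j1)"
          by (auto simp: doubleton_eq_iff)
        then show ?thesis using ne True by auto
      next
        case False
        then have "s = 1 \<and> s' = -1 \<or> s = -1 \<and> s' = 1" using x1 x2 by auto
        then have "a j + a j' = a j1 + a j1'" using D by auto
        from SidonD[OF S aj this] show ?thesis by (auto simp: doubleton_eq_iff)
      qed
      then show "j \<in> {j1, j1'}" using greedy_sidon_eq_iff x1 x2 y1 unfolding a_def by auto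
    qed
    ultimately have "card F \<le> card {j1, j1'}" by (intro card_inj_on_le[of g]) auto
    also have "\<dots> \<le> 2" by (simp add: card_insert_le_m1)
    finally show ?thesis unfolding F_def .
  qed
  from card_fibres_le[OF finite_label_pairs kQ Q(1) this] show ?thesis using Q(2) by simp
qed

text \<open>Equal H digits mean the same sign and the same Sidon element, which cancels. By
  disjointness of the nonzero blocks, the two blocks agree or one of them is block 0, so that at
  most one T_i is left over.\<close>

lemma label_pairs_equal_H:
  assumes "(p, q) \<in> label_pairs d" "H_part p = H_part q"
  obtains \<epsilon> \<tau> i where "\<epsilon> \<in> {-1, 0, 1}" "\<tau> \<in> {1, -1}" "i \<le> 6" "[d = \<tau> * (offset i + \<epsilon>)] (mod int k)"
proof -
  obtain i s j e i' s' j' e' where pq: "p = (i, s, j, e)" "q = (i', s', j', e')" by (cases p, cases q) auto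
  have l: "(i, s, j, e) \<in> labels" "(i', s', j', e') \<in> labels" "[d = label_val p - label_val q] (mod int k)"
    using assms(1) unfolding pq label_pairs_def by (auto simp: cong_sym)
  note l1 = label_index[OF l(1)] and l2 = label_index[OF l(2)]
  have sj: "s' = s \<and> j' = j" using signed_sidon_eq[of s s' j j'] l1 l2 assms(2) unfolding pq by auto
  then have d: "[d = s * (offset i - offset i' + (e - e'))] (mod int k)"
    using l(3) unfolding pq by (simp add: algebra_simps)
  consider "i = i'" | "i \<noteq> i'" "i' = 0" | "i \<noteq> i'" "i = 0"
    using blk_disjoint[of j i i'] l1 l2 sj by blast
  then show ?thesis
  proof cases
    case 1
    then show ?thesis using d l1 l2 by (intro that[of "e - e'" s 0]) (auto simp: offset_def)
  next
    case 2
    then show ?thesis using d l1 l2 by (intro that[of "e - e'" s i]) (auto simp: offset_def)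
  next
    case 3
    have "s * (offset i - offset i' + (e - e')) = - s * (offset i' + (e' - e))" using 3 by (simp add: offset_def algebra_simps)
    then show ?thesis using d l1 l2 by (intro that[of "e' - e" "- s" i']) auto
  qed
qed

text \<open>Reads the blocks off the T digits. For s = 1 the scale T_i comes from the first term;
  for s = -1 it comes from subtracting a second term that contains -T_i.\<close>

lemma V_part_index:
  assumes l: "(i1, s, j, e) \<in> labels" "(i2, s, j, e') \<in> labels" "i \<le> 6"
    and V: "\<forall>h\<in>{1..6}. V_part (i1, s, j, e) h - V_part (i2, s, j, e') h = (if h = i then 1 else 0)"
  shows "i = 0 \<and> i1 = i2 \<or> i \<noteq> 0 \<and> (s = 1 \<and> i1 = i \<and> i2 = 0 \<or> s = -1 \<and> i1 = 0 \<and> i2 = i)"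
proof -
  note l1 = label_index[OF l(1)] and l2 = label_index[OF l(2)]
  have v: "(if h = i1 then s else 0) - (if h = i2 then s else 0) = (if h = i then 1 else 0)" if "1 \<le> h" "h \<le> 6" for h
    using V that by auto
  consider "i1 = i2" | "i1 \<noteq> i2" "i2 = 0" | "i1 \<noteq> i2" "i1 = 0"
    using blk_disjoint[of j i1 i2] l1 l2 by blast
  then show ?thesis
  proof cases
    case 1
    then show ?thesis using v[of i] l(3) by (cases "i = 0") auto
  next
    case 2
    then show ?thesis using v[of i1] l1 by (auto split: if_splits)
  next
    case 3
    then show ?thesis using v[of i2] l2 by (auto split: if_splits)
  qed
qed

definition bit_pairs :: "int \<Rightarrow> (int \<times> int) set" where
  "bit_pairs \<epsilon> = {(x, y). x \<in> {0, 1} \<and> y \<in> {0, 1} \<and> x - y = \<epsilon>}"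

lemma bit_pairs_eqs: "bit_pairs 0 = {(0, 0), (1, 1)}" "bit_pairs 1 = {(1, 0)}" "bit_pairs (-1) = {(0, 1)}"
  unfolding bit_pairs_def by auto

lemma card_bit_pairs: "card (bit_pairs 0) = 2" "\<epsilon> \<in> {1, -1} \<Longrightarrow> card (bit_pairs \<epsilon>) = 1"
  by (auto simp: bit_pairs_eqs)

text \<open>For s = -1 both terms are negated and swapped, so either sign yields the same
  difference, namely \<open>offset i - offset i' + x - y\<close>.\<close>

definition pair_of :: "nat \<Rightarrow> nat \<Rightarrow> int \<times> nat \<times> int \<times> int \<Rightarrow> label \<times> label" where
  "pair_of i i' = (\<lambda>(s, j, x, y). if s = 1 then ((i, 1, j, x), (i', 1, j, y)) else ((i', -1, j, y), (i, -1, j, x)))"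

lemma pair_of_inj: "inj_on (pair_of i i') ({1, -1} \<times> UNIV)"
  unfolding pair_of_def by (rule inj_onI) (auto split: if_splits)

lemma pair_of_diff:
  assumes "s \<in> {1, -1}" "(x, y) \<in> bit_pairs \<epsilon>" "pair_of i i' (s, j, x, y) = (p, q)"
  shows "label_val p - label_val q = offset i - offset i' + \<epsilon>"
  using assms unfolding pair_of_def bit_pairs_def by auto

text \<open>A representation consists of a sign, a Sidon element of block i shared with block 0, and
  a pair of bits with difference \<epsilon>; this explains the three factors.\<close>

lemma card_label_pairs_offset:
  assumes i: "i \<in> {1..6}" and \<epsilon>: "\<epsilon> \<in> {-1, 0, 1}"
  shows "card (label_pairs (offset i + \<epsilon>)) = 2 * M i * card (bit_pairs \<epsilon>)"
proof -
  have i0: "i \<noteq> 0" "i \<le> 6" using i by auto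
  let ?D = "{1, -1 :: int} \<times> blk i \<times> bit_pairs \<epsilon>"
  have b0: "blk i \<subseteq> blk 0" using blk_subset[OF i0(2)] by (simp add: blk_def)
  have sub: "pair_of i 0 ` ?D \<subseteq> label_pairs (offset i + \<epsilon>)"
  proof (rule image_subsetI)
    fix t assume t: "t \<in> ?D"
    obtain s j x y where te: "t = (s, j, x, y)" by (cases t) auto
    have h: "s \<in> {1, -1}" "j \<in> blk i" "(x, y) \<in> bit_pairs \<epsilon>" using t unfolding te by auto
    obtain p q where pq: "pair_of i 0 (s, j, x, y) = (p, q)" by (rule prod.exhaust)
    have "label_val p - label_val q = offset i + \<epsilon>" using pair_of_diff[OF h(1,3) pq] by (simp add: offset_def)
    moreover have "p \<in> labels" "q \<in> labels"
      using pq h b0 i0 unfolding pair_of_def bit_pairs_def labels_def by (auto split: if_splits)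
    ultimately show "pair_of i 0 t \<in> label_pairs (offset i + \<epsilon>)" unfolding te pq label_pairs_def by simp
  qed
  moreover have "label_pairs (offset i + \<epsilon>) \<subseteq> pair_of i 0 ` ?D"
  proof
    fix u assume u: "u \<in> label_pairs (offset i + \<epsilon>)"
    obtain i1 s j e i2 s' j' e' where ue: "u = ((i1, s, j, e), (i2, s', j', e'))" by (cases u) auto
    have l: "(i1, s, j, e) \<in> labels" "(i2, s', j', e') \<in> labels" using u unfolding ue label_pairs_def by auto
    note l1 = label_index[OF l(1)] and l2 = label_index[OF l(2)]
    obtain j0 where j0: "j0 \<in> blk i" using blk_card[OF i0(1)] M_ge[OF i] by (metis all_not_in_conv card.empty not_numeral_le_zero)
    obtain x y where xy: "(x, y) \<in> bit_pairs \<epsilon>" using \<epsilon> bit_pairs_eqs by blast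
    \<comment> \<open>One explicit representation provides the digits of the difference; any other
      representation is compared with it.\<close>
    have w: "((i, 1, j0, x), (0, 1, j0, y)) \<in> label_pairs (offset i + \<epsilon>)"
      using sub j0 xy by (auto simp: pair_of_def image_subset_iff)
    note D = label_pairs_diff[OF u[unfolded ue] w]
    have sj: "s' = s \<and> j' = j" using signed_sidon_eq[of s s' j j'] l1 l2 D(2) by auto
    have "\<forall>h\<in>{1..6}. V_part (i1, s, j, e) h - V_part (i2, s, j, e') h = (if h = i then 1 else 0)"
      using D(1) sj i0 by auto
    from V_part_index[OF l(1) l(2)[unfolded conjunct1[OF sj] conjunct2[OF sj]] i0(2) this]
    have V: "s = 1 \<and> i1 = i \<and> i2 = 0 \<or> s = -1 \<and> i1 = 0 \<and> i2 = i" using i0 by blast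
    have E: "s * (e - e') = \<epsilon>" using D(3) xy sj unfolding bit_pairs_def by (auto simp: algebra_simps)
    from V show "u \<in> pair_of i 0 ` ?D"
    proof
      assume h: "s = 1 \<and> i1 = i \<and> i2 = 0"
      then show ?thesis using sj E l1 l2 unfolding ue
        by (intro image_eqI[of _ _ "(1, j, e, e')"]) (auto simp: pair_of_def bit_pairs_def)
    next
      assume h: "s = -1 \<and> i1 = 0 \<and> i2 = i"
      then show ?thesis using sj E l1 l2 unfolding ue
        by (intro image_eqI[of _ _ "(-1, j, e', e)"]) (auto simp: pair_of_def bit_pairs_def)
    qed
  qed
  ultimately have "label_pairs (offset i + \<epsilon>) = pair_of i 0 ` ?D" by blast
  moreover have "inj_on (pair_of i 0) ?D" using pair_of_inj by (rule inj_on_subset) auto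
  ultimately have "card (label_pairs (offset i + \<epsilon>)) = card ?D" by (simp add: card_image)
  then show ?thesis using blk_card[OF i0(1)] by (simp add: card_cartesian_product)
qed

definition index_set :: "(nat \<times> nat) set" where
  "index_set = Sigma {0..6} blk"

lemma card_index_set: "card index_set = L + (\<Sum>i = 1..6. M i)"
proof -
  have "card index_set = (\<Sum>i\<in>{0..6}. card (blk i))" unfolding index_set_def by (simp add: finite_blk)
  also have "{0..6} = insert 0 {1..6::nat}" by auto
  also have "(\<Sum>i\<in>\<dots>. card (blk i)) = L + (\<Sum>i = 1..6. card (blk i))" by (simp add: blk_def)
  also have "(\<Sum>i = 1..6. card (blk i)) = (\<Sum>i = 1..6. M i)" by (rule sum.cong) (auto simp: blk_card)
  finally show ?thesis .
qed

lemma card_labels: "card labels = 4 * (L + (\<Sum>i = 1..6. M i))"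
proof -
  have "labels = (\<lambda>((i, j), s, e). (i, s, j, e)) ` (index_set \<times> {1, -1} \<times> {0, 1})"
    unfolding labels_def index_set_def by force
  moreover have "inj_on (\<lambda>((i, j), s, e). (i, s, j, e)) (index_set \<times> {1, -1 :: int} \<times> {0, 1 :: int})"
    by (rule inj_onI) auto
  ultimately have "card labels = card (index_set \<times> {1, -1 :: int} \<times> {0, 1 :: int})" by (simp add: card_image)
  then show ?thesis by (simp add: card_cartesian_product card_index_set)
qed

text \<open>Both terms of a representation have the same block, sign and Sidon element, and the bits
  are forced: one representation for each position in \<open>index_set\<close> and each
  sign.\<close>

lemma card_label_pairs_small:
  assumes \<epsilon>: "\<epsilon> \<in> {-1, 1}"
  shows "card (label_pairs \<epsilon>) = 2 * (L + (\<Sum>i = 1..6. M i))"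
proof -
  let ?D = "index_set \<times> {1, -1 :: int} \<times> bit_pairs \<epsilon>"
  define f where "f = (\<lambda>((i, j), s, x, y). pair_of i i (s, j, x, y))"
  have sub: "f ` ?D \<subseteq> label_pairs \<epsilon>"
  proof (rule image_subsetI)
    fix t assume t: "t \<in> ?D"
    obtain i j s x y where te: "t = ((i, j), s, x, y)" by (cases t) auto
    have h: "s \<in> {1, -1}" "j \<in> blk i" "(x, y) \<in> bit_pairs \<epsilon>" "i \<le> 6" using t unfolding te index_set_def by auto
    obtain p q where pq: "pair_of i i (s, j, x, y) = (p, q)" by (rule prod.exhaust)
    have "label_val p - label_val q = \<epsilon>" using pair_of_diff[OF h(1,3) pq] by simp
    moreover have "p \<in> labels" "q \<in> labels"
      using pq h unfolding pair_of_def bit_pairs_def labels_def by (auto split: if_splits)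
    ultimately show "f t \<in> label_pairs \<epsilon>" unfolding te f_def by (simp add: pq label_pairs_def)
  qed
  moreover have "label_pairs \<epsilon> \<subseteq> f ` ?D"
  proof
    fix u assume u: "u \<in> label_pairs \<epsilon>"
    obtain i1 s j e i2 s' j' e' where ue: "u = ((i1, s, j, e), (i2, s', j', e'))" by (cases u) auto
    have l: "(i1, s, j, e) \<in> labels" "(i2, s', j', e') \<in> labels" using u unfolding ue label_pairs_def by auto
    note l1 = label_index[OF l(1)] and l2 = label_index[OF l(2)]
    obtain x y where xy: "(x, y) \<in> bit_pairs \<epsilon>" using \<epsilon> bit_pairs_eqs by blast
    have "(0, 1) \<in> index_set" using L_ge unfolding index_set_def blk_def by simp
    then have "((0, 1), 1, x, y) \<in> ?D" using xy by simp
    then have "f ((0, 1), 1, x, y) \<in> label_pairs \<epsilon>" using sub by blast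
    then have w: "((0, 1, 1, x), (0, 1, 1, y)) \<in> label_pairs \<epsilon>" by (simp add: f_def pair_of_def)
    note D = label_pairs_diff[OF u[unfolded ue] w]
    have sj: "s' = s \<and> j' = j" using signed_sidon_eq[of s s' j j'] l1 l2 D(2) by auto
    have "\<forall>h\<in>{1..6}. V_part (i1, s, j, e) h - V_part (i2, s, j, e') h = (if h = 0 then 1 else 0)"
      using D(1) sj by auto
    from V_part_index[OF l(1) l(2)[unfolded conjunct1[OF sj] conjunct2[OF sj]] _ this]
    have V: "i1 = i2" by blast
    have E: "s * (e - e') = \<epsilon>" using D(3) xy sj unfolding bit_pairs_def by (auto simp: algebra_simps)
    have "s = 1 \<or> s = -1" using l1 by auto
    then show "u \<in> f ` ?D"
    proof
      assume "s = 1"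
      then show ?thesis using V sj E l1 l2 unfolding ue
        by (intro image_eqI[of _ _ "((i1, j), 1, e, e')"]) (auto simp: f_def pair_of_def bit_pairs_def index_set_def)
    next
      assume "s = -1"
      then show ?thesis using V sj E l1 l2 unfolding ue
        by (intro image_eqI[of _ _ "((i1, j), -1, e', e)"]) (auto simp: f_def pair_of_def bit_pairs_def index_set_def)
    qed
  qed
  ultimately have "label_pairs \<epsilon> = f ` ?D" by blast
  moreover have "inj_on f ?D"
    unfolding f_def pair_of_def by (rule inj_onI) (auto split: if_splits)
  ultimately have "card (label_pairs \<epsilon>) = card ?D" by (simp add: card_image)
  then show ?thesis using card_bit_pairs(2)[of \<epsilon>] \<epsilon> by (auto simp: card_cartesian_product card_index_set)
qed

section \<open>Which differences share a representation count\<close>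

lemma diff_count_cong: "[d = d'] (mod int k) \<Longrightarrow> diff_count k A d = diff_count k A d'"
  unfolding diff_count_def by (simp add: Cong.cong_def)

lemma diff_count_uminus: "diff_count k A (- d) = diff_count k A d"
proof -
  have "{(a, b). a \<in> A \<and> b \<in> A \<and> [a - b = - d] (mod int k)}
    = prod.swap ` {(a, b). a \<in> A \<and> b \<in> A \<and> [a - b = d] (mod int k)}"
  proof -
    have "[a - b = - d] (mod int k) \<longleftrightarrow> [b - a = d] (mod int k)" for a b
      using cong_minus_minus_iff[of "a - b" "- d" "int k"] by simp
    then show ?thesis by force
  qed
  then show ?thesis unfolding diff_count_def by (simp add: card_image)
qed

lemma diff_count_signed: "\<tau> \<in> {1, -1} \<Longrightarrow> diff_count k A (\<tau> * d) = diff_count k A d"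
  using diff_count_uminus by auto

text \<open>The last alternative covers T_i + 1 and T_i - 1 up to sign; only the value is recorded
  there, as it serves merely to rule these differences out. The alternatives may overlap.\<close>

lemma diff_count_cases:
  obtains "diff_count k A0 d \<le> 32"
  | "[d = 0] (mod int k)"
  | \<tau> where "\<tau> \<in> {1, -1}" "[d = \<tau>] (mod int k)" "diff_count k A0 d = 2 * (L + (\<Sum>i = 1..6. M i))"
  | \<tau> i where "\<tau> \<in> {1, -1}" "i \<in> {1..6}" "[d = \<tau> * T_val k i] (mod int k)" "diff_count k A0 d = 4 * M i"
  | i where "i \<in> {1..6}" "diff_count k A0 d = 2 * M i"
proof (cases "diff_count k A0 d \<le> 32")
  case True
  then show ?thesis by (rule that(1))
next
  case False
  then have "card (label_pairs d) \<noteq> 0" "\<not> card (label_pairs d) \<le> 32" unfolding diff_count_label_pairs by auto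
  then have "label_pairs d \<noteq> {}" by auto
  then obtain p q where pq: "(p, q) \<in> label_pairs d" by auto
  then have "H_part p = H_part q" using card_label_pairs_le \<open>\<not> card (label_pairs d) \<le> 32\<close> by blast
  from label_pairs_equal_H[OF pq this] obtain \<epsilon> \<tau> i where h: "\<epsilon> \<in> {-1, 0, 1}" "\<tau> \<in> {1, -1}" "i \<le> 6"
    "[d = \<tau> * (offset i + \<epsilon>)] (mod int k)" .
  have dc: "diff_count k A0 d = diff_count k A0 (offset i + \<epsilon>)"
    using diff_count_cong[OF h(4)] diff_count_signed[OF h(2)] by simp
  show ?thesis
  proof (cases "i = 0")
    case True
    show ?thesis
    proof (cases "\<epsilon> = 0")
      case True
      then show ?thesis using that(2) h(4) \<open>i = 0\<close> by (simp add: offset_def)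
    next
      case False
      then have e: "\<epsilon> \<in> {-1, 1}" using h(1) by auto
      have "diff_count k A0 d = 2 * (L + (\<Sum>i = 1..6. M i))"
        using dc True card_label_pairs_small[OF e] unfolding diff_count_label_pairs by (simp add: offset_def)
      moreover have "\<tau> * \<epsilon> \<in> {1, -1}" using e h(2) by auto
      moreover have "[d = \<tau> * \<epsilon>] (mod int k)" using h(4) True by (simp add: offset_def)
      ultimately show ?thesis using that(3) by blast
    qed
  next
    case False
    then have i: "i \<in> {1..6}" using h(3) by simp
    have c: "diff_count k A0 d = 2 * M i * card (bit_pairs \<epsilon>)"
      using dc card_label_pairs_offset[OF i h(1)] unfolding diff_count_label_pairs by simp
    show ?thesis
    proof (cases "\<epsilon> = 0")
      case True
      then have "[d = \<tau> * T_val k i] (mod int k)" using h(4) False by (simp add: offset_def)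
      moreover have "diff_count k A0 d = 4 * M i" using c True card_bit_pairs(1) by simp
      ultimately show ?thesis using that(4) h(2) i by blast
    next
      case False
      then have "diff_count k A0 d = 2 * M i" using c card_bit_pairs(2)[of \<epsilon>] h(1) by auto
      then show ?thesis using that(5) i by blast
    qed
  qed
qed

lemma M_le_sum: "i \<in> {1..6} \<Longrightarrow> M i \<le> (\<Sum>i = 1..6. M i)"
  by (rule member_le_sum) auto

lemma diff_count_one: "diff_count k A0 1 = 2 * (L + (\<Sum>i = 1..6. M i))"
  unfolding diff_count_label_pairs by (rule card_label_pairs_small) simp

lemma diff_count_T: "i \<in> {1..6} \<Longrightarrow> diff_count k A0 (T_val k i) = 4 * M i"
  using card_label_pairs_offset[of i 0] card_bit_pairs(1) unfolding diff_count_label_pairs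
  by (auto simp: offset_def)

lemma diff_count_zero: "diff_count k A0 0 = 4 * (L + (\<Sum>i = 1..6. M i))"
proof -
  have "{(a, b). a \<in> A0 \<and> b \<in> A0 \<and> [a - b = 0] (mod int k)} = (\<lambda>a. (a, a)) ` A0"
  proof -
    have "a = b" if "a \<in> A0" "b \<in> A0" "[a - b = 0] (mod int k)" for a b
    proof -
      have "a mod int k = b mod int k" using that(3) by (simp add: cong_0_iff mod_eq_dvd_iff)
      then show ?thesis using that A0_subset unfolding Zmod_def by (metis atLeastLessThan_iff mod_pos_pos_trivial subset_iff)
    qed
    then show ?thesis by auto
  qed
  then show ?thesis unfolding diff_count_def
    by (simp add: card_image inj_on_def card_A0 card_labels)
qed

text \<open>Used at the end of the rigidity argument: two vertices whose codegree is close to a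
  degree must coincide.\<close>

lemma diff_count_eq_zero:
  assumes "diff_count k A0 d = diff_count k A0 0"
  shows "[d = 0] (mod int k)"
proof -
  have e: "diff_count k A0 d = 4 * (L + (\<Sum>i = 1..6. M i))" using assms diff_count_zero by simp
  consider "diff_count k A0 d \<le> 32" | "[d = 0] (mod int k)"
    | "diff_count k A0 d = 2 * (L + (\<Sum>i = 1..6. M i))"
    | i where "i \<in> {1..6}" "diff_count k A0 d \<le> 4 * M i"
    by (rule diff_count_cases[of d]) auto
  then show ?thesis
  proof cases
    case 4
    then show ?thesis using e M_le_sum[of i] L_gt by simp
  qed (use e L_ge in auto)
qed

lemma diff_count_eq_one:
  assumes "diff_count k A0 d = diff_count k A0 1"
  shows "[d = 1] (mod int k) \<or> [d = -1] (mod int k)"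
proof -
  consider "diff_count k A0 d \<le> 32" | "[d = 0] (mod int k)"
    | \<tau> where "\<tau> \<in> {1, -1}" "[d = \<tau>] (mod int k)"
    | i where "i \<in> {1..6}" "diff_count k A0 d \<le> 4 * M i"
    by (rule diff_count_cases[of d]) auto
  then show ?thesis
  proof cases
    case 2
    then show ?thesis using assms diff_count_cong[of d 0 A0] diff_count_zero diff_count_one L_ge by simp
  next
    case 4
    then show ?thesis using assms diff_count_one M_le_sum[of i] L_gt by simp
  qed (use assms diff_count_one L_ge in auto)
qed

lemma diff_count_eq_T:
  assumes i: "i \<in> {1..6}" and "diff_count k A0 d = diff_count k A0 (T_val k i)"
  shows "[d = T_val k i] (mod int k) \<or> [d = - T_val k i] (mod int k)"
proof -
  have e: "diff_count k A0 d = 4 * M i" using assms diff_count_T by simp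
  have b: "4 * M i < 2 * (L + (\<Sum>i = 1..6. M i))" using M_le_sum[OF i] L_gt by simp
  show ?thesis
  proof (rule diff_count_cases[of d])
    assume "diff_count k A0 d \<le> 32"
    then show ?thesis using e M_ge[OF i] by simp
  next
    assume "[d = 0] (mod int k)"
    then show ?thesis using e b diff_count_cong[of d 0 A0] diff_count_zero by simp
  next
    assume "diff_count k A0 d = 2 * (L + (\<Sum>i = 1..6. M i))"
    then show ?thesis using e b by simp
  next
    fix \<tau> i' assume h: "\<tau> \<in> {1, -1}" "i' \<in> {1..6}" "[d = \<tau> * T_val k i'] (mod int k)" "diff_count k A0 d = 4 * M i'"
    then have "i' = i" using e M_inj i by (simp add: inj_on_eq_iff)
    then show ?thesis using h by auto
  next
    fix i' assume "i' \<in> {1..6}" "diff_count k A0 d = 2 * M i'"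
    then have "M i' = 2 * M i" using e by simp
    then show ?thesis using M_odd[of i'] \<open>i' \<in> {1..6}\<close> by simp
  qed
qed

end

section \<open>Local rigidity\<close>

text \<open>Collects all that the orientation argument uses: unit steps and steps in
  \<open>Tset\<close> are preserved up to sign, and t + 1 is a connection while t - 1 is not.
  \<open>T_range\<close> keeps t + 1 from vanishing modulo k.\<close>

locale local_rigidity =
  fixes k :: nat and S X Tset :: "int set" and f :: "int \<Rightarrow> int"
  assumes k2: "k > 2" and XZ: "X \<subseteq> Zmod k"
    and emb: "induced_embedding (Zmod k) (cayley_adj k S) X f"
    and S_sym: "x \<in> S \<Longrightarrow> (- x) mod int k \<in> S"
    and step_one: "\<lbrakk>x \<in> X; y \<in> X; [y - x = 1] (mod int k)\<rbrakk>
      \<Longrightarrow> [f y - f x = 1] (mod int k) \<or> [f y - f x = - 1] (mod int k)"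
    and step_T: "\<lbrakk>t \<in> Tset; x \<in> X; y \<in> X; [y - x = t] (mod int k)\<rbrakk>
      \<Longrightarrow> [f y - f x = t] (mod int k) \<or> [f y - f x = - t] (mod int k)"
    and T_plus: "t \<in> Tset \<Longrightarrow> (t + 1) mod int k \<in> S"
    and T_minus: "t \<in> Tset \<Longrightarrow> (t - 1) mod int k \<notin> S"
    and T_range: "t \<in> Tset \<Longrightarrow> 1 \<le> t \<and> t + 1 < int k"
begin

text \<open>Periodic extension of f to all integers, so that partial sums along a path need not be
  reduced.\<close>

definition F :: "int \<Rightarrow> int" where "F x = f (x mod int k)"
definition inX :: "int \<Rightarrow> bool" where "inX x \<longleftrightarrow> x mod int k \<in> X"
definition fat :: "int \<Rightarrow> bool" where "fat x \<longleftrightarrow> inX x \<and> inX (x - 1) \<and> inX (x + 1)"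
text \<open>The local orientation of f at x, required to be the same on both sides of x.\<close>

definition has_sign :: "int \<Rightarrow> int \<Rightarrow> bool" where
  "has_sign x s \<longleftrightarrow> s \<in> {1, -1} \<and> [F (x + 1) - F x = s] (mod int k) \<and> [F x - F (x - 1) = s] (mod int k)"

lemma F_inj: "\<lbrakk>inX x; inX y; [F x = F y] (mod int k)\<rbrakk> \<Longrightarrow> [x = y] (mod int k)"
proof -
  assume h: "inX x" "inX y" "[F x = F y] (mod int k)"
  then have "F x \<in> Zmod k" "F y \<in> Zmod k" using emb unfolding induced_embedding_def F_def inX_def by auto
  then have "F x = F y" using h(3) unfolding Zmod_def Cong.cong_def by simp
  then have "x mod int k = y mod int k"
    using h emb unfolding induced_embedding_def F_def inX_def inj_on_def by blast
  then show ?thesis by (simp add: Cong.cong_def)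
qed

lemma F_adj:
  assumes "inX x" "inX y" "\<not> [x = y] (mod int k)" "(y - x) mod int k \<in> S"
  shows "(F y - F x) mod int k \<in> S"
proof -
  have xy: "x mod int k \<in> X" "y mod int k \<in> X" "x mod int k \<noteq> y mod int k"
    using assms unfolding inX_def Cong.cong_def by auto
  have "(y mod int k - x mod int k) mod int k = (y - x) mod int k" by (simp add: mod_simps)
  then have "cayley_adj k S (x mod int k) (y mod int k)"
    using xy XZ assms(4) unfolding cayley_adj_def by auto
  then have "cayley_adj k S (F x) (F y)"
    using emb xy unfolding induced_embedding_def F_def by blast
  then show ?thesis unfolding cayley_adj_def by simp
qed

lemma F_step_one: "\<lbrakk>inX x; inX y; [y - x = 1] (mod int k)\<rbrakk>
   \<Longrightarrow> [F y - F x = 1] (mod int k) \<or> [F y - F x = - 1] (mod int k)"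
  unfolding F_def inX_def by (rule step_one) (simp_all add: Cong.cong_def mod_diff_eq)

lemma F_step_T: "\<lbrakk>t \<in> Tset; inX x; inX y; [y - x = t] (mod int k)\<rbrakk>
   \<Longrightarrow> [F y - F x = t] (mod int k) \<or> [F y - F x = - t] (mod int k)"
  unfolding F_def inX_def by (rule step_T) (simp_all add: Cong.cong_def mod_diff_eq)

lemma not_cong_small: "\<lbrakk>x \<noteq> y; \<bar>x - y\<bar> < int k\<rbrakk> \<Longrightarrow> \<not> [x = y] (mod int k)"
  using dvd_imp_le_int[of "x - y" "int k"] by (auto simp: cong_iff_dvd_diff)

lemma sign_unique:
  assumes "s \<in> {1, -1}" "s' \<in> {1, -1}" "[a = s] (mod int k)" "[a = s'] (mod int k)"
  shows "s = s'"
proof (rule ccontr)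
  assume "s \<noteq> s'"
  moreover have "\<bar>s - s'\<bar> < int k" using assms(1,2) k2 by auto
  ultimately have "\<not> [s = s'] (mod int k)" by (rule not_cong_small)
  moreover have "[s = s'] (mod int k)" using assms(3,4) cong_sym cong_trans by blast
  ultimately show False by contradiction
qed

text \<open>If the two unit steps at x had opposite signs, f would identify x - 1 and x + 1, which
  are distinct because k > 2.\<close>

lemma fat_has_sign:
  assumes "fat x"
  shows "\<exists>s. has_sign x s"
proof -
  have X: "inX x" "inX (x - 1)" "inX (x + 1)" using assms unfolding fat_def by auto
  from F_step_one[OF X(1,3)] obtain s where s: "s \<in> {1, -1}" "[F (x + 1) - F x = s] (mod int k)" by auto
  from F_step_one[OF X(2,1)] obtain s' where s': "s' \<in> {1, -1}" "[F x - F (x - 1) = s'] (mod int k)" by auto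
  have "s' = s"
  proof (rule ccontr)
    assume "s' \<noteq> s"
    then have "s' + s = 0" using s s' by auto
    moreover have "[F x - F (x - 1) + (F (x + 1) - F x) = s' + s] (mod int k)"
      by (rule cong_add[OF s'(2) s(2)])
    ultimately have "[F (x + 1) = F (x - 1)] (mod int k)" by (simp add: cong_iff_dvd_diff)
    then have "[x + 1 = x - 1] (mod int k)" by (rule F_inj[OF X(3,2)])
    then show False using not_cong_small[of "x + 1" "x - 1"] k2 by simp
  qed
  then show ?thesis using s s' unfolding has_sign_def by blast
qed

lemma has_sign_one:
  assumes "fat (x + 1)" "has_sign x s"
  shows "has_sign (x + 1) s" "[F (x + 1) = F x + s] (mod int k)"
proof -
  from fat_has_sign[OF assms(1)] obtain s' where s': "has_sign (x + 1) s'" by blast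
  then have "[F (x + 1) - F x = s'] (mod int k)" unfolding has_sign_def by simp
  then have "s' = s" using s' assms(2) sign_unique unfolding has_sign_def by blast
  then show "has_sign (x + 1) s" using s' by simp
  have "[F (x + 1) - F x = s] (mod int k)" using assms(2) unfolding has_sign_def by simp
  then show "[F (x + 1) = F x + s] (mod int k)" by (simp add: cong_iff_dvd_diff algebra_simps)
qed

text \<open>Opposite signs would send an edge with difference t + 1 to a pair with difference t - 1
  or 1 - t, which is not an edge.\<close>

lemma opposite_signs_excluded:
  assumes t: "t \<in> Tset" and x: "inX x" "inX y" "[y - x = t + 1] (mod int k)"
    and s: "\<tau> \<in> {1, -1}" "s \<in> {1, -1}" and d: "[F y - F x = \<tau> * t + s] (mod int k)"
  shows "\<tau> = s"
proof (rule ccontr)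
  assume ne: "\<tau> \<noteq> s"
  have "\<not> [x = y] (mod int k)"
  proof
    assume "[x = y] (mod int k)"
    then have "[t + 1 = 0] (mod int k)" using x(3)
      by (metis cong_diff_iff_cong_0 cong_sym cong_trans)
    then show False using not_cong_small[of "t + 1" 0] T_range[OF t] by simp
  qed
  moreover have "(y - x) mod int k \<in> S" using x(3) T_plus[OF t] by (simp add: Cong.cong_def)
  ultimately have "(F y - F x) mod int k \<in> S" using F_adj x by blast
  then have S: "(\<tau> * t + s) mod int k \<in> S" using d by (simp add: Cong.cong_def)
  consider "\<tau> = 1" "s = -1" | "\<tau> = -1" "s = 1" using s ne by auto
  then show False
  proof cases
    case 1
    then show ?thesis using S T_minus[OF t] by simp
  next
    case 2
    then have "(1 - t) mod int k \<in> S" using S by (simp add: algebra_simps)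
    then have "(- ((1 - t) mod int k)) mod int k \<in> S" by (rule S_sym)
    moreover have "(- ((1 - t) mod int k)) mod int k = (t - 1) mod int k" by (simp add: mod_minus_eq)
    ultimately show ?thesis using T_minus[OF t] by simp
  qed
qed

text \<open>The pair x, x + t + 1 ties the sign of the long step to the orientation at x + t; the
  pair x - 1, x + t ties it to the orientation at x. Hence the long step transports the
  orientation.\<close>

lemma has_sign_T:
  assumes t: "t \<in> Tset" and x: "fat x" "fat (x + t)" "has_sign x s"
  shows "has_sign (x + t) s" "[F (x + t) = F x + s * t] (mod int k)"
proof -
  have X: "inX x" "inX (x + t)" "inX (x - 1)" "inX (x + t + 1)" using x(1,2) unfolding fat_def by auto
  from fat_has_sign[OF x(2)] obtain s' where s': "has_sign (x + t) s'" by blast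
  have st: "[F (x + t) - F x = t] (mod int k) \<or> [F (x + t) - F x = - t] (mod int k)"
    by (rule F_step_T[OF t X(1,2)]) simp
  obtain \<tau> where \<tau>: "\<tau> \<in> {1, -1}" "[F (x + t) - F x = \<tau> * t] (mod int k)"
  proof -
    from st consider "[F (x + t) - F x = 1 * t] (mod int k)" | "[F (x + t) - F x = - 1 * t] (mod int k)"
      by (simp only: mult_1 mult_minus1) blast
    then show thesis using that by cases blast+
  qed
  have s1: "s \<in> {1, -1}" "[F x - F (x - 1) = s] (mod int k)" using x(3) unfolding has_sign_def by auto
  have s2: "s' \<in> {1, -1}" "[F (x + t + 1) - F (x + t) = s'] (mod int k)" using s' unfolding has_sign_def by auto
  have "\<tau> = s'"
  proof (rule opposite_signs_excluded[OF t X(1,4) _ \<tau>(1) s2(1)])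
    show "[x + t + 1 - x = t + 1] (mod int k)" by simp
    show "[F (x + t + 1) - F x = \<tau> * t + s'] (mod int k)" using cong_add[OF \<tau>(2) s2(2)] by simp
  qed
  moreover have "\<tau> = s"
  proof (rule opposite_signs_excluded[OF t X(3,2) _ \<tau>(1) s1(1)])
    show "[x + t - (x - 1) = t + 1] (mod int k)" by simp
    show "[F (x + t) - F (x - 1) = \<tau> * t + s] (mod int k)" using cong_add[OF \<tau>(2) s1(2)] by simp
  qed
  ultimately show "has_sign (x + t) s" "[F (x + t) = F x + s * t] (mod int k)"
    using s' \<tau>(2) by (simp_all add: cong_iff_dvd_diff algebra_simps)
qed

lemma path_affine:
  assumes "set ss \<subseteq> insert 1 Tset" "\<forall>n\<le>length ss. fat (x + sum_list (take n ss))" "has_sign x s"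
  shows "[F (x + sum_list ss) = F x + s * sum_list ss] (mod int k)"
  using assms
proof (induction ss arbitrary: x)
  case (Cons t ss)
  have fx: "fat x" using Cons.prems(2) by force
  have ft: "fat (x + t)" using Cons.prems(2)[rule_format, of 1] by simp
  have st: "has_sign (x + t) s \<and> [F (x + t) = F x + s * t] (mod int k)"
  proof (cases "t = 1")
    case True
    then show ?thesis using has_sign_one[of x s] ft Cons.prems(3) by simp
  next
    case False
    then have "t \<in> Tset" using Cons.prems(1) by simp
    then show ?thesis using has_sign_T fx ft Cons.prems(3) by blast
  qed
  have "\<forall>n\<le>length ss. fat (x + t + sum_list (take n ss))"
  proof (intro allI impI)
    fix n assume "n \<le> length ss"
    then show "fat (x + t + sum_list (take n ss))" using Cons.prems(2)[rule_format, of "Suc n"] by (simp add: add.assoc)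
  qed
  then have "[F (x + t + sum_list ss) = F (x + t) + s * sum_list ss] (mod int k)"
    using Cons.IH[of "x + t"] Cons.prems(1) st by simp
  also have "[F (x + t) + s * sum_list ss = F x + s * t + s * sum_list ss] (mod int k)"
    using st by (intro cong_add) auto
  finally show ?case by (simp add: algebra_simps)
qed simp

section \<open>Counting spoiled paths\<close>

definition nonfat :: "int set" where "nonfat = {x \<in> Zmod k. \<not> fat x}"

lemma card_nonfat: "card nonfat \<le> 3 * (k - card X)"
proof -
  have k0: "k > 0" using k2 by simp
  define W where "W = Zmod k - X"
  have W: "card W = k - card X" "finite W" unfolding W_def using XZ by (simp_all add: card_Diff_subset finite_subset_Zmod)
  have "nonfat \<subseteq> shift k 0 W \<union> (shift k 1 W \<union> shift k (-1) W)"
  proof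
    fix x assume x: "x \<in> nonfat"
    then have xZ: "x \<in> Zmod k" unfolding nonfat_def by simp
    have m: "x \<in> shift k t W" if "\<not> inX (x - t)" for t
    proof -
      have "(x - t) mod int k \<in> W" using that k0 unfolding W_def inX_def Zmod_def by simp
      moreover have "x = ((x - t) mod int k + t) mod int k" using xZ by (simp add: Zmod_def mod_simps)
      ultimately show ?thesis unfolding shift_def by blast
    qed
    have "\<not> inX (x - 0) \<or> \<not> inX (x - 1) \<or> \<not> inX (x - (-1))" using x unfolding nonfat_def fat_def by simp
    then show "x \<in> shift k 0 W \<union> (shift k 1 W \<union> shift k (-1) W)" using m by blast
  qed
  then have "card nonfat \<le> card (shift k 0 W \<union> (shift k 1 W \<union> shift k (-1) W))"
    using W(2) by (intro card_mono) (simp_all add: shift_def)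
  also have "\<dots> \<le> card (shift k 0 W) + (card (shift k 1 W) + card (shift k (-1) W))"
    using card_Un_le[of "shift k 0 W" "shift k 1 W \<union> shift k (-1) W"] card_Un_le[of "shift k 1 W" "shift k (-1) W"] by linarith
  also have "\<dots> \<le> 3 * card W"
  proof -
    have "card (shift k t W) \<le> card W" for t unfolding shift_def using W(2) by (rule card_image_le)
    from this[of 0] this[of 1] this[of "-1"] show ?thesis by linarith
  qed
  finally show ?thesis unfolding W(1) .
qed

lemma card_bad_starts:
  "card {x \<in> Zmod k. \<exists>n\<le>length ss. \<not> fat (x + sum_list (take n ss))} \<le> (length ss + 1) * (3 * (k - card X))"
proof -
  have k0: "k > 0" using k2 by simp
  have "{x \<in> Zmod k. \<exists>n\<le>length ss. \<not> fat (x + sum_list (take n ss))}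
    \<subseteq> (\<Union>n\<in>{..length ss}. shift k (- sum_list (take n ss)) nonfat)"
  proof
    fix x assume "x \<in> {x \<in> Zmod k. \<exists>n\<le>length ss. \<not> fat (x + sum_list (take n ss))}"
    then obtain n where x: "x \<in> Zmod k" and n: "n \<le> length ss" "\<not> fat (x + sum_list (take n ss))" by blast
    let ?y = "(x + sum_list (take n ss)) mod int k"
    have "inX ?y = inX (x + sum_list (take n ss))" "inX (?y - 1) = inX (x + sum_list (take n ss) - 1)"
      "inX (?y + 1) = inX (x + sum_list (take n ss) + 1)"
      unfolding inX_def by (simp_all add: mod_simps)
    then have "?y \<in> nonfat" using n(2) k0 unfolding nonfat_def fat_def Zmod_def by simp
    moreover have "x = (?y + - sum_list (take n ss)) mod int k" using x by (simp add: Zmod_def mod_simps)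
    ultimately have "x \<in> shift k (- sum_list (take n ss)) nonfat" unfolding shift_def by blast
    then show "x \<in> (\<Union>n\<in>{..length ss}. shift k (- sum_list (take n ss)) nonfat)" using n(1) by blast
  qed
  moreover have fn: "finite nonfat" by (rule finite_subset_Zmod[of _ k]) (auto simp: nonfat_def)
  ultimately have "card {x \<in> Zmod k. \<exists>n\<le>length ss. \<not> fat (x + sum_list (take n ss))}
    \<le> card (\<Union>n\<in>{..length ss}. shift k (- sum_list (take n ss)) nonfat)"
    by (intro card_mono) (auto simp: shift_def)
  also have "\<dots> \<le> (\<Sum>n\<in>{..length ss}. card (shift k (- sum_list (take n ss)) nonfat))"
    by (rule card_UN_le) simp
  also have "\<dots> \<le> (\<Sum>n\<in>{..length ss}. 3 * (k - card X))"
  proof (rule sum_mono)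
    fix n
    have "card (shift k (- sum_list (take n ss)) nonfat) \<le> card nonfat"
      unfolding shift_def by (rule card_image_le[OF fn])
    then show "card (shift k (- sum_list (take n ss)) nonfat) \<le> 3 * (k - card X)" using card_nonfat by simp
  qed
  also have "\<dots> = (length ss + 1) * (3 * (k - card X))" by simp
  finally show ?thesis .
qed

text \<open>Each t has at most b starting points from which its path meets a vertex that is not fat.
  Averaging over the starting points gives one base point \<open>x0\<close> with at most b spoiled
  targets, and f is affine on all targets reached from it.\<close>

lemma affine_on_most:
  assumes paths: "\<And>t. t \<in> Zmod k \<Longrightarrow> \<exists>ss. set ss \<subseteq> insert 1 Tset \<and> sum_list ss = t \<and> length ss \<le> N"
    and b: "b = (N + 1) * (3 * (k - card X))" "b < k"
  shows "\<exists>s c Y. s \<in> {1, -1} \<and> Y \<subseteq> X \<and> k \<le> card Y + b \<and> (\<forall>y\<in>Y. [f y = s * y + c] (mod int k))"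
proof -
  have k0: "k > 0" using k2 by simp
  obtain ss where ss: "\<And>t. t \<in> Zmod k \<Longrightarrow> set (ss t) \<subseteq> insert 1 Tset \<and> sum_list (ss t) = t \<and> length (ss t) \<le> N"
    using paths by metis
  define bad where "bad x t \<longleftrightarrow> (\<exists>n\<le>length (ss t). \<not> fat (x + sum_list (take n (ss t))))" for x t
  have "(\<Sum>x\<in>Zmod k. card {t \<in> Zmod k. bad x t}) = (\<Sum>t\<in>Zmod k. card {x \<in> Zmod k. bad x t})"
    by (rule sum_multicount_gen) simp_all
  also have "\<dots> \<le> (\<Sum>t\<in>Zmod k. b)"
  proof (rule sum_mono)
    fix t assume t: "t \<in> Zmod k"
    have "card {x \<in> Zmod k. bad x t} \<le> (length (ss t) + 1) * (3 * (k - card X))"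
      unfolding bad_def by (rule card_bad_starts)
    also have "\<dots> \<le> b" unfolding b(1) using ss[OF t] by (intro mult_right_mono) auto
    finally show "card {x \<in> Zmod k. bad x t} \<le> b" .
  qed
  also have "\<dots> = k * b" by simp
  finally have tot: "(\<Sum>x\<in>Zmod k. card {t \<in> Zmod k. bad x t}) \<le> k * b" .
  have "\<exists>x\<in>Zmod k. card {t \<in> Zmod k. bad x t} \<le> b"
  proof (rule ccontr)
    assume "\<not> ?thesis"
    then have "(\<Sum>x\<in>Zmod k. Suc b) \<le> (\<Sum>x\<in>Zmod k. card {t \<in> Zmod k. bad x t})"
      by (intro sum_mono) (auto simp: not_le Suc_le_eq)
    then have "k * Suc b \<le> k * b" using tot by simp
    then show False using k0 by simp
  qed
  then obtain x0 where x0: "x0 \<in> Zmod k" "card {t \<in> Zmod k. bad x0 t} \<le> b" by blast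
  define G where "G = {t \<in> Zmod k. \<not> bad x0 t}"
  have "card (Zmod k) = card G + card {t \<in> Zmod k. bad x0 t}"
  proof -
    have "Zmod k = G \<union> {t \<in> Zmod k. bad x0 t}" unfolding G_def by blast
    moreover have "card (G \<union> {t \<in> Zmod k. bad x0 t}) = card G + card {t \<in> Zmod k. bad x0 t}"
      unfolding G_def by (rule card_Un_disjoint) auto
    ultimately show ?thesis by simp
  qed
  then have G: "k \<le> card G + b" using x0(2) by simp
  \<comment> \<open>An unspoiled path passes through its own base point, so \<open>x0\<close> is fat
    and has an orientation; this is where b < k enters.\<close>
  then have "G \<noteq> {}" using b(2) by auto
  then obtain t0 where "t0 \<in> G" by blast
  then have "fat (x0 + sum_list (take 0 (ss t0)))" unfolding G_def bad_def by blast
  then have "fat x0" by simp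
  then obtain s where s: "has_sign x0 s" using fat_has_sign by blast
  define c where "c = F x0 - s * x0"
  define Y where "Y = shift k x0 G"
  have path: "[F (x0 + t) = F x0 + s * t] (mod int k) \<and> inX (x0 + t)" if t: "t \<in> G" for t
  proof -
    have tZ: "t \<in> Zmod k" and fatp: "\<forall>n\<le>length (ss t). fat (x0 + sum_list (take n (ss t)))"
      using t unfolding G_def bad_def by auto
    have "fat (x0 + sum_list (take (length (ss t)) (ss t)))" using fatp by blast
    then have "inX (x0 + t)" using ss[OF tZ] unfolding fat_def by simp
    moreover have "[F (x0 + sum_list (ss t)) = F x0 + s * sum_list (ss t)] (mod int k)"
      by (rule path_affine[OF _ fatp s]) (use ss[OF tZ] in blast)
    ultimately show ?thesis using ss[OF tZ] by simp
  qed
  have "s \<in> {1, -1}" using s unfolding has_sign_def by simp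
  moreover have "Y \<subseteq> X" unfolding Y_def shift_def using path unfolding inX_def by (auto simp: add.commute)
  moreover have "card Y = card G" unfolding Y_def by (rule card_shift[OF k0]) (auto simp: G_def)
  moreover have "\<forall>y\<in>Y. [f y = s * y + c] (mod int k)"
  proof
    fix y assume "y \<in> Y"
    then obtain t where t: "t \<in> G" "y = (t + x0) mod int k" unfolding Y_def shift_def by blast
    have "f y = F (x0 + t)" unfolding F_def t(2) by (simp add: add.commute)
    also have "[F (x0 + t) = F x0 + s * t] (mod int k)" using path[OF t(1)] by blast
    also have "[F x0 + s * t = s * y + c] (mod int k)"
    proof -
      have "[y = t + x0] (mod int k)" unfolding t(2) by (simp add: Cong.cong_def)
      then have "[s * y + c = s * (t + x0) + c] (mod int k)" by (intro cong_add cong_mult) auto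
      then show ?thesis unfolding c_def by (simp add: algebra_simps cong_sym_eq)
    qed
    finally show "[f y = s * y + c] (mod int k)" .
  qed
  ultimately show ?thesis using G by (intro exI[of _ s] exI[of _ c] exI[of _ Y]) simp
qed

end

text \<open>Greedy expansion: take \<open>t div U n\<close> copies of the largest scale, at most B
  of them by the ratio bound, and expand the remainder in the smaller scales. It ends at remainder 0
  because \<open>U 0 = 1\<close>.\<close>

lemma exists_step_list:
  fixes U :: "nat \<Rightarrow> int"
  assumes "U 0 = 1" "\<And>i. i < n \<Longrightarrow> 1 \<le> U i" "\<And>i. i < n \<Longrightarrow> U (Suc i) \<le> int B * U i"
  shows "\<lbrakk>0 \<le> t; t < U n\<rbrakk> \<Longrightarrow> \<exists>ss. set ss \<subseteq> U ` {..<n} \<and> sum_list ss = t \<and> length ss \<le> n * B"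
  using assms
proof (induction n arbitrary: t)
  case 0
  then show ?case by (intro exI[of _ "[]"]) simp
next
  case (Suc n)
  have U: "1 \<le> U n" "U (Suc n) \<le> int B * U n" using Suc.prems(4,5) by auto
  define q where "q = nat (t div U n)"
  have q: "int q = t div U n" unfolding q_def using Suc.prems(1) U by (simp add: pos_imp_zdiv_nonneg_iff)
  have "t div U n \<le> int B"
  proof -
    have "t < int B * U n" using Suc.prems(2) U(2) by linarith
    moreover have "t div U n * U n \<le> t" using U(1) div_mult_mod_eq[of t "U n"] pos_mod_sign[of "U n" t] by linarith
    ultimately have "t div U n * U n < int B * U n" by linarith
    then show ?thesis using U(1) by (simp add: mult_less_cancel_right)
  qed
  then have qB: "q \<le> B" using q by linarith
  have "\<exists>ss. set ss \<subseteq> U ` {..<n} \<and> sum_list ss = t mod U n \<and> length ss \<le> n * B"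
  proof (rule Suc.IH)
    show "0 \<le> t mod U n" "t mod U n < U n" using U(1) by simp_all
  qed (use Suc.prems(3,4,5) in simp_all)
  then obtain ss where ss: "set ss \<subseteq> U ` {..<n}" "sum_list ss = t mod U n" "length ss \<le> n * B" by blast
  have "sum_list (replicate q (U n) @ ss) = t" using q ss(2) by (simp add: sum_list_replicate mult.commute)
  moreover have "set (replicate q (U n) @ ss) \<subseteq> U ` {..<Suc n}" using ss(1) by auto
  moreover have "length (replicate q (U n) @ ss) \<le> Suc n * B" using qB ss(3) by simp
  ultimately show ?case by blast
qed

section \<open>Rigidity of the construction\<close>

text \<open>f matches the common neighbours inside X with those inside f(X). Each codegree exceeds
  this shared number by at most k - card X, so the missing vertices are charged only once.\<close>

lemma common_nbrs_transport:
  assumes emb: "induced_embedding (Zmod k) (cayley_adj k S) X f" and xy: "x \<in> X" "y \<in> X"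
  shows "\<bar>real (card (common_nbrs k S x y)) - real (card (common_nbrs k S (f x) (f y)))\<bar> \<le> k - card X"
proof -
  have X: "X \<subseteq> Zmod k" "f ` X \<subseteq> Zmod k" "inj_on f X"
    and adj: "\<And>x y. \<lbrakk>x \<in> X; y \<in> X; x \<noteq> y\<rbrakk> \<Longrightarrow> cayley_adj k S x y = cayley_adj k S (f x) (f y)"
    using emb unfolding induced_embedding_def by blast+
  have adj': "cayley_adj k S x z = cayley_adj k S (f x) (f z)" if "x \<in> X" "z \<in> X" for x z
  proof (cases "x = z")
    case True
    then show ?thesis unfolding cayley_adj_def by simp
  qed (rule adj[OF that])
  have bound: "card C \<le> card (C \<inter> Z) + (k - card Z)" "card (C \<inter> Z) \<le> card C"
    if "C \<subseteq> Zmod k" "Z \<subseteq> Zmod k" for C Z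
  proof -
    have fin: "finite C" "finite Z" using that finite_subset_Zmod by blast+
    have "card C \<le> card ((C \<inter> Z) \<union> (Zmod k - Z))" using that fin by (intro card_mono) auto
    also have "\<dots> \<le> card (C \<inter> Z) + card (Zmod k - Z)" by (rule card_Un_le)
    also have "card (Zmod k - Z) = k - card Z" using that fin by (simp add: card_Diff_subset)
    finally show "card C \<le> card (C \<inter> Z) + (k - card Z)" .
    show "card (C \<inter> Z) \<le> card C" using fin by (intro card_mono) auto
  qed
  have "f ` (common_nbrs k S x y \<inter> X) = common_nbrs k S (f x) (f y) \<inter> f ` X"
    unfolding common_nbrs_def using adj'[OF xy(1)] adj'[OF xy(2)] by auto
  moreover have "inj_on f (common_nbrs k S x y \<inter> X)" using X(3) by (rule inj_on_subset) auto
  ultimately have "card (common_nbrs k S x y \<inter> X) = card (common_nbrs k S (f x) (f y) \<inter> f ` X)"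
    by (metis card_image)
  moreover have "card (f ` X) = card X" using X(3) by (rule card_image)
  ultimately show ?thesis
    using bound[OF common_nbrs_subset[of k S x y] X(1)] bound[OF common_nbrs_subset[of k S "f x" "f y"] X(2)]
    by simp
qed

context sidon_construction
begin

lemma T1_gt: "4 < T_val k 1"
proof -
  have "0 \<le> int L * int (greedy_sidon L)" by simp
  then have "4 \<le> 4 * (int L * int (greedy_sidon L) + 1)" by (simp only: distrib_left)
  then show ?thesis using T_large by (rule le_less_trans)
qed

lemma lacunary_T:
  fixes c :: "nat \<Rightarrow> int"
  assumes "\<And>i. i \<in> {1..6} \<Longrightarrow> \<bar>c i\<bar> \<le> 4" "\<bar>c0\<bar> \<le> 4" "int k dvd (\<Sum>i = 1..6. c i * T_val k i) + c0"
  shows "c0 = 0 \<and> (\<forall>i\<in>{1..6}. c i = 0)"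
proof (rule lacunary_zero_mod[of 6 "\<lambda>i. if i = 7 then int k else T_val k i"])
  fix i :: nat assume i: "i \<in> {1..6}"
  show "5 * (if i = 7 then int k else T_val k i) \<le> (if Suc i = 7 then int k else T_val k (Suc i))"
  proof (cases "i = 6")
    case False
    then show ?thesis using i T_lacunary[of i] by auto
  qed (use T_small in simp)
next
  have "\<bar>c0\<bar> < T_val k 1" using T1_gt assms(2) by linarith
  then show "\<bar>c0\<bar> < (if 1 = (7::nat) then int k else T_val k 1)" by simp
next
  have "(\<Sum>i = 1..6. c i * (if i = 7 then int k else T_val k i)) = (\<Sum>i = 1..6. c i * T_val k i)"
    by (rule sum.cong) auto
  then show "(if Suc 6 = 7 then int k else T_val k (Suc 6)) dvd
      (\<Sum>i = 1..6. c i * (if i = 7 then int k else T_val k i)) + c0" using assms(3) by simp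
qed (use assms(1) in auto)

lemma T_pos: "i \<in> {1..6} \<Longrightarrow> 5 \<le> T_val k i"
proof -
  have "1 \<le> i \<Longrightarrow> i \<le> 6 \<Longrightarrow> 5 \<le> T_val k i" for i
  proof (induction i rule: dec_induct)
    case (step n)
    then show ?case using T_lacunary[of n] by simp
  qed (use T1_gt in simp)
  then show "i \<in> {1..6} \<Longrightarrow> 5 \<le> T_val k i" by simp
qed

lemma T_upper: "i \<in> {1..6} \<Longrightarrow> 5 * T_val k i \<le> int k"
proof -
  have "i \<le> 6 \<Longrightarrow> 1 \<le> i \<Longrightarrow> 5 * T_val k i \<le> int k" for i
  proof (induction i rule: inc_induct)
    case (step n)
    then have "5 * T_val k (Suc n) \<le> int k" by simp
    moreover have "5 * T_val k n \<le> T_val k (Suc n)" using step T_lacunary[of n] by simp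
    moreover have "5 \<le> T_val k (Suc n)" using T_pos[of "Suc n"] step by simp
    ultimately show ?case by linarith
  qed (rule T_small)
  then show "i \<in> {1..6} \<Longrightarrow> 5 * T_val k i \<le> int k" by simp
qed

abbreviation "S \<equiv> conn_set M L k"

lemma T_plus_mem: "i \<in> {1..6} \<Longrightarrow> (T_val k i + 1) mod int k \<in> S"
proof -
  assume i: "i \<in> {1..6}"
  have "(T_val k i + 1) mod int k \<in> D_plus k" unfolding D_plus_def residues_of_def using i by blast
  moreover have "(T_val k i + 1) mod int k \<notin> D_minus k"
  proof
    assume "(T_val k i + 1) mod int k \<in> D_minus k"
    then obtain j \<tau> where j: "j \<in> {1..6}" "\<tau> \<in> {1, -1 :: int}" "(T_val k i + 1) mod int k = (\<tau> * (T_val k j - 1)) mod int k"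
      unfolding D_minus_def residues_of_def by force
    define c :: "nat \<Rightarrow> int" where "c h = (if h = i then 1 else 0) - (if h = j then \<tau> else 0)" for h
    have "(\<Sum>h = 1..6. c h * T_val k h) = (\<Sum>h = 1..6. if h = i then T_val k h else 0) - (\<Sum>h = 1..6. if h = j then \<tau> * T_val k h else 0)"
      unfolding c_def sum_subtractf[symmetric] by (rule sum.cong) (auto simp: algebra_simps)
    also have "\<dots> = T_val k i - \<tau> * T_val k j" using i j(1) by simp
    finally have e: "(\<Sum>h = 1..6. c h * T_val k h) + (1 + \<tau>) = T_val k i + 1 - \<tau> * (T_val k j - 1)"
      by (simp add: algebra_simps)
    have "int k dvd (\<Sum>h = 1..6. c h * T_val k h) + (1 + \<tau>)" unfolding e using j(3) by (simp only: mod_eq_dvd_iff)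
    then have z: "1 + \<tau> = 0 \<and> (\<forall>h\<in>{1..6}. c h = 0)"
      by (intro lacunary_T) (use j(2) in \<open>auto simp: c_def\<close>)
    then have "\<tau> = -1" "c i = 0" using i by auto
    \<comment> \<open>With \<tau> = -1 the coefficient \<open>c i\<close> is 1 or 2.\<close>
    then show False unfolding c_def by (auto split: if_splits)
  qed
  ultimately show ?thesis unfolding conn_set_def by blast
qed

lemma T_minus_mem: "i \<in> {1..6} \<Longrightarrow> (T_val k i - 1) mod int k \<notin> S"
  unfolding conn_set_def D_minus_def residues_of_def by blast

lemma conn_set_near_Q:
  "(S - Q_set k A0) \<union> (Q_set k A0 - S) \<subseteq> insert 0 (D_plus k \<union> D_minus k)"
  unfolding conn_set_def by blast

text \<open>Twelve residues for each of the two correction sets, and 0, which is removed from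
  Q.\<close>

lemma exception_card: "finite (insert 0 (D_plus k \<union> D_minus k)) \<and> card (insert 0 (D_plus k \<union> D_minus k)) \<le> 25"
proof -
  have c: "finite (residues_of k (\<Union>i\<in>{1..6}. {a i, - a i})) \<and> card (residues_of k (\<Union>i\<in>{1..6}. {a i, - a i})) \<le> 12"
    for a :: "nat \<Rightarrow> int"
  proof -
    have fin: "finite (\<Union>i\<in>{1..6}. {a i, - a i})" by blast
    have "card (\<Union>i\<in>{1..6}. {a i, - a i}) \<le> (\<Sum>i\<in>{1..6::nat}. card {a i, - a i})"
      by (rule card_UN_le) simp
    also have "\<dots> \<le> (\<Sum>i\<in>{1..6::nat}. 2)" by (rule sum_mono) (simp add: card_insert_le_m1)
    finally have "card (\<Union>i\<in>{1..6}. {a i, - a i}) \<le> 12" by simp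
    then show ?thesis unfolding residues_of_def using card_image_le[OF fin, of "\<lambda>a. a mod int k"] fin by simp
  qed
  from c[of "\<lambda>i. T_val k i + 1"] c[of "\<lambda>i. T_val k i - 1"]
  have "finite (D_plus k)" "card (D_plus k) \<le> 12" "finite (D_minus k)" "card (D_minus k) \<le> 12"
    unfolding D_plus_def D_minus_def by blast+
  then show ?thesis using card_Un_le[of "D_plus k" "D_minus k"] by (simp add: card_insert_if)
qed

text \<open>B bounds the ratio of consecutive scales among 1, T_1, ..., T_6, k, so paths have at
  most 7 B steps, and b bounds the number of vertices where f is not yet known to be affine. The
  codegree tolerance \<eta> must also absorb one more vertex, the one whose image is being
  identified.\<close>

lemma rigidity:
  assumes k: "prime k" "[k = 1] (mod 4)"
    and det: "\<And>u v u' v'. \<lbrakk>u \<in> Zmod k; v \<in> Zmod k; u' \<in> Zmod k; v' \<in> Zmod k;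
      \<bar>real (card (common_nbrs k S u v)) - real (card (common_nbrs k S u' v'))\<bar> \<le> \<eta>\<rbrakk>
      \<Longrightarrow> diff_count k A0 (u - v) = diff_count k A0 (u' - v')"
    and B: "T_val k 1 \<le> int B" "\<And>i. i \<in> {1..5} \<Longrightarrow> T_val k (Suc i) \<le> int B * T_val k i" "int k \<le> int B * T_val k 6"
    and emb: "induced_embedding (Zmod k) (H_adj M L k) X f"
    and b: "b = (7 * B + 1) * (3 * (k - card X))" "real b + 1 \<le> \<eta>" "b < k"
  shows "\<exists>\<sigma>\<in>{1, - 1}. \<exists>c\<in>Zmod k. \<forall>x\<in>X. f x = (\<sigma> * x + c) mod int k"
proof -
  have X: "X \<subseteq> Zmod k" "f ` X \<subseteq> Zmod k" "inj_on f X"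
    and adj: "\<And>x y. \<lbrakk>x \<in> X; y \<in> X; x \<noteq> y\<rbrakk> \<Longrightarrow> H_adj M L k x y = H_adj M L k (f x) (f y)"
    using emb unfolding induced_embedding_def by blast+
  have k2: "k > 2" using T_upper[of 1] T_pos[of 1] by simp
  have wb: "k - card X \<le> b" unfolding b(1) by simp
  have dc: "diff_count k A0 (y - x) = diff_count k A0 (f y - f x)" if "x \<in> X" "y \<in> X" for x y
  proof (rule det)
    show "\<bar>real (card (common_nbrs k S y x)) - real (card (common_nbrs k S (f y) (f x)))\<bar> \<le> \<eta>"
      using common_nbrs_transport[OF emb that(2,1)] wb b(2) by linarith
  qed (use that X in auto)
  interpret local_rigidity k S X "T_val k ` {1..6}" f
  proof
    show "(- x) mod int k \<in> S" if "x \<in> S" for x using conn_sym[OF k that] .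
    show "[f y - f x = 1] (mod int k) \<or> [f y - f x = - 1] (mod int k)"
      if "x \<in> X" "y \<in> X" "[y - x = 1] (mod int k)" for x y
      using diff_count_eq_one[of "f y - f x"] dc[OF that(1,2)] diff_count_cong[OF that(3), of A0] by simp
    show "[f y - f x = t] (mod int k) \<or> [f y - f x = - t] (mod int k)"
      if t: "t \<in> T_val k ` {1..6}" and h: "x \<in> X" "y \<in> X" "[y - x = t] (mod int k)" for t x y
    proof -
      obtain i where i: "i \<in> {1..6}" "t = T_val k i" using t by blast
      show ?thesis using diff_count_eq_T[OF i(1), of "f y - f x"] dc[OF h(1,2)] diff_count_cong[OF h(3), of A0] i(2) by simp
    qed
    show "(t + 1) mod int k \<in> S" if "t \<in> T_val k ` {1..6}" for t using that T_plus_mem by blast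
    show "(t - 1) mod int k \<notin> S" if "t \<in> T_val k ` {1..6}" for t using that T_minus_mem by blast
    show "1 \<le> t \<and> t + 1 < int k" if t: "t \<in> T_val k ` {1..6}" for t
    proof -
      obtain i where i: "i \<in> {1..6}" "t = T_val k i" using t by blast
      show ?thesis using T_pos[OF i(1)] T_upper[OF i(1)] unfolding i(2) by linarith
    qed
  qed (use k2 X emb in auto)
  \<comment> \<open>Steps are taken from the seven scales U 0 to U 6; \<open>U 7\<close> is only the
    upper end of the range.\<close>
  define U where "U i = (if i = 0 then 1 else if i = 7 then int k else T_val k i)" for i :: nat
  have paths: "\<exists>ss. set ss \<subseteq> insert 1 (T_val k ` {1..6}) \<and> sum_list ss = t \<and> length ss \<le> 7 * B" if "t \<in> Zmod k" for t
  proof -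
    have "\<exists>ss. set ss \<subseteq> U ` {..<7} \<and> sum_list ss = t \<and> length ss \<le> 7 * B"
    proof (rule exists_step_list)
      show "0 \<le> t" "t < U 7" using that unfolding Zmod_def U_def by auto
      show "U 0 = 1" by (simp add: U_def)
      fix i :: nat assume i: "i < 7"
      show "1 \<le> U i" using i T_pos[of i] unfolding U_def by auto
      consider "i = 0" | "i = 6" | "i \<in> {1..5}" using i by force
      then show "U (Suc i) \<le> int B * U i"
        by cases (use B in \<open>auto simp: U_def\<close>)
    qed
    moreover have "U ` {..<7} \<subseteq> insert 1 (T_val k ` {1..6})" unfolding U_def by auto
    ultimately show ?thesis by blast
  qed
  from affine_on_most[OF paths b(1) b(3)] obtain s c Y where
    s: "s \<in> {1, -1}" and Y: "Y \<subseteq> X" "k \<le> card Y + b" "\<forall>y\<in>Y. [f y = s * y + c] (mod int k)" by blast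
  define g where "g x = (s * x + c) mod int k" for x
  have fg: "f y = g y" if "y \<in> Y" for y
  proof -
    have "f y \<in> Zmod k" using that Y(1) X(2) by blast
    then have "f y = f y mod int k" by (simp add: Zmod_def)
    also have "\<dots> = (s * y + c) mod int k" using Y(3) that unfolding Cong.cong_def by blast
    finally show ?thesis unfolding g_def .
  qed
  have gZ: "g x \<in> Zmod k" for x unfolding g_def Zmod_def using k2 by simp
  have ss: "s * s = 1" using s by auto
  have "f x = g x" if x: "x \<in> X" for x
  proof -
    let ?u = "g x" and ?v = "f x"
    have vZ: "?v \<in> Zmod k" using x X(2) by blast
    \<comment> \<open>Apart from at most b + 1 exceptions, a neighbour w of g(x) is g(z) with z in Y
      and z different from x. As g preserves adjacency, x is adjacent to z, so f(x) is adjacent to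
      f(z) = w.\<close>
    have sub: "common_nbrs k S ?u ?u - common_nbrs k S ?u ?v \<subseteq> g ` insert x (Zmod k - Y)"
    proof
      fix w assume w: "w \<in> common_nbrs k S ?u ?u - common_nbrs k S ?u ?v"
      then have w1: "H_adj M L k ?u w" "\<not> H_adj M L k ?v w" unfolding common_nbrs_def by auto
      then have wZ: "w \<in> Zmod k" unfolding cayley_adj_def by simp
      \<comment> \<open>The preimage of w under g, since s is its own inverse.\<close>
      define z where "z = (s * (w - c)) mod int k"
      have zZ: "z \<in> Zmod k" unfolding z_def Zmod_def using k2 by simp
      have "(s * z) mod int k = (s * (s * (w - c))) mod int k" unfolding z_def by (rule mod_mult_right_eq)
      then have "g z = (s * (s * (w - c)) + c) mod int k" unfolding g_def by (rule mod_add_cong) simp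
      also have "s * (s * (w - c)) = w - c" using ss by (simp flip: mult.assoc)
      also have "(w - c + c) mod int k = w" using wZ by (simp add: Zmod_def)
      finally have gz: "w = g z" by simp
      show "w \<in> g ` insert x (Zmod k - Y)"
      proof (rule ccontr)
        assume "w \<notin> g ` insert x (Zmod k - Y)"
        then have z: "z \<in> Y" "z \<noteq> x" using gz zZ by auto
        then have zX: "z \<in> X" using Y(1) by blast
        have "(w - ?u) mod int k \<in> S" using w1(1) unfolding cayley_adj_def by simp
        moreover have "(w - ?u) mod int k = (s * (z - x)) mod int k"
          unfolding gz g_def by (simp add: mod_simps algebra_simps)
        ultimately have "(s * (z - x)) mod int k \<in> S" by simp
        then have "(z - x) mod int k \<in> S"
        proof (cases "s = 1")
          case False
          then have "s = -1" using s by simp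
          then have "(- ((x - z) mod int k)) mod int k \<in> S"
            using conn_sym[OF k] \<open>(s * (z - x)) mod int k \<in> S\<close> by simp
          then show ?thesis by (simp add: mod_minus_eq)
        qed simp
        then have "H_adj M L k x z" using x zX z(2) X(1) unfolding cayley_adj_def by auto
        then have "H_adj M L k ?v (f z)" using adj[OF x zX] z(2) by blast
        then show False using w1(2) fg[OF z(1)] gz by simp
      qed
    qed
    have fY: "finite Y" using Y(1) X(1) finite_subset_Zmod by blast
    have "card (g ` insert x (Zmod k - Y)) \<le> card (insert x (Zmod k - Y))" by (rule card_image_le) simp
    also have "\<dots> \<le> Suc (card (Zmod k - Y))" by (rule card_insert_le_m1) auto
    also have "card (Zmod k - Y) = k - card Y" using fY Y(1) X(1) by (simp add: card_Diff_subset)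
    also have "Suc (k - card Y) \<le> b + 1" using Y(2) by simp
    finally have cb: "card (g ` insert x (Zmod k - Y)) \<le> b + 1" .
    have sub2: "common_nbrs k S ?u ?v \<subseteq> common_nbrs k S ?u ?u" unfolding common_nbrs_def by blast
    have fin: "finite (common_nbrs k S a c)" for a c by (rule finite_subset_Zmod[OF common_nbrs_subset])
    have "\<bar>real (card (common_nbrs k S ?u ?u)) - real (card (common_nbrs k S ?u ?v))\<bar> \<le> card (g ` insert x (Zmod k - Y))"
      by (rule card_abs_diff_le[OF fin fin]) (use sub sub2 in auto)
    then have "\<bar>real (card (common_nbrs k S ?u ?u)) - real (card (common_nbrs k S ?u ?v))\<bar> \<le> \<eta>"
      using cb b(2) by linarith
    \<comment> \<open>The codegree of g(x) with itself is its degree, so near equality forces the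
      value r(0), which belongs to the difference 0 alone.\<close>
    then have "diff_count k A0 (?u - ?u) = diff_count k A0 (?u - ?v)" by (rule det[OF gZ gZ gZ vZ])
    then have "[?u - ?v = 0] (mod int k)" using diff_count_eq_zero[of "?u - ?v"] by simp
    then have "?u mod int k = ?v mod int k" by (simp add: cong_0_iff mod_eq_dvd_iff)
    then show "?v = ?u" using gZ[of x] vZ by (simp add: Zmod_def)
  qed
  then have "\<forall>x\<in>X. f x = (s * x + c mod int k) mod int k" unfolding g_def by (simp add: mod_simps)
  moreover have "c mod int k \<in> Zmod k" unfolding Zmod_def using k2 by simp
  ultimately show ?thesis using s by blast
qed

end

section \<open>Size of the parameters for large k\<close>

lemma T_val_root:
  assumes "k > 0"
  shows "T_val k i = \<lfloor>(real k powr (1 / 7)) ^ i\<rfloor>"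
proof -
  have "real k powr (real i / 7) = (real k powr (1 / 7)) powr real i" by (simp add: powr_powr)
  then show ?thesis unfolding T_val_def using assms by (simp add: powr_realpow)
qed

lemma floor_power_lacunary:
  fixes R :: real
  assumes "R \<ge> 6"
  shows "5 * \<lfloor>R ^ i\<rfloor> \<le> \<lfloor>R ^ Suc i\<rfloor>"
proof -
  have "real_of_int (5 * \<lfloor>R ^ i\<rfloor>) \<le> 5 * R ^ i" by simp
  also have "\<dots> \<le> R ^ Suc i" using assms by simp
  finally show ?thesis by (simp only: le_floor_iff)
qed

text \<open>Rounding down a power that is at least 1 loses less than a factor 2, hence the
  requirement that B be at least 2 R.\<close>

lemma power_le_floor:
  fixes R :: real
  assumes "R \<ge> 6" and B: "2 * R \<le> real B"
  shows "R ^ Suc i \<le> real B * \<lfloor>R ^ i\<rfloor>"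
proof -
  have "R ^ i \<ge> 1" using assms by (intro one_le_power) simp
  then have "1 \<le> \<lfloor>R ^ i\<rfloor>" by (simp add: le_floor_iff)
  then have "1 \<le> real_of_int \<lfloor>R ^ i\<rfloor>" by simp
  then have "R ^ i \<le> 2 * \<lfloor>R ^ i\<rfloor>" using real_of_int_floor_add_one_gt[of "R ^ i"] by linarith
  then have "R * R ^ i \<le> R * (2 * \<lfloor>R ^ i\<rfloor>)" using assms by (intro mult_left_mono) auto
  also have "\<dots> = 2 * R * \<lfloor>R ^ i\<rfloor>" by simp
  also have "\<dots> \<le> real B * \<lfloor>R ^ i\<rfloor>" using B \<open>R ^ i \<ge> 1\<close> by (intro mult_right_mono) auto
  finally show ?thesis by simp
qed

text \<open>Path length times missing vertices has order k^(1/7 + 4/5) (log k)^(1/5), and 1/7 + 4/5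
  = 33/35 < 1. The factor 14 k^(1/7) + 8 bounds 7 B + 1 when B is at most 2 k^(1/7) + 1.\<close>

lemma eventually_error_small:
  fixes c :: real
  assumes "c > 0"
  shows "\<exists>K. \<forall>k\<ge>K. (14 * real k powr (1 / 7) + 8) * (3 * (delta k * k)) + 1 \<le> c * k"
proof -
  have "((\<lambda>x::real. ((14 * x powr (1 / 7) + 8) * (3 * (10 ^ 3 * ln x powr (1 / 5) * x powr (- (1 / 5)) * x)) + 1) / x) \<longlongrightarrow> 0) at_top"
    by real_asymp
  then have "eventually (\<lambda>x::real. ((14 * x powr (1 / 7) + 8) * (3 * (10 ^ 3 * ln x powr (1 / 5) * x powr (- (1 / 5)) * x)) + 1) / x < c) at_top"
    using assms by (rule order_tendstoD(2))
  moreover have "eventually (\<lambda>x::real. x > 0) at_top" by (rule eventually_gt_at_top)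
  ultimately have "eventually (\<lambda>x::real. (14 * x powr (1 / 7) + 8) * (3 * (10 ^ 3 * ln x powr (1 / 5) * x powr (- (1 / 5)) * x)) + 1 \<le> c * x) at_top"
    by eventually_elim (simp add: divide_less_eq)
  then have "eventually (\<lambda>k::nat. (14 * real k powr (1 / 7) + 8) * (3 * (10 ^ 3 * ln (real k) powr (1 / 5) * real k powr (- (1 / 5)) * real k)) + 1 \<le> c * real k) sequentially"
    by (rule eventually_compose_filterlim[OF _ filterlim_real_sequentially])
  then show ?thesis unfolding delta_def eventually_sequentially .
qed

theorem proposition2p3:
  fixes M :: "nat \<Rightarrow> nat" and L :: nat
  assumes "\<forall>i\<in>{1..6}. prime (M i) \<and> odd (M i)"
    and "11 \<le> M 1"
    and "strict_mono_on {1..6} M"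
    and "L > (\<Sum>i = 1..6. M i)"
  shows "\<exists>K. \<forall>k\<ge>K. prime k \<and> [k = 1] (mod 4) \<longrightarrow>
           (\<forall>X f. X \<subseteq> Zmod k \<and> real (card X) \<ge> (1 - delta k) * real k \<and>
                  induced_embedding (Zmod k) (H_adj M L k) X f \<longrightarrow>
              (\<exists>\<sigma>\<in>{1, - 1}. \<exists>b\<in>Zmod k. \<forall>x\<in>X. f x = (\<sigma> * x + b) mod int k))"
proof -
  \<comment> \<open>The size of \<open>A0\<close>; together with the tolerance \<open>c\<close>
    derived from it, it does not depend on k.\<close>
  define N where "N = 4 * (L + (\<Sum>i = 1..6. M i))"
  define c :: real where "c = 1 / 4 ^ N / 2"
  have c: "c > 0" "c < 1" 
  proof -
    have "(1 :: real) \<le> 4 ^ N" by simp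
    then have "1 < (4 ^ N :: real) * 2" by linarith
    then show "c > 0" "c < 1" unfolding c_def by (simp_all add: divide_less_eq)
  qed
  \<comment> \<open>A lower bound for k^(1/7) that supplies both \<open>T_large\<close>, with room
    for the floor, and the lacunarity condition R \<ge> 6.\<close>
  define C :: real where "C = 4 * (real L * real (greedy_sidon L) + 1) + 7"
  obtain K1 where K1: "\<forall>k\<ge>K1. prime k \<longrightarrow> (\<forall>A S E u v u' v'. A \<subseteq> Zmod k \<and> card A \<le> N \<and> finite E \<and> card E \<le> 25
    \<and> (S - Q_set k A) \<union> (Q_set k A - S) \<subseteq> E \<and> u \<in> Zmod k \<and> v \<in> Zmod k \<and> u' \<in> Zmod k \<and> v' \<in> Zmod k
    \<and> \<bar>real (card (common_nbrs k S u v)) - real (card (common_nbrs k S u' v'))\<bar> \<le> k / 4 ^ N / 2 \<longrightarrow>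
    diff_count k A (u - v) = diff_count k A (u' - v'))"
    using codegree_determines_diff_count[of N 25] by blast
  obtain K2 where K2: "\<forall>k\<ge>K2. (14 * real k powr (1 / 7) + 8) * (3 * (delta k * k)) + 1 \<le> c * k"
    using eventually_error_small[OF c(1)] by blast
  have "filterlim (\<lambda>k. real k powr (1 / 7)) at_top sequentially" by real_asymp
  then have "eventually (\<lambda>k. C \<le> real k powr (1 / 7)) sequentially" unfolding filterlim_at_top by blast
  then obtain K3 where K3: "\<forall>k\<ge>K3. C \<le> real k powr (1 / 7)" unfolding eventually_sequentially by blast
  show ?thesis
  proof (intro exI[of _ "max 1 (max K1 (max K2 K3))"] allI impI, elim conjE)
    fix k X f
    assume kK: "max 1 (max K1 (max K2 K3)) \<le> k" and k: "prime k" "[k = 1] (mod 4)"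
      and X: "X \<subseteq> Zmod k" "(1 - delta k) * real k \<le> real (card X)"
      and emb: "induced_embedding (Zmod k) (H_adj M L k) X f"
    define R where "R = real k powr (1 / 7)"
    have k0: "k > 0" using kK by simp
    have T: "T_val k i = \<lfloor>R ^ i\<rfloor>" for i unfolding R_def by (rule T_val_root[OF k0])
    have RC: "C \<le> R" using K3 kK unfolding R_def by simp
    have "0 \<le> real L * real (greedy_sidon L)" by simp
    then have "6 \<le> C" unfolding C_def by (simp only: distrib_left)
    then have R6: "R \<ge> 6" using RC by linarith
    have R7: "R ^ 7 = real k" unfolding R_def using k0 by (simp add: powr_power)
    interpret sidon_construction M L k
    proof
      show "odd (M i)" if "i \<in> {1..6}" for i using assms(1) that by blast
      show "11 \<le> M i" if "i \<in> {1..6}" for i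
        using assms(2) strict_mono_on_leD[OF assms(3), of 1 i] that by simp
      show "inj_on M {1..6}" using assms(3) by (rule strict_mono_on_imp_inj_on)
      show "L > (\<Sum>i = 1..6. M i)" by (rule assms(4))
      show "k > 0" by (rule k0)
      have "real_of_int (4 * (int L * int (greedy_sidon L) + 1) + 1) \<le> R" using RC unfolding C_def by simp
      then have "4 * (int L * int (greedy_sidon L) + 1) + 1 \<le> \<lfloor>R\<rfloor>" by (simp only: le_floor_iff)
      then show "4 * (int L * int (greedy_sidon L) + 1) < T_val k 1" unfolding T by simp
      show "5 * T_val k i \<le> T_val k (Suc i)" if "i \<in> {1..5}" for i
        unfolding T by (rule floor_power_lacunary[OF R6])
      have "5 * \<lfloor>R ^ 6\<rfloor> \<le> \<lfloor>R ^ Suc 6\<rfloor>" by (rule floor_power_lacunary[OF R6])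
      then show "5 * T_val k 6 \<le> int k" unfolding T using R7 by simp
    qed
    define B where "B = nat \<lceil>2 * R\<rceil>"
    have B: "2 * R \<le> real B" "real B \<le> 2 * R + 1" unfolding B_def using R6 by linarith+
    define b where "b = (7 * B + 1) * (3 * (k - card X))"
    have cX: "card X \<le> k" using card_mono[OF finite_Zmod X(1)] by simp
    have "real (k - card X) \<le> delta k * k" using X(2) cX by (simp add: of_nat_diff algebra_simps)
    moreover have "real (7 * B + 1) \<le> 14 * R + 8" using B(2) by simp
    ultimately have "real b \<le> (14 * R + 8) * (3 * (delta k * k))"
      unfolding b_def of_nat_mult by (intro mult_mono) (use R6 in auto)
    then have "real b + 1 \<le> c * k" using K2 kK unfolding R_def by fastforce
    then have b: "real b + 1 \<le> k / 4 ^ N / 2" unfolding c_def by simp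
    have "c * real k \<le> 1 * real k" using c(2) by (intro mult_right_mono) auto
    then have bk: "b < k" using \<open>real b + 1 \<le> c * k\<close> by linarith
    show "\<exists>\<sigma>\<in>{1, - 1}. \<exists>b\<in>Zmod k. \<forall>x\<in>X. f x = (\<sigma> * x + b) mod int k"
    proof (rule rigidity[OF k _ _ _ _ emb b_def b bk])
      show "diff_count k (A0_set M L k) (u - v) = diff_count k (A0_set M L k) (u' - v')"
        if "u \<in> Zmod k" "v \<in> Zmod k" "u' \<in> Zmod k" "v' \<in> Zmod k"
          "\<bar>real (card (common_nbrs k (conn_set M L k) u v)) - real (card (common_nbrs k (conn_set M L k) u' v'))\<bar> \<le> k / 4 ^ N / 2"
        for u v u' v'
      proof -
        have "card (A0_set M L k) \<le> N" unfolding card_A0 card_labels N_def by simp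
        moreover have "K1 \<le> k" using kK by simp
        ultimately show ?thesis
          using K1[rule_format, OF _ k(1), of "A0_set M L k" "insert 0 (D_plus k \<union> D_minus k)" "conn_set M L k" u v u' v']
            A0_subset exception_card conn_set_near_Q that by simp
      qed
      have pf: "\<lfloor>R ^ Suc i\<rfloor> \<le> int B * \<lfloor>R ^ i\<rfloor>" for i
      proof -
        have "real_of_int \<lfloor>R ^ Suc i\<rfloor> \<le> R ^ Suc i" by simp
        also have "\<dots> \<le> real_of_int (int B * \<lfloor>R ^ i\<rfloor>)" using power_le_floor[OF R6 B(1), of i] by simp
        finally show ?thesis by (simp only: of_int_le_iff)
      qed
      show "T_val k 1 \<le> int B" using pf[of 0] unfolding T by simp
      show "T_val k (Suc i) \<le> int B * T_val k i" for i unfolding T by (rule pf)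
      show "int k \<le> int B * T_val k 6" using pf[of 6] unfolding T using R7 by simp
    qed
  qed
qed

end
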